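(* Let $(R,\mathfrak m)$ be an equicharacteristic Cohen-Macaulay local ring with infinite residue field and let $I$ be an $\mathfrak m$-primary ideal. If $I$ is stretched, then $I$ is $j$-stretched on $R$.
   Context: $\lambda$ denotes length. A reduction of $I$ is an ideal $J\subseteq I$ with $I^{r+1}=JI^r$ for some $r\geq0$; it is minimal if it properly contains no other reduction of $I$. For $I$ $\mathfrak m$-primary and infinite residue field, every minimal reduction is generated by $d=\dim R$ elements. Stretched. An $\mathfrak m$-primary ideal $I$ is stretched if there exists a minimal reduction $J$ of $I$ such that (a) $J\cap I^2=JI$ and (b) $HF_{I/J}(2)\leq1$, where $HF_{I/J}(2)=\lambda\big((I^2+J)/(I^3+J)\big)=\lambda\big(I^2/((J\cap I^2)+I^3)\big)$ is the value at 2 of the Hilbert function of the ideal $I/J$ of $R/J$. General minimal reductions. Let $k=R/\mathfrak m$ and $I=(a_1,\ldots,a_n)$. A general minimal reduction is $J=(x_1,\ldots,x_d)$ with $x_i=\sum_j\lambda_{ij}a_j$, $\lambda_{ij}\in R$, where the image of $(\lambda_{ij})$ in $k^{dn}$ lies in a suitable dense Zariski open subset; an assertion holds for a general minimal reduction if there is a dense open $U\subseteq k^{dn}$ such that it holds for all $J$ coming from $U$. $j$-stretched. $I$ (with $\ell(I)=d=\dim R$, automatic here) is $j$-stretched on $R$ if for a general minimal reduction $J=(x_1,\ldots,x_d)$ of $I$ one has $\lambda(\overline I^2/(x_d\overline I+\overline I^3))\leq1$, where $\overline{I}=I\overline R$ and $\overline R=R/((x_1,\ldots,x_{d-1}):I^\infty)$.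 *)

theory Defs
  imports "HOL-Algebra.Algebra" "HOL-Library.Extended_Nat"
begin

section \<open>Length of modules\<close>

definition module_length :: "('a, 'b) ring_scheme \<Rightarrow> ('a, 'c, 'd) module_scheme \<Rightarrow> enat" where
  "module_length R M =
     Sup {enat n | n. \<exists>N. (\<forall>i\<le>n. submodule (N i) R M) \<and> (\<forall>i<n. N i \<subset> N (Suc i))}"

text \<open>The \<open>R\<close>-module \<open>A/B\<close> for ideals \<open>B \<subseteq> A\<close> of \<open>R\<close>. The fields \<open>mult\<close> and \<open>one\<close> are only
  present because module records extend ring records; they play no role.\<close>

definition quot_module :: "('a, 'b) ring_scheme \<Rightarrow> 'a set \<Rightarrow> 'a set \<Rightarrow> ('a, 'a set) module" where
  "quot_module R A B =
     \<lparr>carrier = (\<lambda>a. B +>\<^bsub>R\<^esub> a) ` A, monoid.mult = rcoset_mult R B, one = B +>\<^bsub>R\<^esub> \<one>\<^bsub>R\<^esub>,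
      ring.zero = B, add = set_add R,
      smult = (\<lambda>r T. \<Union>x\<in>T. B +>\<^bsub>R\<^esub> (r \<otimes>\<^bsub>R\<^esub> x))\<rparr>"


section \<open>Local rings\<close>

definition noetherian_local :: "('a, 'b) ring_scheme \<Rightarrow> 'a set \<Rightarrow> bool" where
  "noetherian_local R m \<longleftrightarrow> cring R \<and> noetherian_ring R \<and>
     maximalideal m R \<and> (\<forall>n. maximalideal n R \<longrightarrow> n = m)"

definition ring_characteristic :: "('a, 'b) ring_scheme \<Rightarrow> nat" where
  "ring_characteristic R =
     (if \<exists>n::nat. n > 0 \<and> [n] \<cdot>\<^bsub>R\<^esub> \<one>\<^bsub>R\<^esub> = \<zero>\<^bsub>R\<^esub>
      then LEAST n::nat. n > 0 \<and> [n] \<cdot>\<^bsub>R\<^esub> \<one>\<^bsub>R\<^esub> = \<zero>\<^bsub>R\<^esub> else 0)"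

definition equicharacteristic :: "('a, 'b) ring_scheme \<Rightarrow> 'a set \<Rightarrow> bool" where
  "equicharacteristic R m \<longleftrightarrow> ring_characteristic R = ring_characteristic (R Quot m)"

definition krull_dim :: "('a, 'b) ring_scheme \<Rightarrow> enat" where
  "krull_dim R =
     Sup {enat n | n. \<exists>P. (\<forall>i\<le>n. primeideal (P i) R) \<and> (\<forall>i<n. P i \<subset> P (Suc i))}"

definition regular_sequence :: "('a, 'b) ring_scheme \<Rightarrow> 'a list \<Rightarrow> bool" where
  "regular_sequence R xs \<longleftrightarrow> set xs \<subseteq> carrier R \<and> Idl\<^bsub>R\<^esub> (set xs) \<noteq> carrier R \<and>
     (\<forall>i<length xs. \<forall>a\<in>carrier R.
        xs ! i \<otimes>\<^bsub>R\<^esub> a \<in> Idl\<^bsub>R\<^esub> (set (take i xs)) \<longrightarrow> a \<in> Idl\<^bsub>R\<^esub> (set (take i xs)))"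

definition local_depth :: "('a, 'b) ring_scheme \<Rightarrow> 'a set \<Rightarrow> enat" where
  "local_depth R m = Sup {enat (length xs) | xs. set xs \<subseteq> m \<and> regular_sequence R xs}"

definition cohen_macaulay_local :: "('a, 'b) ring_scheme \<Rightarrow> 'a set \<Rightarrow> bool" where
  "cohen_macaulay_local R m \<longleftrightarrow> noetherian_local R m \<and> local_depth R m = krull_dim R"


section \<open>Ideals\<close>

definition ideal_radical :: "('a, 'b) ring_scheme \<Rightarrow> 'a set \<Rightarrow> 'a set" where
  "ideal_radical R I = {a \<in> carrier R. \<exists>n::nat. a [^]\<^bsub>R\<^esub> n \<in> I}"

definition primary_ideal :: "('a, 'b) ring_scheme \<Rightarrow> 'a set \<Rightarrow> bool" where
  "primary_ideal R I \<longleftrightarrow> ideal I R \<and> I \<noteq> carrier R \<and>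
     (\<forall>a\<in>carrier R. \<forall>b\<in>carrier R. a \<otimes>\<^bsub>R\<^esub> b \<in> I \<longrightarrow> a \<in> I \<or> b \<in> ideal_radical R I)"

definition primary_to :: "('a, 'b) ring_scheme \<Rightarrow> 'a set \<Rightarrow> 'a set \<Rightarrow> bool" where
  "primary_to R m I \<longleftrightarrow> primary_ideal R I \<and> ideal_radical R I = m"

abbreviation ideal_pow :: "('a, 'b) ring_scheme \<Rightarrow> 'a set \<Rightarrow> nat \<Rightarrow> 'a set" where
  "ideal_pow R I n \<equiv> I [^]\<^bsub>ideals_set R\<^esub> n"

text \<open>The saturation \<open>A : I\<^sup>\<infinity>\<close>.\<close>

definition ideal_saturation :: "('a, 'b) ring_scheme \<Rightarrow> 'a set \<Rightarrow> 'a set \<Rightarrow> 'a set" where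
  "ideal_saturation R A I =
     {r \<in> carrier R. \<exists>n. \<forall>y \<in> ideal_pow R I n. r \<otimes>\<^bsub>R\<^esub> y \<in> A}"

definition reduction :: "('a, 'b) ring_scheme \<Rightarrow> 'a set \<Rightarrow> 'a set \<Rightarrow> bool" where
  "reduction R J I \<longleftrightarrow> ideal J R \<and> J \<subseteq> I \<and>
     (\<exists>r. ideal_pow R I (Suc r) = J \<cdot>\<^bsub>R\<^esub> ideal_pow R I r)"

definition minimal_reduction :: "('a, 'b) ring_scheme \<Rightarrow> 'a set \<Rightarrow> 'a set \<Rightarrow> bool" where
  "minimal_reduction R J I \<longleftrightarrow> reduction R J I \<and> (\<forall>K. reduction R K I \<longrightarrow> \<not> K \<subset> J)"


section \<open>Stretched ideals\<close>

text \<open>The Hilbert function of the ideal \<open>I/J\<close> of \<open>R/J\<close>, expressed through ideals of \<open>R\<close>.\<close>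

definition hilbert_fun_mod :: "('a, 'b) ring_scheme \<Rightarrow> 'a set \<Rightarrow> 'a set \<Rightarrow> nat \<Rightarrow> enat" where
  "hilbert_fun_mod R I J n =
     module_length R
       (quot_module R (ideal_pow R I n <+>\<^bsub>R\<^esub> J) (ideal_pow R I (Suc n) <+>\<^bsub>R\<^esub> J))"

definition stretched :: "('a, 'b) ring_scheme \<Rightarrow> 'a set \<Rightarrow> bool" where
  "stretched R I \<longleftrightarrow>
     (\<exists>J. minimal_reduction R J I \<and> J \<inter> ideal_pow R I 2 = J \<cdot>\<^bsub>R\<^esub> I \<and>
          hilbert_fun_mod R I J 2 \<le> 1)"


section \<open>Zariski topology on \<open>k\<^sup>S\<close> for a finite index set \<open>S\<close>\<close>

inductive_set poly_funs :: "('a, 'b) ring_scheme \<Rightarrow> 'i set \<Rightarrow> (('i \<Rightarrow> 'a) \<Rightarrow> 'a) set"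
  for K and S where
  const: "c \<in> carrier K \<Longrightarrow> (\<lambda>_. c) \<in> poly_funs K S"
| var: "i \<in> S \<Longrightarrow> (\<lambda>x. x i) \<in> poly_funs K S"
| add: "f \<in> poly_funs K S \<Longrightarrow> g \<in> poly_funs K S \<Longrightarrow> (\<lambda>x. f x \<oplus>\<^bsub>K\<^esub> g x) \<in> poly_funs K S"
| mult: "f \<in> poly_funs K S \<Longrightarrow> g \<in> poly_funs K S \<Longrightarrow> (\<lambda>x. f x \<otimes>\<^bsub>K\<^esub> g x) \<in> poly_funs K S"

definition zariski_closed :: "('a, 'b) ring_scheme \<Rightarrow> 'i set \<Rightarrow> ('i \<Rightarrow> 'a) set \<Rightarrow> bool" where
  "zariski_closed K S C \<longleftrightarrow>
     (\<exists>F \<subseteq> poly_funs K S. C = {x \<in> S \<rightarrow>\<^sub>E carrier K. \<forall>f\<in>F. f x = \<zero>\<^bsub>K\<^esub>})"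

definition zariski_open :: "('a, 'b) ring_scheme \<Rightarrow> 'i set \<Rightarrow> ('i \<Rightarrow> 'a) set \<Rightarrow> bool" where
  "zariski_open K S U \<longleftrightarrow> U \<subseteq> S \<rightarrow>\<^sub>E carrier K \<and> zariski_closed K S ((S \<rightarrow>\<^sub>E carrier K) - U)"

definition zariski_dense :: "('a, 'b) ring_scheme \<Rightarrow> 'i set \<Rightarrow> ('i \<Rightarrow> 'a) set \<Rightarrow> bool" where
  "zariski_dense K S U \<longleftrightarrow> U \<subseteq> S \<rightarrow>\<^sub>E carrier K \<and>
     (\<forall>C. zariski_closed K S C \<and> U \<subseteq> C \<longrightarrow> C = (S \<rightarrow>\<^sub>E carrier K))"


section \<open>General minimal reductions and \<open>j\<close>-stretched ideals\<close>

text \<open>The property \<open>P\<close> of sequences \<open>x 0, \<dots>, x (d - 1)\<close> holds for a general minimal reduction of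
  \<open>I\<close>. All indices start at 0. The open set may depend on the chosen finite generating sequence
  \<open>as\<close> of \<open>I\<close>, and every generating sequence is required to admit one. That the ideal
  \<open>(x 0, \<dots>, x (d - 1))\<close> is a minimal reduction for parameters in the open set is part of the
  assertion.\<close>

definition for_general_minimal_reduction ::
    "('a, 'b) ring_scheme \<Rightarrow> 'a set \<Rightarrow> 'a set \<Rightarrow> nat \<Rightarrow> ((nat \<Rightarrow> 'a) \<Rightarrow> bool) \<Rightarrow> bool" where
  "for_general_minimal_reduction R m I d P \<longleftrightarrow>
     (\<forall>as. set as \<subseteq> carrier R \<and> I = Idl\<^bsub>R\<^esub> (set as) \<longrightarrow>
       (let S = {..<d} \<times> {..<length as}; k = R Quot m in
        \<exists>U. zariski_open k S U \<and> zariski_dense k S U \<and>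
          (\<forall>L \<in> S \<rightarrow> carrier R. (\<lambda>s\<in>S. m +>\<^bsub>R\<^esub> L s) \<in> U \<longrightarrow>
             (let x = (\<lambda>i. \<Oplus>\<^bsub>R\<^esub>j\<in>{..<length as}. L (i, j) \<otimes>\<^bsub>R\<^esub> as ! j) in
              minimal_reduction R (Idl\<^bsub>R\<^esub> (x ` {..<d})) I \<and> P x))))"

text \<open>The element written \<open>x\<^sub>d\<close> in the literature is \<open>x (d - 1)\<close> here. If \<open>d = 0\<close> the sequence is
  empty: then \<open>Q = 0 : I\<^sup>\<infinity>\<close> and the missing last element is read as zero.\<close>

definition j_stretched :: "('a, 'b) ring_scheme \<Rightarrow> 'a set \<Rightarrow> 'a set \<Rightarrow> bool" where
  "j_stretched R m I \<longleftrightarrow>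
     (\<exists>d. krull_dim R = enat d \<and>
        for_general_minimal_reduction R m I d (\<lambda>x.
          let Q = ideal_saturation R (Idl\<^bsub>R\<^esub> (x ` {..<d - 1})) I;
              R' = R Quot Q;
              I' = Idl\<^bsub>R'\<^esub> ((\<lambda>a. Q +>\<^bsub>R\<^esub> a) ` I);
              y = (if d = 0 then \<zero>\<^bsub>R'\<^esub> else Q +>\<^bsub>R\<^esub> x (d - 1))
          in module_length R'
               (quot_module R' (ideal_pow R' I' 2)
                 (((PIdl\<^bsub>R'\<^esub> y) \<cdot>\<^bsub>R'\<^esub> I') <+>\<^bsub>R'\<^esub> ideal_pow R' I' 3)) \<le> 1))"

end

theory Submission
  imports Defs
begin

text \<open>Everything is decided in \<open>I\<^sup>2 / (J I + I\<^sup>3)\<close>. For the \<open>J\<close> in the definition of a stretched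
  ideal, \<open>J \<inter> I\<^sup>2 = J I\<close> shows that this module has length at most 1, that is, it is generated by
  one element \<open>w\<close> killed by \<open>m\<close>. For a general \<open>J\<close> the module in the definition of \<open>j\<close>-stretched is
  a quotient of \<open>I\<^sup>2 / (J I + I\<^sup>3)\<close>, because \<open>x\<^sub>1, \<dots>, x\<^sub>d\<^sub>-\<^sub>1\<close> vanish in \<open>R'\<close>. So it suffices to pass
  from the special \<open>J\<close> to a general one.

  By Noether normalization every minimal reduction is generated by \<open>d\<close> elements, so the special \<open>J\<close>
  is a member \<open>J L0\<close> of the family of ideals \<open>J L\<close> generated by \<open>d\<close> linear combinations of the given
  generators of \<open>I\<close>, with coefficients \<open>L\<close> in \<open>R\<close>. That \<open>J L\<close> is a reduction, that \<open>w\<close> generates and that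
  \<open>m\<close> kills \<open>w\<close> are open conditions on the residues of \<open>L\<close>, by Nakayama's lemma over the ring of
  polynomial functions of \<open>L\<close>, localized at \<open>L0\<close>. A reduction with \<open>d\<close> generators is minimal by
  Krull's height theorem.\<close>

section \<open>Ideals and finite linear combinations\<close>

text \<open>Of the three open conditions, the delicate one is that \<open>m\<close> kills
  \<open>w\<close>. Rewriting \<open>t w\<close> from \<open>J L0\<close> to \<open>J L\<close>
  leaves an error \<open>p L w\<close> with \<open>p L0 = 0\<close>, but \<open>p\<close> may take
  unit values elsewhere, whereas Nakayama's lemma for \<open>m\<close> needs \<open>p\<close> as a
  combination of generators of \<open>m\<close>. The case distinction in \<open>open_socle\<close>
  overcomes this. One of its cases yields good parameters at a point possibly different from
  \<open>L0\<close>, so the conditions are joined by the irreducibility of affine space over the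
  infinite residue field. The coefficients \<open>L\<close> lie in \<open>R\<close> and not in the
  residue field. All dependence on \<open>L\<close> is therefore expressed by polynomial functions
  with values in \<open>R\<close>, and whether such a value is a unit depends on the residues of
  \<open>L\<close> alone. Localizations and lengths occur in elementary form:
  \<open>prime_sat R P A\<close> is the contraction of the extension of \<open>A\<close> to
  \<open>R_P\<close>, and \<open>cyc_filt\<close> with the counting function of
  \<open>cyc_filt_length\<close> bounds lengths over \<open>R_P\<close>.\<close>

lemma (in ring) ideal_closed:
  assumes "ideal A R"
  shows "\<zero> \<in> A"
    and "\<And>a b. a \<in> A \<Longrightarrow> b \<in> A \<Longrightarrow> a \<oplus> b \<in> A"
    and "\<And>a. a \<in> A \<Longrightarrow> \<ominus> a \<in> A"
    and "\<And>a b. a \<in> A \<Longrightarrow> b \<in> A \<Longrightarrow> a \<ominus> b \<in> A"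
    and "\<And>a r. a \<in> A \<Longrightarrow> r \<in> carrier R \<Longrightarrow> r \<otimes> a \<in> A"
    and "\<And>a r. a \<in> A \<Longrightarrow> r \<in> carrier R \<Longrightarrow> a \<otimes> r \<in> A"
    and "\<And>a. a \<in> A \<Longrightarrow> a \<in> carrier R"
    and "A \<subseteq> carrier R"
proof -
  interpret A: ideal A R by fact
  show "\<zero> \<in> A" "\<And>a b. a \<in> A \<Longrightarrow> b \<in> A \<Longrightarrow> a \<oplus> b \<in> A" "\<And>a. a \<in> A \<Longrightarrow> \<ominus> a \<in> A"
    "\<And>a b. a \<in> A \<Longrightarrow> b \<in> A \<Longrightarrow> a \<ominus> b \<in> A"
    "\<And>a r. a \<in> A \<Longrightarrow> r \<in> carrier R \<Longrightarrow> r \<otimes> a \<in> A"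
    "\<And>a r. a \<in> A \<Longrightarrow> r \<in> carrier R \<Longrightarrow> a \<otimes> r \<in> A"
    "\<And>a. a \<in> A \<Longrightarrow> a \<in> carrier R" "A \<subseteq> carrier R"
    by (auto simp: a_minus_def A.I_l_closed A.I_r_closed)
qed

lemma (in ring) finsum_in_ideal:
  assumes "ideal A R" "f \<in> E \<rightarrow> A"
  shows "(\<Oplus>i\<in>E. f i) \<in> A"
  using assms(2)
proof (induction E rule: infinite_finite_induct)
  case (insert x F)
  then have "f \<in> F \<rightarrow> carrier R" "f x \<in> carrier R" "f x \<in> A"
    using ideal_closed[OF assms(1)] by auto
  then show ?case using insert ideal_closed[OF assms(1)] by auto
qed (use ideal_closed[OF assms(1)] in auto)

lemma (in ring) set_add_iff: "x \<in> A <+>\<^bsub>R\<^esub> B \<longleftrightarrow> (\<exists>a\<in>A. \<exists>b\<in>B. x = a \<oplus> b)"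
  by (auto simp: set_add_def')

lemma (in ring) set_add_incl:
  assumes "ideal A R" "ideal B R"
  shows "A \<subseteq> A <+>\<^bsub>R\<^esub> B" "B \<subseteq> A <+>\<^bsub>R\<^esub> B"
proof -
  show "A \<subseteq> A <+>\<^bsub>R\<^esub> B"
    using assms ideal_closed[OF assms(1)] ideal_closed[OF assms(2)]
    by (metis r_zero set_add_iff subsetI)
  show "B \<subseteq> A <+>\<^bsub>R\<^esub> B"
    using assms ideal_closed[OF assms(1)] ideal_closed[OF assms(2)]
    by (metis l_zero set_add_iff subsetI)
qed

lemma (in ring) set_add_least:
  assumes "ideal C R" "A \<subseteq> C" "B \<subseteq> C"
  shows "A <+>\<^bsub>R\<^esub> B \<subseteq> C"
  using assms(2,3) ideal_closed(2)[OF assms(1)] by (fastforce simp: set_add_iff)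

lemma (in cring) cring_idealI:
  assumes "S \<subseteq> carrier R" "\<zero> \<in> S" "\<And>a b. a \<in> S \<Longrightarrow> b \<in> S \<Longrightarrow> a \<oplus> b \<in> S"
    and "\<And>a r. a \<in> S \<Longrightarrow> r \<in> carrier R \<Longrightarrow> r \<otimes> a \<in> S"
  shows "ideal S R"
proof (rule idealI)
  show "ring R" by unfold_locales
  have neg: "\<ominus> a \<in> S" if "a \<in> S" for a
    using assms(4)[OF that, of "\<ominus> \<one>"] assms(1) that by (auto simp: l_minus)
  show "subgroup S (add_monoid R)"
    using assms neg by (auto intro!: add.subgroupI simp flip: a_inv_def)
qed (use assms m_comm in \<open>auto simp: subset_iff\<close>)

lemma (in ring) Idl_least:
  assumes "ideal A R" "S \<subseteq> A"
  shows "Idl S \<subseteq> A"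
  using assms by (rule genideal_minimal)

lemma (in ring) ideal_prod_least:
  assumes "ideal C R" "\<And>a b. a \<in> A \<Longrightarrow> b \<in> B \<Longrightarrow> a \<otimes> b \<in> C"
  shows "A \<cdot> B \<subseteq> C"
proof
  fix x assume "x \<in> A \<cdot> B"
  then show "x \<in> C"
    by induction (use assms ideal_closed[OF assms(1)] in auto)
qed

lemma (in ring) ideal_prod_mono:
  assumes "A \<subseteq> A'" "B \<subseteq> B'"
  shows "A \<cdot> B \<subseteq> A' \<cdot> B'"
proof
  fix x assume "x \<in> A \<cdot> B"
  then show "x \<in> A' \<cdot> B'"
    by induction (use assms in \<open>auto intro: ideal_prod.intros\<close>)
qed

lemma (in cring) Idl_image:
  assumes "finite E" "g \<in> E \<rightarrow> carrier R"
  shows "Idl (g ` E) = {(\<Oplus>i\<in>E. c i \<otimes> g i) | c. c \<in> E \<rightarrow> carrier R}" (is "_ = ?S")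
proof
  have S: "ideal ?S R"
  proof (rule cring_idealI)
    show "?S \<subseteq> carrier R" using assms by (auto intro!: finsum_closed simp: Pi_iff)
    have "(\<Oplus>i\<in>E. \<zero> \<otimes> g i) = (\<Oplus>i\<in>E. \<zero>)"
      by (intro finsum_cong') (use assms in \<open>auto simp: Pi_iff\<close>)
    then show "\<zero> \<in> ?S" by (intro CollectI exI[of _ "\<lambda>_. \<zero>"]) auto
    fix a b assume "a \<in> ?S" "b \<in> ?S"
    then obtain c c' where c: "c \<in> E \<rightarrow> carrier R" "a = (\<Oplus>i\<in>E. c i \<otimes> g i)"
      "c' \<in> E \<rightarrow> carrier R" "b = (\<Oplus>i\<in>E. c' i \<otimes> g i)" by auto
    have "a \<oplus> b = (\<Oplus>i\<in>E. c i \<otimes> g i \<oplus> c' i \<otimes> g i)"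
      unfolding c by (rule finsum_addf[symmetric]) (use c assms in \<open>auto simp: Pi_iff\<close>)
    also have "\<dots> = (\<Oplus>i\<in>E. (c i \<oplus> c' i) \<otimes> g i)"
      by (intro finsum_cong') (use c assms in \<open>auto simp: Pi_iff l_distr\<close>)
    finally show "a \<oplus> b \<in> ?S" using c by (intro CollectI exI[of _ "\<lambda>i. c i \<oplus> c' i"]) auto
  next
    fix a r assume "a \<in> ?S" and r: "r \<in> carrier R"
    then obtain c where c: "c \<in> E \<rightarrow> carrier R" "a = (\<Oplus>i\<in>E. c i \<otimes> g i)" by auto
    have "r \<otimes> a = (\<Oplus>i\<in>E. r \<otimes> (c i \<otimes> g i))"
      unfolding c by (rule finsum_rdistr) (use c assms r in \<open>auto simp: Pi_iff\<close>)
    also have "\<dots> = (\<Oplus>i\<in>E. (r \<otimes> c i) \<otimes> g i)"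
      by (intro finsum_cong') (use c assms r in \<open>auto simp: Pi_iff m_assoc\<close>)
    finally show "r \<otimes> a \<in> ?S" using c r by (intro CollectI exI[of _ "\<lambda>i. r \<otimes> c i"]) auto
  qed
  have "g j \<in> ?S" if j: "j \<in> E" for j
  proof -
    have "(\<Oplus>i\<in>E. (if j = i then \<one> else \<zero>) \<otimes> g i) = (\<Oplus>i\<in>E. if j = i then g i else \<zero>)"
      by (intro finsum_cong') (use assms in \<open>auto simp: Pi_iff\<close>)
    also have "\<dots> = g j"
      by (rule finsum_singleton[OF j assms(1)]) (use assms in auto)
    finally show ?thesis by (intro CollectI exI[of _ "\<lambda>i. if j = i then \<one> else \<zero>"]) auto
  qed
  then show "Idl (g ` E) \<subseteq> ?S" by (intro Idl_least[OF S]) auto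
  have "g ` E \<subseteq> carrier R" using assms by auto
  note id = genideal_ideal[OF this] genideal_self[OF this]
  show "?S \<subseteq> Idl (g ` E)"
    using id(2) by (auto intro!: finsum_in_ideal[OF id(1)] ideal_closed(5)[OF id(1)])
qed

text \<open>Puts membership in \<open>P \<cdot> B\<close>, for \<open>B\<close> generated by the
  \<open>g i\<close>, into the shape in which Nakayama's lemma uses it: a combination of the
  generators with coefficients in \<open>P\<close>.\<close>

lemma (in cring) mem_ideal_prod_Idl:
  assumes "ideal P R" "finite E" "g \<in> E \<rightarrow> carrier R" "x \<in> P \<cdot> (Idl (g ` E))"
  shows "\<exists>n \<in> E \<rightarrow> P. x = (\<Oplus>i\<in>E. n i \<otimes> g i)"
  using assms(4)
proof induction
  case (prod p b)
  then obtain c where c: "c \<in> E \<rightarrow> carrier R" "b = (\<Oplus>i\<in>E. c i \<otimes> g i)"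
    using Idl_image[OF assms(2,3)] by auto
  have p: "p \<in> carrier R" using prod ideal_closed[OF assms(1)] by auto
  have "p \<otimes> b = (\<Oplus>i\<in>E. p \<otimes> (c i \<otimes> g i))"
    unfolding c by (rule finsum_rdistr) (use c assms p in \<open>auto simp: Pi_iff\<close>)
  also have "\<dots> = (\<Oplus>i\<in>E. (p \<otimes> c i) \<otimes> g i)"
    by (intro finsum_cong') (use c assms p in \<open>auto simp: Pi_iff m_assoc\<close>)
  finally show ?case using c prod(1) ideal_closed(6)[OF assms(1)]
    by (intro bexI[of _ "\<lambda>i. p \<otimes> c i"]) (auto simp: Pi_iff)
next
  case (sum a b)
  then obtain c c' where c: "c \<in> E \<rightarrow> P" "a = (\<Oplus>i\<in>E. c i \<otimes> g i)"
      "c' \<in> E \<rightarrow> P" "b = (\<Oplus>i\<in>E. c' i \<otimes> g i)" by auto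
  have cc: "c \<in> E \<rightarrow> carrier R" "c' \<in> E \<rightarrow> carrier R" using c ideal_closed[OF assms(1)] by auto
  have "a \<oplus> b = (\<Oplus>i\<in>E. c i \<otimes> g i \<oplus> c' i \<otimes> g i)"
    unfolding c by (rule finsum_addf[symmetric]) (use cc assms in \<open>auto simp: Pi_iff\<close>)
  also have "\<dots> = (\<Oplus>i\<in>E. (c i \<oplus> c' i) \<otimes> g i)"
    by (intro finsum_cong') (use cc assms in \<open>auto simp: Pi_iff l_distr\<close>)
  finally show ?case using c ideal_closed[OF assms(1)]
    by (intro bexI[of _ "\<lambda>i. c i \<oplus> c' i"]) auto
qed

section \<open>Nakayama's lemma\<close>

text \<open>Nakayama's lemma for the module generated by the \<open>g e\<close> over the localization of \<open>A\<close> at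
  \<open>N\<close>, with denominators cleared.\<close>

lemma (in cring) nakayama_denominators:
  assumes A: "subring A R"
    and N: "N \<subseteq> A" "\<And>a n. a \<in> A \<Longrightarrow> n \<in> N \<Longrightarrow> a \<otimes> n \<in> N" "\<And>a b. a \<in> N \<Longrightarrow> b \<in> N \<Longrightarrow> a \<oplus> b \<in> N"
      "\<one> \<notin> N" "\<And>a b. a \<in> A - N \<Longrightarrow> b \<in> A - N \<Longrightarrow> a \<otimes> b \<notin> N"
    and H: "H \<subseteq> carrier R" "\<zero> \<in> H" "\<And>a b. a \<in> H \<Longrightarrow> b \<in> H \<Longrightarrow> a \<oplus> b \<in> H"
      "\<And>a h. a \<in> A \<Longrightarrow> h \<in> H \<Longrightarrow> a \<otimes> h \<in> H"
    and "finite E" "g \<in> E \<rightarrow> carrier R"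
    and "\<And>e. e \<in> E \<Longrightarrow> \<exists>u\<in>A - N. \<exists>n\<in>E \<rightarrow> N. \<exists>h\<in>H. u \<otimes> g e = h \<oplus> (\<Oplus>i\<in>E. n i \<otimes> g i)"
  shows "\<exists>u\<in>A - N. \<forall>e\<in>E. u \<otimes> g e \<in> H"
  using assms(11-)
proof (induction E rule: finite_induct)
  case empty
  then show ?case using N(4) subringE(3)[OF A] by auto
next
  case (insert x E)
  have A': "a \<in> carrier R" if "a \<in> A" for a using subringE(1)[OF A] that by auto
  have N': "a \<in> carrier R" "a \<in> A" if "a \<in> N" for a using A' N that by auto
  have H': "a \<in> carrier R" if "a \<in> H" for a using H that by auto
  have gx: "g x \<in> carrier R" using insert.prems by auto
  have g: "g i \<in> carrier R" if "i \<in> E" for i using insert.prems that by auto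
  have neg: "\<ominus> n \<in> N" if "n \<in> N" for n
    using N(2)[of "\<ominus> \<one>" n] N'[OF that] that subringE[OF A] by (auto simp: l_minus)
  have Hsum: "(\<Oplus>i\<in>F. f i) \<in> H" if "f \<in> F \<rightarrow> H" "finite F" for f and F :: "'c set"
    using that(2,1)
  proof (induction F rule: finite_induct)
    case (insert y F)
    then show ?case using H H' by (subst finsum_insert) auto
  qed (use H in auto)
  obtain u n h where u: "u \<in> A - N" and n: "n \<in> insert x E \<rightarrow> N" and h: "h \<in> H"
    and eq: "u \<otimes> g x = h \<oplus> (\<Oplus>i\<in>insert x E. n i \<otimes> g i)" using insert.prems(2)[of x] by auto
  \<comment> \<open>Moving the term with \<open>g x\<close> to the left leaves the coefficient
    \<open>v\<close>, which is again outside \<open>N\<close>. So the relation expresses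
    \<open>v g x\<close> by the other generators.\<close>
  define v where "v = u \<ominus> n x"
  define s where "s = (\<Oplus>i\<in>E. n i \<otimes> g i)"
  have nx: "n x \<in> N" using n by auto
  have nE: "n i \<in> N" if "i \<in> E" for i using n that by auto
  have s: "s \<in> carrier R" unfolding s_def using g N' nE by (intro finsum_closed) auto
  have "v \<in> A" unfolding v_def a_minus_def using u nx subringE[OF A] N' by auto
  moreover have "v \<notin> N"
  proof
    assume "v \<in> N"
    then have "v \<oplus> n x \<in> N" using nx N by auto
    moreover have "v \<oplus> n x = u" unfolding v_def using N'[OF nx] A'[of u] u
      by (auto simp: a_minus_def a_assoc l_neg)
    ultimately show False using u by auto
  qed
  ultimately have v: "v \<in> A - N" by auto
  then have v': "v \<in> carrier R" using A' by auto
  have "u \<otimes> g x = h \<oplus> (n x \<otimes> g x \<oplus> s)" unfolding eq s_def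
    using insert.hyps g gx N'(1)[OF nx] N'(1)[OF nE] by (subst finsum_insert) auto
  moreover have "v \<otimes> g x = u \<otimes> g x \<ominus> n x \<otimes> g x"
    unfolding v_def using A' u N'(1)[OF nx] gx by (simp add: a_minus_def l_distr l_minus)
  moreover have "h \<oplus> (n x \<otimes> g x \<oplus> s) \<ominus> n x \<otimes> g x = h \<oplus> s"
    using H'[OF h] N'(1)[OF nx] gx s by algebra
  ultimately have vgx: "v \<otimes> g x = h \<oplus> s" by simp
  \<comment> \<open>Multiplying the relation of \<open>g e\<close> by \<open>v\<close> allows
    \<open>g x\<close> to be eliminated, so that the induction hypothesis applies to the remaining
    generators.\<close>
  have "\<exists>u\<in>A - N. \<exists>n\<in>E \<rightarrow> N. \<exists>h\<in>H. u \<otimes> g e = h \<oplus> (\<Oplus>i\<in>E. n i \<otimes> g i)" if e: "e \<in> E" for e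
  proof -
    obtain u' n' h' where u': "u' \<in> A - N" and n': "n' \<in> insert x E \<rightarrow> N" and h': "h' \<in> H"
      and eq': "u' \<otimes> g e = h' \<oplus> (\<Oplus>i\<in>insert x E. n' i \<otimes> g i)" using insert.prems(2)[of e] e by auto
    define s' where "s' = (\<Oplus>i\<in>E. n' i \<otimes> g i)"
    have nx': "n' x \<in> N" using n' by auto
    have nE': "n' i \<in> N" if "i \<in> E" for i using n' that by auto
    have s': "s' \<in> carrier R" unfolding s'_def using g N' nE' by (intro finsum_closed) auto
    have eq2: "u' \<otimes> g e = h' \<oplus> (n' x \<otimes> g x \<oplus> s')" unfolding eq' s'_def
      using insert.hyps g gx N'(1)[OF nx'] N'(1)[OF nE'] by (subst finsum_insert) auto
    have "(v \<otimes> u') \<otimes> g e = v \<otimes> (u' \<otimes> g e)" using v u' A' g[OF e] by (simp add: m_assoc)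
    also have "\<dots> = v \<otimes> h' \<oplus> n' x \<otimes> (v \<otimes> g x) \<oplus> v \<otimes> s'"
      unfolding eq2 using v' H'[OF h'] N'(1)[OF nx'] gx s' by algebra
    also have "\<dots> = (v \<otimes> h' \<oplus> n' x \<otimes> h) \<oplus> (n' x \<otimes> s \<oplus> v \<otimes> s')"
      unfolding vgx using v' H'[OF h'] H'[OF h] N'(1)[OF nx'] gx s' s by algebra
    also have "n' x \<otimes> s \<oplus> v \<otimes> s' = (\<Oplus>i\<in>E. n' x \<otimes> (n i \<otimes> g i)) \<oplus> (\<Oplus>i\<in>E. v \<otimes> (n' i \<otimes> g i))"
      unfolding s_def s'_def using insert.hyps nx' v' v N' nE nE' g
      by (subst (1 2) finsum_rdistr) auto
    also have "\<dots> = (\<Oplus>i\<in>E. n' x \<otimes> (n i \<otimes> g i) \<oplus> v \<otimes> (n' i \<otimes> g i))"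
      using insert.hyps nx' v' v N' nE nE' g by (subst finsum_addf) auto
    also have "\<dots> = (\<Oplus>i\<in>E. (n' x \<otimes> n i \<oplus> v \<otimes> n' i) \<otimes> g i)"
      using insert.hyps nx' v' v N' nE nE' g
      by (intro finsum_cong') (auto simp: m_assoc l_distr)
    finally have "(v \<otimes> u') \<otimes> g e
      = (v \<otimes> h' \<oplus> n' x \<otimes> h) \<oplus> (\<Oplus>i\<in>E. (n' x \<otimes> n i \<oplus> v \<otimes> n' i) \<otimes> g i)" .
    moreover have "v \<otimes> u' \<in> A - N" using v u' N(5) subringE(6)[OF A] by auto
    moreover have "v \<otimes> h' \<oplus> n' x \<otimes> h \<in> H" using v h h' H N'(2)[OF nx'] by auto
    moreover have "(\<lambda>i. n' x \<otimes> n i \<oplus> v \<otimes> n' i) \<in> E \<rightarrow> N"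
      using N N'(2)[OF nx'] v nE nE' by auto
    ultimately show ?thesis
      by (intro bexI[of _ "v \<otimes> u'"] bexI[of _ "\<lambda>i. n' x \<otimes> n i \<oplus> v \<otimes> n' i"]
          bexI[of _ "v \<otimes> h' \<oplus> n' x \<otimes> h"]) auto
  qed
  then obtain w where w: "w \<in> A - N" and wg: "\<forall>e\<in>E. w \<otimes> g e \<in> H"
    using insert.IH insert.prems(1) by (auto simp: Pi_iff)
  \<comment> \<open>Back substitution: all \<open>w g i\<close> with \<open>i\<close> in
    \<open>E\<close> lie in \<open>H\<close>, so the relation of \<open>g x\<close>, multiplied by
    \<open>w\<close>, puts \<open>w v g x\<close> into \<open>H\<close> as well.\<close>
  have "(w \<otimes> v) \<otimes> g x = w \<otimes> h \<oplus> w \<otimes> s"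
    using w v A' gx H'[OF h] s vgx by (simp add: m_assoc r_distr)
  also have "w \<otimes> s = (\<Oplus>i\<in>E. w \<otimes> (n i \<otimes> g i))"
    unfolding s_def using insert.hyps w A' N' nE g by (subst finsum_rdistr) auto
  also have "\<dots> = (\<Oplus>i\<in>E. n i \<otimes> (w \<otimes> g i))"
    using insert.hyps w A' N' nE g by (intro finsum_cong') (auto simp: m_lcomm)
  finally have "(w \<otimes> v) \<otimes> g x = w \<otimes> h \<oplus> (\<Oplus>i\<in>E. n i \<otimes> (w \<otimes> g i))" .
  moreover have "(\<Oplus>i\<in>E. n i \<otimes> (w \<otimes> g i)) \<in> H"
    using insert.hyps wg nE N' H by (intro Hsum) auto
  ultimately have 1: "(w \<otimes> v) \<otimes> g x \<in> H" using H h w by auto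
  have 2: "(w \<otimes> v) \<otimes> g e \<in> H" if "e \<in> E" for e
  proof -
    have "(w \<otimes> v) \<otimes> g e = v \<otimes> (w \<otimes> g e)" using w v A' g[OF that] by (simp add: m_ac)
    then show ?thesis using H wg that v by auto
  qed
  have "w \<otimes> v \<in> A - N" using v w N(5) subringE(6)[OF A] by auto
  with 1 2 show ?case by blast
qed

section \<open>Powers of ideals\<close>

lemma ideals_set_simps [simp]:
  "\<one>\<^bsub>ideals_set R\<^esub> = carrier R" "A \<otimes>\<^bsub>ideals_set R\<^esub> B = A \<cdot>\<^bsub>R\<^esub> B"
  by (simp_all add: ideals_set_def)

lemma ideal_pow_0: "ideal_pow R I 0 = carrier R"
  by (simp add: nat_pow_def ideals_set_def)

lemma ideal_pow_Suc: "ideal_pow R I (Suc n) = ideal_pow R I n \<cdot>\<^bsub>R\<^esub> I"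
  by (simp add: nat_pow_def ideals_set_def)

context cring
begin

lemma ideal_pow_ideal:
  assumes "ideal I R"
  shows "ideal (ideal_pow R I n) R"
  by (induction n) (use assms in \<open>auto simp: ideal_pow_0 ideal_pow_Suc oneideal ideal_prod_is_ideal\<close>)

lemma ideal_pow_one:
  assumes "ideal I R"
  shows "ideal_pow R I 1 = I"
  using ideal_pow_Suc[of R I 0] assms
  by (simp add: ideal_pow_0 ideal_prod_one ideal_prod_commute oneideal)

lemma ideal_pow_add:
  assumes "ideal I R"
  shows "ideal_pow R I (a + b) = ideal_pow R I a \<cdot> ideal_pow R I b"
proof (induction b)
  case 0
  then show ?case using assms by (simp add: ideal_pow_0 ideal_prod_one ideal_pow_ideal)
next
  case (Suc b)
  then show ?case using assms by (simp add: ideal_pow_Suc ideal_prod_assoc ideal_pow_ideal)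
qed

lemma ideal_pow_decreasing:
  assumes "ideal I R" "a \<le> b"
  shows "ideal_pow R I b \<subseteq> ideal_pow R I a"
proof -
  obtain k where "b = a + k" using assms(2) le_Suc_ex by auto
  then show ?thesis
    using ideal_pow_add[OF assms(1)] ideal_prod_inter[OF ideal_pow_ideal ideal_pow_ideal] assms by auto
qed

lemma ideal_pow_mono:
  assumes "A \<subseteq> B"
  shows "ideal_pow R A n \<subseteq> ideal_pow R B n"
proof (induction n)
  case (Suc n)
  then show ?case unfolding ideal_pow_Suc by (intro ideal_prod_mono assms)
qed (simp add: ideal_pow_0)

lemma ideal_pow_mult:
  assumes "ideal I R"
  shows "ideal_pow R I (a * b) = ideal_pow R (ideal_pow R I a) b"
proof (induction b)
  case (Suc b)
  have "ideal_pow R I (a * Suc b) = ideal_pow R I (a * b + a)" by (simp add: add.commute)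
  then show ?case using Suc ideal_pow_add[OF assms] by (simp add: ideal_pow_Suc)
qed (simp add: ideal_pow_0)

lemma pow_mem_ideal_pow:
  assumes "ideal I R" "x \<in> I"
  shows "x [^] n \<in> ideal_pow R I n"
  by (induction n) (use assms in \<open>auto simp: ideal_pow_0 ideal_pow_Suc intro: ideal_prod.prod\<close>)

lemma Idl_insert:
  assumes "x \<in> carrier R" "S \<subseteq> carrier R" "r \<in> Idl (insert x S)"
  shows "\<exists>a\<in>carrier R. \<exists>c\<in>Idl S. r = a \<otimes> x \<oplus> c"
proof -
  note S = genideal_ideal[OF assms(2)] genideal_self[OF assms(2)]
  have "ideal (PIdl x <+>\<^bsub>R\<^esub> Idl S) R"
    using add_ideals[OF cgenideal_ideal[OF assms(1)] S(1)] .
  moreover have "insert x S \<subseteq> PIdl x <+>\<^bsub>R\<^esub> Idl S"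
    using set_add_incl[OF cgenideal_ideal[OF assms(1)] S(1)] cgenideal_self[OF assms(1)] S(2) by auto
  ultimately have "r \<in> PIdl x <+>\<^bsub>R\<^esub> Idl S" using Idl_least assms(3) by blast
  then show ?thesis by (auto simp: set_add_iff cgenideal_def)
qed

text \<open>Pigeonhole principle: among \<open>a + b\<close> factors from (x) + (S), at least
  \<open>a\<close> come from (S) or at least \<open>b\<close> from (x). The induction splits the
  last factor as \<open>r x + d\<close> and uses the bound for \<open>(a, b - 1)\<close> on the part
  with \<open>x\<close>, the bound for \<open>(a - 1, b)\<close> on the part with
  \<open>d\<close>.\<close>

lemma power_Idl_insert:
  assumes x: "x \<in> carrier R" and S: "S \<subseteq> carrier R"
  shows "ideal_pow R (Idl (insert x S)) (a + b) \<subseteq> ideal_pow R (Idl S) a <+>\<^bsub>R\<^esub> PIdl (x [^] b)"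
proof (induction "a + b" arbitrary: a b rule: less_induct)
  case less
  let ?A = "Idl (insert x S)" and ?D = "Idl S"
  have iA: "ideal ?A R" and iD: "ideal ?D R" using x S by (auto intro: genideal_ideal)
  note iDn = ideal_pow_ideal[OF iD]
  have iP: "ideal (PIdl (x [^] k)) R" for k :: nat using x cgenideal_ideal by auto
  have iX: "ideal (ideal_pow R ?D a <+>\<^bsub>R\<^esub> PIdl (x [^] b)) R" by (intro add_ideals iDn iP)
  show ?case
  proof (cases "a = 0 \<or> b = 0")
    case True
    then have "\<one> \<in> ideal_pow R ?D a <+>\<^bsub>R\<^esub> PIdl (x [^] b)"
      using set_add_incl[OF iDn[of a] iP[of b]] cgenideal_self[OF one_closed]
      by (auto simp: ideal_pow_0)
    then have "ideal_pow R ?D a <+>\<^bsub>R\<^esub> PIdl (x [^] b) = carrier R"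
      using ideal.one_imp_carrier[OF iX] by auto
    then show ?thesis using ideal_closed(8)[OF ideal_pow_ideal[OF iA]] by auto
  next
    case False
    then obtain a' b' where ab: "a = Suc a'" "b = Suc b'" by (metis not0_implies_Suc)
    define n where "n = a + b'"
    have n: "a + b = Suc n" "n = a' + b" using ab n_def by auto
    have 1: "ideal_pow R ?A n \<subseteq> ideal_pow R ?D a <+>\<^bsub>R\<^esub> PIdl (x [^] b')"
      using less[of a b'] n_def ab by simp
    have 2: "ideal_pow R ?A n \<subseteq> ideal_pow R ?D a' <+>\<^bsub>R\<^esub> PIdl (x [^] b)"
      using less[of a' b] n ab by simp
    have "ideal_pow R ?A n \<cdot> ?A \<subseteq> ideal_pow R ?D a <+>\<^bsub>R\<^esub> PIdl (x [^] b)"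
    proof (rule ideal_prod_least[OF iX])
      fix u v assume u: "u \<in> ideal_pow R ?A n" and v: "v \<in> ?A"
      obtain r d where rd: "r \<in> carrier R" "d \<in> ?D" "v = r \<otimes> x \<oplus> d"
        using Idl_insert[OF x S v] by auto
      obtain e s where e: "e \<in> ideal_pow R ?D a" "s \<in> carrier R" "u = e \<oplus> s \<otimes> x [^] b'"
        using subsetD[OF 1 u] by (auto simp: set_add_iff cgenideal_def)
      obtain e' s' where e': "e' \<in> ideal_pow R ?D a'" "s' \<in> carrier R" "u = e' \<oplus> s' \<otimes> x [^] b"
        using subsetD[OF 2 u] by (auto simp: set_add_iff cgenideal_def)
      have c: "e \<in> carrier R" "e' \<in> carrier R" "d \<in> carrier R" "u \<in> carrier R"
        using e e' rd u ideal_closed(7)[OF iDn] ideal_closed(7)[OF iD]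
          ideal_closed(7)[OF ideal_pow_ideal[OF iA]] by auto
      have xb: "x [^] b = x [^] b' \<otimes> x" using ab x by simp
      have "u \<otimes> v = (u \<otimes> x) \<otimes> r \<oplus> u \<otimes> d"
        unfolding rd using rd(1) c x by algebra
      also have "u \<otimes> x = e \<otimes> x \<oplus> s \<otimes> x [^] b"
        unfolding e(3) xb using e c x nat_pow_closed[OF x, of b'] by algebra
      also have "u \<otimes> d = e' \<otimes> d \<oplus> s' \<otimes> x [^] b \<otimes> d"
        unfolding e'(3) using e' c x by (simp add: l_distr)
      also have "(e \<otimes> x \<oplus> s \<otimes> x [^] b) \<otimes> r \<oplus> (e' \<otimes> d \<oplus> s' \<otimes> x [^] b \<otimes> d)
        = (e \<otimes> (x \<otimes> r) \<oplus> e' \<otimes> d) \<oplus> (s \<otimes> r \<oplus> s' \<otimes> d) \<otimes> x [^] b"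
        using e e' c x rd nat_pow_closed[OF x, of b] by algebra
      finally have "u \<otimes> v = (e \<otimes> (x \<otimes> r) \<oplus> e' \<otimes> d) \<oplus> (s \<otimes> r \<oplus> s' \<otimes> d) \<otimes> x [^] b" .
      moreover have "e' \<otimes> d \<in> ideal_pow R ?D a"
        unfolding ab ideal_pow_Suc using e' rd by (auto intro: ideal_prod.prod)
      then have "e \<otimes> (x \<otimes> r) \<oplus> e' \<otimes> d \<in> ideal_pow R ?D a"
        using e x rd ideal_closed[OF iDn[of a]] by auto
      moreover have "(s \<otimes> r \<oplus> s' \<otimes> d) \<otimes> x [^] b \<in> PIdl (x [^] b)"
        using e e' c rd by (auto simp: cgenideal_def)
      ultimately show "u \<otimes> v \<in> ideal_pow R ?D a <+>\<^bsub>R\<^esub> PIdl (x [^] b)"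
        unfolding set_add_iff by blast
    qed
    then show ?thesis unfolding n(1) ideal_pow_Suc .
  qed
qed

end

section \<open>Saturation with respect to a prime and cyclic filtrations\<close>

text \<open>For a prime \<open>P\<close> and an ideal \<open>A\<close> this is the contraction to
  \<open>R\<close> of the extension of \<open>A\<close> to the localization
  \<open>R_P\<close>.\<close>

definition prime_sat :: "('a, 'b) ring_scheme \<Rightarrow> 'a set \<Rightarrow> 'a set \<Rightarrow> 'a set" where
  "prime_sat R P A = {r \<in> carrier R. \<exists>t\<in>carrier R - P. t \<otimes>\<^bsub>R\<^esub> r \<in> A}"

text \<open>A filtration of \<open>A/C\<close> with \<open>s\<close> cyclic factors killed by
  \<open>P\<close>. Over \<open>R_P\<close>, for a prime \<open>P\<close>, each factor becomes a
  quotient of the residue field of \<open>P\<close>, so the localized quotient has length at most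
  \<open>s\<close>.\<close>

inductive cyc_filt :: "('a, 'b) ring_scheme \<Rightarrow> 'a set \<Rightarrow> 'a set \<Rightarrow> 'a set \<Rightarrow> nat \<Rightarrow> bool"
  for R and P where
  trivial: "ideal A R \<Longrightarrow> cyc_filt R P A A 0"
| step: "\<lbrakk>ideal A R; g \<in> A; B \<subseteq> A; \<And>r. r \<in> A \<Longrightarrow> \<exists>a\<in>carrier R. \<exists>c\<in>B. r = a \<otimes>\<^bsub>R\<^esub> g \<oplus>\<^bsub>R\<^esub> c;
    \<And>p. p \<in> P \<Longrightarrow> p \<otimes>\<^bsub>R\<^esub> g \<in> B; cyc_filt R P B C s\<rbrakk> \<Longrightarrow> cyc_filt R P A C (Suc s)"

lemma cyc_filt_ideal:
  assumes "cyc_filt R P A B s"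
  shows "ideal A R" "ideal B R" "B \<subseteq> A"
  using assms by induction auto

lemma cyc_filt_trans:
  assumes "cyc_filt R P A B s" "cyc_filt R P B C t"
  shows "cyc_filt R P A C (s + t)"
  using assms by induction (auto intro: cyc_filt.step)

context cring
begin

lemma primeideal_one: "primeideal P R \<Longrightarrow> \<one> \<in> carrier R - P"
  using ideal.one_imp_carrier[of P R] primeideal.I_notcarr[of P R] primeideal.axioms(1)[of P R] by auto

lemma primeideal_mult:
  "primeideal P R \<Longrightarrow> s \<in> carrier R - P \<Longrightarrow> t \<in> carrier R - P \<Longrightarrow> s \<otimes> t \<in> carrier R - P"
  by (meson DiffD1 DiffD2 DiffI m_closed primeideal.I_prime)

lemma primeideal_pow:
  assumes "primeideal P R" "x \<in> carrier R" "x [^] (n::nat) \<in> P"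
  shows "x \<in> P"
  using assms(3)
proof (induction n)
  case 0
  then show ?case using primeideal_one[OF assms(1)] by auto
next
  case (Suc n)
  then show ?case using primeideal.I_prime[OF assms(1), of "x [^] n" x] assms(2) by auto
qed

lemma prime_sat_incl:
  assumes "primeideal P R" "A \<subseteq> carrier R"
  shows "A \<subseteq> prime_sat R P A"
  using primeideal_one[OF assms(1)] assms(2) by (auto simp: prime_sat_def intro!: bexI[of _ \<one>])

lemma prime_sat_ideal:
  assumes P: "primeideal P R" and A: "ideal A R"
  shows "ideal (prime_sat R P A) R"
proof (rule cring_idealI)
  show "prime_sat R P A \<subseteq> carrier R" by (auto simp: prime_sat_def)
  show "\<zero> \<in> prime_sat R P A" using prime_sat_incl[OF P] ideal_closed[OF A] by blast
next
  fix a b assume "a \<in> prime_sat R P A" "b \<in> prime_sat R P A"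
  then obtain s t where st: "a \<in> carrier R" "b \<in> carrier R" "s \<in> carrier R - P" "t \<in> carrier R - P"
    "s \<otimes> a \<in> A" "t \<otimes> b \<in> A" by (auto simp: prime_sat_def)
  have "s \<in> carrier R" "t \<in> carrier R" using st by auto
  then have "(s \<otimes> t) \<otimes> (a \<oplus> b) = t \<otimes> (s \<otimes> a) \<oplus> s \<otimes> (t \<otimes> b)" using st(1,2) by algebra
  then have "(s \<otimes> t) \<otimes> (a \<oplus> b) \<in> A" using st ideal_closed[OF A] by auto
  then show "a \<oplus> b \<in> prime_sat R P A"
    using st primeideal_mult[OF P st(3,4)] unfolding prime_sat_def by blast
next
  fix a r assume "a \<in> prime_sat R P A" and r: "r \<in> carrier R"
  then obtain s where s: "a \<in> carrier R" "s \<in> carrier R - P" "s \<otimes> a \<in> A" by (auto simp: prime_sat_def)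
  have "s \<otimes> (r \<otimes> a) = r \<otimes> (s \<otimes> a)" using s r by (auto simp: m_ac)
  then have "s \<otimes> (r \<otimes> a) \<in> A" using s r ideal_closed(5)[OF A] by auto
  then show "r \<otimes> a \<in> prime_sat R P A" using s r unfolding prime_sat_def by blast
qed

lemma prime_sat_mono: "A \<subseteq> B \<Longrightarrow> prime_sat R P A \<subseteq> prime_sat R P B"
  by (auto simp: prime_sat_def)

lemma prime_sat_prime:
  assumes "primeideal P R" "primeideal Q R" "Q \<subseteq> P"
  shows "prime_sat R P Q \<subseteq> Q"
  using primeideal.I_prime[OF assms(2)] assms(3) by (auto simp: prime_sat_def)

lemma prime_sat_idem:
  assumes "primeideal P R" "primeideal P' R" "P \<subseteq> P'" "A \<subseteq> carrier R"
  shows "prime_sat R P' (prime_sat R P A) \<subseteq> prime_sat R P A"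
proof
  fix r assume "r \<in> prime_sat R P' (prime_sat R P A)"
  then obtain t s where r: "r \<in> carrier R" "t \<in> carrier R - P'" "s \<in> carrier R - P" "s \<otimes> (t \<otimes> r) \<in> A"
    by (auto simp: prime_sat_def)
  then have "s \<otimes> t \<in> carrier R - P" using primeideal_mult[OF assms(1), of s t] assms(3) by auto
  moreover have "(s \<otimes> t) \<otimes> r \<in> A" using r by (auto simp: m_assoc)
  ultimately show "r \<in> prime_sat R P A" using r unfolding prime_sat_def by blast
qed

text \<open>A cyclic filtration of length \<open>s\<close> bounds the length of chains of saturated ideals above
  its bottom: the function \<open>f\<close> counts the steps to which an ideal contributes.\<close>

lemma cyc_filt_length:
  assumes P: "primeideal P R" and "cyc_filt R P A C s"
  shows "\<exists>f. (\<forall>c. f c \<le> s) \<and> (\<forall>c c'. ideal c R \<and> ideal c' R \<and> prime_sat R P c' \<subseteq> c' \<and> C \<subseteq> c' \<and> c' \<subseteq> c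
      \<longrightarrow> f c' \<le> f c \<and> (f c' = f c \<longrightarrow> c \<inter> A \<subseteq> c'))"
  using assms(2)
proof induction
  case (trivial A)
  then show ?case by (intro exI[of _ "\<lambda>_. 0"]) auto
next
  case (step A g B C s)
  then obtain f where f1: "\<And>c. f c \<le> s"
    and f2: "\<And>c c'. ideal c R \<Longrightarrow> ideal c' R \<Longrightarrow> prime_sat R P c' \<subseteq> c' \<Longrightarrow> C \<subseteq> c' \<Longrightarrow> c' \<subseteq> c
      \<Longrightarrow> f c' \<le> f c \<and> (f c' = f c \<longrightarrow> c \<inter> B \<subseteq> c')" by metis
  \<comment> \<open>\<open>h c\<close> says that modulo \<open>B\<close> the ideal \<open>c\<close>
    contains a multiple of \<open>g\<close> by an element outside \<open>P\<close>. This is the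
    contribution of \<open>c\<close> to the cyclic factor \<open>A/B\<close> over
    \<open>R_P\<close>; the steps below are counted by \<open>f\<close>.\<close>
  define h where "h c = (\<exists>t\<in>carrier R - P. \<exists>b\<in>B. \<exists>x\<in>c. t \<otimes> g = x \<oplus> b)" for c
  define f' where "f' c = f c + (if h c then 1 else 0)" for c
  have iA: "ideal A R" and iB: "ideal B R" using step cyc_filt_ideal by auto
  have g: "g \<in> carrier R" using step(2) ideal_closed[OF iA] by auto
  have "f' c' \<le> f' c \<and> (f' c' = f' c \<longrightarrow> c \<inter> A \<subseteq> c')"
    if c: "ideal c R" "ideal c' R" "prime_sat R P c' \<subseteq> c'" "C \<subseteq> c'" "c' \<subseteq> c" for c c'
  proof -
    have hm: "h c' \<Longrightarrow> h c" using c(5) by (auto simp: h_def)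
    have "c \<inter> A \<subseteq> c'" if eq: "f' c' = f' c"
    proof
      fix r assume r: "r \<in> c \<inter> A"
      have eq': "f c' = f c" "h c' = h c" using f2[OF c] hm eq by (auto simp: f'_def split: if_splits)
      then have cB: "c \<inter> B \<subseteq> c'" using f2[OF c] by auto
      obtain a b where ab: "a \<in> carrier R" "b \<in> B" "r = a \<otimes> g \<oplus> b" using step(4)[of r] r by auto
      have bc: "b \<in> carrier R" "r \<in> carrier R" using ab r ideal_closed(7)[OF iB] ideal_closed(7)[OF c(1)] by auto
      show "r \<in> c'"
      proof (cases "a \<in> P")
        case True
        then have "r \<in> B" using ab step(5) ideal_closed[OF iB] by auto
        then show ?thesis using cB r by auto
      next
        case False
        have "a \<otimes> g = r \<oplus> (\<ominus> b)" unfolding ab(3) using ab(1) bc g by algebra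
        then have "h c" unfolding h_def using False ab r ideal_closed[OF iB] by blast
        then obtain t b' x where t: "t \<in> carrier R - P" "b' \<in> B" "x \<in> c'" "t \<otimes> g = x \<oplus> b'"
          using eq' by (auto simp: h_def)
        have tc: "t \<in> carrier R" "x \<in> carrier R" "b' \<in> carrier R"
          using t ideal_closed(7)[OF c(2)] ideal_closed(7)[OF iB] by auto
        \<comment> \<open>In \<open>t r - a x\<close> the \<open>g\<close>-components cancel, so
          this element lies in \<open>c \<inter> B\<close>, hence in \<open>c'\<close>. As
          \<open>a x\<close> is in \<open>c'\<close>, so is \<open>t r\<close>, and saturation gives
          \<open>r\<close>.\<close>
        have "t \<otimes> r = a \<otimes> (t \<otimes> g) \<oplus> t \<otimes> b" unfolding ab(3) using ab(1) bc g tc by algebra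
        then have "t \<otimes> r \<ominus> a \<otimes> x = a \<otimes> b' \<oplus> t \<otimes> b"
          unfolding t(4) using ab(1) bc g tc by algebra
        moreover have "a \<otimes> b' \<oplus> t \<otimes> b \<in> B" using ab(1,2) t tc ideal_closed[OF iB] by auto
        moreover have "t \<otimes> r \<ominus> a \<otimes> x \<in> c"
          using r t c(5) ab(1) tc ideal_closed[OF c(1)] by auto
        ultimately have "t \<otimes> r \<ominus> a \<otimes> x \<in> c'" using cB by auto
        then have "(t \<otimes> r \<ominus> a \<otimes> x) \<oplus> a \<otimes> x \<in> c'" using t ab(1) ideal_closed[OF c(2)] by auto
        moreover have "(t \<otimes> r \<ominus> a \<otimes> x) \<oplus> a \<otimes> x = t \<otimes> r" using tc bc ab(1) by algebra
        ultimately have "r \<in> prime_sat R P c'" using bc t unfolding prime_sat_def by auto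
        then show ?thesis using c(3) by auto
      qed
    qed
    moreover have "f' c' \<le> f' c" using f2[OF c] hm by (auto simp: f'_def)
    ultimately show ?thesis by auto
  qed
  moreover have "f' c \<le> Suc s" for c using f1[of c] by (auto simp: f'_def)
  ultimately show ?case by blast
qed

lemma cyc_filt_generators:
  assumes B: "ideal B R" and "finite S" "S \<subseteq> carrier R" "\<And>p x. p \<in> P \<Longrightarrow> x \<in> S \<Longrightarrow> p \<otimes> x \<in> B"
  shows "\<exists>s. cyc_filt R P (Idl (B \<union> S)) B s"
  using assms(2-)
proof (induction S rule: finite_induct)
  case empty
  have "Idl B = B" using Idl_subset_ideal[OF B ideal_closed(8)[OF B]] genideal_self[OF ideal_closed(8)[OF B]]
    Idl_least[OF B] by blast
  then show ?case using cyc_filt.trivial[OF B] by auto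
next
  case (insert x S)
  then obtain s where s: "cyc_filt R P (Idl (B \<union> S)) B s" by auto
  have x: "x \<in> carrier R" and S: "B \<union> S \<subseteq> carrier R" using insert ideal_closed(8)[OF B] by auto
  have "cyc_filt R P (Idl (insert x (B \<union> S))) B (Suc s)"
  proof (rule cyc_filt.step[where g = x and B = "Idl (B \<union> S)"])
    show "ideal (Idl (insert x (B \<union> S))) R" using x S by (auto intro: genideal_ideal)
    have "insert x (B \<union> S) \<subseteq> Idl (insert x (B \<union> S))" 
      using genideal_self[of "insert x (B \<union> S)"] x S by auto
    then show "x \<in> Idl (insert x (B \<union> S))" "Idl (B \<union> S) \<subseteq> Idl (insert x (B \<union> S))"
      using x S Idl_least[OF genideal_ideal[of "insert x (B \<union> S)"], of "B \<union> S"] by auto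
    show "\<exists>a\<in>carrier R. \<exists>c\<in>Idl (B \<union> S). r = a \<otimes> x \<oplus> c" if "r \<in> Idl (insert x (B \<union> S))" for r
      using Idl_insert[OF x S that] .
    show "p \<otimes> x \<in> Idl (B \<union> S)" if "p \<in> P" for p
      using insert.prems(2)[OF that, of x] genideal_self[OF S] by auto
    show "cyc_filt R P (Idl (B \<union> S)) B s" by fact
  qed
  then show ?case by auto
qed

end

section \<open>Noetherian rings\<close>

locale noetherian_cring = noetherian_ring R + cring R for R (structure)

section \<open>Primes, Nakayama's lemma at a prime, and Krull's principal ideal theorem\<close>

context noetherian_cring
begin

text \<open>By the ascending chain condition a nonempty chain of ideals contains its own union, so
  Zorn's lemma applies to \<open>\<F>\<close> without any closure property of
  \<open>\<F>\<close>.\<close>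

lemma exists_maximal_ideal:
  assumes "\<F> \<noteq> {}" "\<And>A. A \<in> \<F> \<Longrightarrow> ideal A R"
  shows "\<exists>M\<in>\<F>. \<forall>K\<in>\<F>. M \<subseteq> K \<longrightarrow> K = M"
proof (rule subset_Zorn)
  fix C assume C: "subset.chain \<F> C"
  show "\<exists>U\<in>\<F>. \<forall>A\<in>C. A \<subseteq> U"
  proof (cases "C = {}")
    case False
    have CF: "C \<subseteq> \<F>" and lin: "\<And>A B. A \<in> C \<Longrightarrow> B \<in> C \<Longrightarrow> A \<subset> B \<or> A = B \<or> B \<subset> A"
      using C by (auto simp: pred_on.chain_def)
    have "subset.chain {I. ideal I R} C"
      unfolding pred_on.chain_def using CF lin assms(2) by blast
    then have "\<Union>C \<in> C" by (rule ideal_chain_is_trivial[OF False])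
    then show ?thesis using CF by (intro bexI[of _ "\<Union>C"]) auto
  qed (use assms in auto)
qed

lemma fg_ideal:
  assumes "ideal A R"
  obtains S where "finite S" "S \<subseteq> carrier R" "A = Idl S"
  using finetely_gen[OF assms] by auto

text \<open>An ideal \<open>M\<close> maximal among those containing \<open>A\<close> and disjoint
  from the multiplicative set \<open>T\<close> is prime: if neither \<open>x\<close> nor
  \<open>y\<close> is in \<open>M\<close>, both enlarged ideals meet \<open>T\<close>, and with
  \<open>x y\<close> in \<open>M\<close> the product of the two members of \<open>T\<close> would
  lie in \<open>M\<close>.\<close>

lemma exists_prime_avoiding:
  assumes a: "ideal A R" and T: "\<one> \<in> T" "\<And>s t. s \<in> T \<Longrightarrow> t \<in> T \<Longrightarrow> s \<otimes> t \<in> T" "A \<inter> T = {}"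
  shows "\<exists>P. primeideal P R \<and> A \<subseteq> P \<and> P \<inter> T = {}"
proof -
  define \<F> where "\<F> = {K. ideal K R \<and> A \<subseteq> K \<and> K \<inter> T = {}}"
  have "A \<in> \<F>" using assms by (auto simp: \<F>_def)
  then have "\<exists>M\<in>\<F>. \<forall>K\<in>\<F>. M \<subseteq> K \<longrightarrow> K = M"
    by (intro exists_maximal_ideal) (auto simp: \<F>_def)
  then obtain M where M: "M \<in> \<F>" and max: "\<And>K. K \<in> \<F> \<Longrightarrow> M \<subseteq> K \<Longrightarrow> K = M" by blast
  have iM: "ideal M R" and AM: "A \<subseteq> M" and MT: "M \<inter> T = {}" using M by (auto simp: \<F>_def)
  have meet: "\<exists>t\<in>T. \<exists>u\<in>M. \<exists>r\<in>carrier R. t = u \<oplus> r \<otimes> x" if x: "x \<in> carrier R" "x \<notin> M" for x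
  proof -
    note iP = cgenideal_ideal[OF x(1)]
    note inc = set_add_incl[OF iM iP]
    have "x \<in> M <+>\<^bsub>R\<^esub> PIdl x" using inc cgenideal_self[OF x(1)] by auto
    then have "M <+>\<^bsub>R\<^esub> PIdl x \<notin> \<F>" using max[of "M <+>\<^bsub>R\<^esub> PIdl x"] inc x(2) by auto
    then obtain t where "t \<in> T" "t \<in> M <+>\<^bsub>R\<^esub> PIdl x"
      using add_ideals[OF iM iP] AM inc by (auto simp: \<F>_def)
    then show ?thesis by (auto simp: set_add_iff cgenideal_def)
  qed
  have "primeideal M R"
  proof (rule primeidealI[OF iM])
    show "cring R" by unfold_locales
    show "carrier R \<noteq> M" using MT T(1) by auto
    fix x y assume xy: "x \<in> carrier R" "y \<in> carrier R" "x \<otimes> y \<in> M"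
    show "x \<in> M \<or> y \<in> M"
    proof (rule ccontr)
      assume "\<not> ?thesis"
      then obtain t u r t' u' r' where t: "t \<in> T" "u \<in> M" "r \<in> carrier R" "t = u \<oplus> r \<otimes> x"
        and t': "t' \<in> T" "u' \<in> M" "r' \<in> carrier R" "t' = u' \<oplus> r' \<otimes> y"
        using meet[of x] meet[of y] xy by metis
      have c: "u \<in> carrier R" "u' \<in> carrier R" using t t' ideal_closed[OF iM] by auto
      have "t \<otimes> t' = (u' \<oplus> r' \<otimes> y) \<otimes> u \<oplus> (r \<otimes> x) \<otimes> u' \<oplus> (r \<otimes> r') \<otimes> (x \<otimes> y)"
        unfolding t(4) t'(4) using c t(3) t'(3) xy(1,2) by algebra
      moreover have "\<dots> \<in> M" using c t(2,3) t'(2,3) xy ideal_closed[OF iM] by auto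
      ultimately show False using T(2)[OF t(1) t'(1)] MT by auto
    qed
  qed
  then show ?thesis using AM MT by auto
qed

text \<open>The hypothesis says that \<open>y\<close> is not nilpotent modulo \<open>A\<close> over
  \<open>R_P\<close>, so \<open>A\<close> avoids the multiplicative set of all \<open>s y^k\<close>
  with \<open>s\<close> outside \<open>P\<close>. A prime avoiding this set lies below
  \<open>P\<close> because of the factors \<open>s\<close> and differs from \<open>P\<close> because
  of \<open>y\<close>.\<close>

lemma exists_prime_below:
  assumes A: "ideal A R" and P: "primeideal P R" and y: "y \<in> P"
    and no: "\<And>k::nat. y [^] k \<notin> prime_sat R P A"
  shows "\<exists>P'. primeideal P' R \<and> A \<subseteq> P' \<and> P' \<subset> P \<and> y \<notin> P'"
proof -
  have yc: "y \<in> carrier R" using y ideal_closed(7)[OF primeideal.axioms(1)[OF P]] by auto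
  define T where "T = {s \<otimes> y [^] (k::nat) | s k. s \<in> carrier R - P}"
  have "\<exists>P'. primeideal P' R \<and> A \<subseteq> P' \<and> P' \<inter> T = {}"
  proof (rule exists_prime_avoiding[OF A])
    show "\<one> \<in> T" unfolding T_def using primeideal_one[OF P]
      by (intro CollectI exI[of _ \<one>] exI[of _ "0::nat"]) auto
    show "A \<inter> T = {}" using no yc by (auto simp: T_def prime_sat_def)
    fix u v assume "u \<in> T" "v \<in> T"
    then obtain s t k l where st: "s \<in> carrier R - P" "t \<in> carrier R - P"
      "u = s \<otimes> y [^] (k::nat)" "v = t \<otimes> y [^] (l::nat)" by (auto simp: T_def)
    have sc: "s \<in> carrier R" "t \<in> carrier R" using st by auto
    have "u \<otimes> v = (s \<otimes> t) \<otimes> (y [^] k \<otimes> y [^] l)"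
      unfolding st using sc nat_pow_closed[OF yc] by (simp add: m_ac)
    also have "y [^] k \<otimes> y [^] l = y [^] (k + l)" using yc by (simp add: nat_pow_mult)
    finally show "u \<otimes> v \<in> T" unfolding T_def using primeideal_mult[OF P st(1,2)] by blast
  qed
  then obtain P' where P': "primeideal P' R" "A \<subseteq> P'" "P' \<inter> T = {}" by auto
  have "P' \<subseteq> P"
  proof
    fix s assume s: "s \<in> P'"
    then have "s \<in> carrier R" using ideal_closed(7) P'(1) primeideal.axioms(1) by blast
    then have "s \<in> T" if "s \<notin> P"
      using that unfolding T_def by (intro CollectI exI[of _ s] exI[of _ "0::nat"]) auto
    then show "s \<in> P" using s P'(3) by auto
  qed
  moreover have "y \<notin> P'"
  proof -
    have "\<one> \<otimes> y [^] (1::nat) \<in> T" unfolding T_def using primeideal_one[OF P] by blast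
    then show ?thesis using P'(3) yc by auto
  qed
  ultimately show ?thesis using P'(1,2) y by auto
qed

text \<open>Nakayama's lemma over \<open>R_P\<close>: the instance of
  \<open>nakayama_denominators\<close> with the whole ring as \<open>A\<close> and \<open>P\<close>
  as \<open>N\<close>, for finitely many generators of \<open>B\<close>.\<close>

lemma nakayama_prime:
  assumes P: "primeideal P R" and B: "ideal B R" and C: "ideal C R"
    and "B \<subseteq> prime_sat R P (C <+>\<^bsub>R\<^esub> P \<cdot> B)"
  shows "B \<subseteq> prime_sat R P C"
proof -
  obtain S where S: "finite S" "S \<subseteq> carrier R" "B = Idl S" using fg_ideal[OF B] .
  have iP: "ideal P R" using P primeideal.axioms by auto
  have "\<exists>u\<in>carrier R - P. \<forall>e\<in>S. u \<otimes> id e \<in> C"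
  proof (rule nakayama_denominators[OF carrier_is_subring])
    show "P \<subseteq> carrier R" "\<And>a n. a \<in> carrier R \<Longrightarrow> n \<in> P \<Longrightarrow> a \<otimes> n \<in> P"
      "\<And>a b. a \<in> P \<Longrightarrow> b \<in> P \<Longrightarrow> a \<oplus> b \<in> P" using ideal_closed[OF iP] by auto
    show "C \<subseteq> carrier R" "\<zero> \<in> C" "\<And>a b. a \<in> C \<Longrightarrow> b \<in> C \<Longrightarrow> a \<oplus> b \<in> C"
      "\<And>a h. a \<in> carrier R \<Longrightarrow> h \<in> C \<Longrightarrow> a \<otimes> h \<in> C" using ideal_closed[OF C] by auto
    show "\<one> \<notin> P" using primeideal_one[OF P] by auto
    show "\<And>a b. a \<in> carrier R - P \<Longrightarrow> b \<in> carrier R - P \<Longrightarrow> a \<otimes> b \<notin> P"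
      using primeideal_mult[OF P] by auto
    show "finite S" "id \<in> S \<rightarrow> carrier R" using S by auto
    fix e assume "e \<in> S"
    then have "e \<in> prime_sat R P (C <+>\<^bsub>R\<^esub> P \<cdot> B)" using assms(4) genideal_self[OF S(2)] S(3) by auto
    then obtain u h b where u: "u \<in> carrier R - P" "h \<in> C" "b \<in> P \<cdot> B" "u \<otimes> e = h \<oplus> b"
      unfolding prime_sat_def set_add_iff by auto
    have "b \<in> P \<cdot> (Idl (id ` S))" using u S by simp
    then obtain n where "n \<in> S \<rightarrow> P" "b = (\<Oplus>i\<in>S. n i \<otimes> id i)"
      using mem_ideal_prod_Idl[OF iP S(1), of id b] S(2) by (auto simp: id_def)
    then show "\<exists>u\<in>carrier R - P. \<exists>n\<in>S \<rightarrow> P. \<exists>h\<in>C. u \<otimes> id e = h \<oplus> (\<Oplus>i\<in>S. n i \<otimes> id i)"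
      using u by (intro bexI[of _ u] bexI[of _ n] bexI[of _ h]) auto
  qed
  then have "S \<subseteq> prime_sat R P C" using S(2) by (auto simp: prime_sat_def)
  then show ?thesis using S(3) Idl_least[OF prime_sat_ideal[OF P C]] by auto
qed

text \<open>Each of finitely many generators has a power in \<open>C\<close>, and by
  \<open>power_Idl_insert\<close> the exponents add up.\<close>

lemma power_in_ideal:
  assumes A: "ideal A R" and C: "ideal C R" and "\<And>p. p \<in> A \<Longrightarrow> \<exists>k::nat. p [^] k \<in> C"
  shows "\<exists>N. ideal_pow R A N \<subseteq> C"
proof -
  obtain S where S: "finite S" "S \<subseteq> carrier R" "A = Idl S" using fg_ideal[OF A] .
  have pw: "\<forall>p\<in>S. \<exists>k::nat. p [^] k \<in> C" using assms(3) S genideal_self[OF S(2)] by auto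
  have "\<exists>N. ideal_pow R (Idl S) N \<subseteq> C" using S(1,2) pw
  proof (induction S rule: finite_induct)
    case empty
    have "ideal_pow R (Idl {}) 1 = Idl {}" by (intro ideal_pow_one genideal_ideal) auto
    also have "\<dots> \<subseteq> C" using Idl_least[OF C] by auto
    finally show ?case by blast
  next
    case (insert x S)
    then obtain N k where N: "ideal_pow R (Idl S) N \<subseteq> C" and k: "x [^] (k::nat) \<in> C" by auto
    have "ideal_pow R (Idl (insert x S)) (N + k) \<subseteq> ideal_pow R (Idl S) N <+>\<^bsub>R\<^esub> PIdl (x [^] k)"
      using insert by (intro power_Idl_insert) auto
    also have "\<dots> \<subseteq> C" using N k cgenideal_minimal[OF C k] by (intro set_add_least[OF C]) auto
    finally show ?case by blast
  qed
  then show ?thesis using S by auto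
qed

text \<open>Successive quotients of the ideals \<open>C + P^n\<close> are finitely generated and
  killed by \<open>P\<close>, so they split into cyclic steps; the descent ends at
  \<open>C + P^N = C\<close>.\<close>

lemma cyc_filt_powers:
  assumes P: "ideal P R" and C: "ideal C R" and N: "ideal_pow R P N \<subseteq> C"
  shows "\<exists>s. cyc_filt R P (carrier R) C s"
proof -
  note iPn = ideal_pow_ideal[OF P]
  have iA: "ideal (C <+>\<^bsub>R\<^esub> ideal_pow R P n) R" for n by (intro add_ideals C iPn)
  have "\<exists>s. cyc_filt R P (carrier R) (C <+>\<^bsub>R\<^esub> ideal_pow R P n) s" for n
  proof (induction n)
    case 0
    have "C <+>\<^bsub>R\<^esub> ideal_pow R P 0 = carrier R"
      using set_add_incl[OF C iPn[of 0]] ideal_closed(8)[OF iA[of 0]] unfolding ideal_pow_0 by auto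
    then show ?case using cyc_filt.trivial[OF oneideal] by metis
  next
    case (Suc n)
    let ?B = "C <+>\<^bsub>R\<^esub> ideal_pow R P (Suc n)" and ?A = "C <+>\<^bsub>R\<^esub> ideal_pow R P n"
    have CB: "C \<subseteq> ?B" "ideal_pow R P (Suc n) \<subseteq> ?B" by (rule set_add_incl[OF C iPn])+
    obtain S where S: "finite S" "S \<subseteq> carrier R" "ideal_pow R P n = Idl S" using fg_ideal[OF iPn] .
    have Sn: "S \<subseteq> ideal_pow R P n" using S genideal_self by auto
    have "\<exists>s. cyc_filt R P (Idl (?B \<union> S)) ?B s"
    proof (rule cyc_filt_generators[OF iA S(1,2)])
      fix p x assume p: "p \<in> P" and "x \<in> S"
      then have "x \<otimes> p \<in> ideal_pow R P (Suc n)" unfolding ideal_pow_Suc using Sn by (auto intro: ideal_prod.prod)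
      moreover have "x \<otimes> p = p \<otimes> x" using p \<open>x \<in> S\<close> S ideal_closed(7)[OF P] by (intro m_comm) auto
      ultimately show "p \<otimes> x \<in> ?B" using CB by auto
    qed
    moreover have "Idl (?B \<union> S) = ?A"
    proof
      have "?B \<union> S \<subseteq> carrier R" by (intro Un_least ideal_closed(8)[OF iA] S)
      note D = genideal_ideal[OF this] genideal_self[OF this]
      have "?B \<subseteq> ?A"
        using ideal_pow_decreasing[OF P, of n "Suc n"] set_add_incl[OF C iPn[of n]]
        by (intro set_add_least[OF iA]) auto
      then show "Idl (?B \<union> S) \<subseteq> ?A" using Sn set_add_incl[OF C iPn[of n]] by (intro Idl_least[OF iA]) auto
      have "ideal_pow R P n \<subseteq> Idl (?B \<union> S)" unfolding S(3) using D by (intro Idl_least) auto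
      then show "?A \<subseteq> Idl (?B \<union> S)" using D CB by (intro set_add_least[OF D(1)]) auto
    qed
    ultimately show ?case using Suc cyc_filt_trans[of R P "carrier R" ?A _ ?B] by metis
  qed
  moreover have "C <+>\<^bsub>R\<^esub> ideal_pow R P N = C"
    using set_add_incl[OF C iPn[of N]] set_add_least[OF C subset_refl N] by auto
  ultimately show ?thesis by metis
qed

text \<open>This is Krull's principal ideal theorem in the form that there is always room for a prime
  containing \<open>x\<close> strictly between \<open>Q\<close> and \<open>P\<close>. The proof is the classical one with the symbolic
  powers \<open>sym n\<close> of \<open>P0\<close> modulo \<open>Q\<close>; localization at \<open>P\<close> is replaced by saturation.\<close>

lemma prime_between:
  assumes Q: "primeideal Q R" and P0: "primeideal P0 R" and P: "primeideal P R"
    and sub: "Q \<subset> P0" "P0 \<subset> P" and x: "x \<in> P"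
  shows "\<exists>P'. primeideal P' R \<and> Q \<subset> P' \<and> P' \<subset> P \<and> x \<in> P'"
proof (rule ccontr)
  assume neg: "\<not> ?thesis"
  have iQ: "ideal Q R" and iP0: "ideal P0 R" and iP: "ideal P R"
    using Q P0 P primeideal.axioms by auto
  have xP0: "x \<notin> P0" using neg P0 sub by auto
  have xc: "x \<in> carrier R" using x ideal_closed[OF iP] by auto
  note iX = cgenideal_ideal[OF xc]
  define a where "a = Q <+>\<^bsub>R\<^esub> PIdl x"
  have ia: "ideal a R" unfolding a_def by (intro add_ideals iQ iX)
  have Qa: "Q \<subseteq> a" "x \<in> a" unfolding a_def using set_add_incl[OF iQ iX] cgenideal_self[OF xc] by auto
  \<comment> \<open>No prime strictly below \<open>P\<close> contains \<open>a\<close>, since it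
    would lie strictly above \<open>Q\<close> and contain \<open>x\<close>. Hence \<open>P\<close>
    is nilpotent modulo \<open>a\<close> over \<open>R_P\<close>, which makes the quotient there of
    finite length.\<close>
  have "\<exists>k::nat. p [^] k \<in> prime_sat R P a" if p: "p \<in> P" for p
  proof (rule ccontr)
    assume "\<not> ?thesis"
    then obtain P' where P': "primeideal P' R" "a \<subseteq> P'" "P' \<subset> P"
      using exists_prime_below[OF ia P p] by blast
    moreover have "Q \<subset> P'" using Qa P' sub xP0 by auto
    ultimately show False using neg Qa by auto
  qed
  then obtain N where N: "ideal_pow R P N \<subseteq> prime_sat R P a"
    using power_in_ideal[OF iP prime_sat_ideal[OF P ia]] by auto
  define sym where "sym n = prime_sat R P0 (Q <+>\<^bsub>R\<^esub> ideal_pow R P0 n)" for n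
  \<comment> \<open>This corresponds to the image of \<open>sym n\<close> in the finite length
    quotient of \<open>R_P\<close> by \<open>a\<close>. The images decrease with \<open>n\<close>,
    so two consecutive ones agree.\<close>
  define c where "c n = prime_sat R P (sym n <+>\<^bsub>R\<^esub> PIdl x)" for n
  have iQn: "ideal (Q <+>\<^bsub>R\<^esub> ideal_pow R P0 n) R" for n by (intro add_ideals iQ ideal_pow_ideal iP0)
  have isym: "ideal (sym n) R" for n unfolding sym_def by (intro prime_sat_ideal P0 iQn)
  have isx: "ideal (sym n <+>\<^bsub>R\<^esub> PIdl x) R" for n by (intro add_ideals isym iX)
  have ic: "ideal (c n) R" for n unfolding c_def by (intro prime_sat_ideal P isx)
  have base: "Q \<subseteq> sym n" "ideal_pow R P0 n \<subseteq> sym n" for n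
    using set_add_incl[OF iQ ideal_pow_ideal[OF iP0, of n]] prime_sat_incl[OF P0 ideal_closed(8)[OF iQn[of n]]]
    unfolding sym_def by auto
  have dec: "sym (Suc n) \<subseteq> sym n" for n
  proof -
    have "Q <+>\<^bsub>R\<^esub> ideal_pow R P0 (Suc n) \<subseteq> Q <+>\<^bsub>R\<^esub> ideal_pow R P0 n"
      using set_add_incl[OF iQ ideal_pow_ideal[OF iP0, of n]] ideal_pow_decreasing[OF iP0, of n "Suc n"]
      by (intro set_add_least[OF iQn]) auto
    then show ?thesis unfolding sym_def by (rule prime_sat_mono)
  qed
  have cdec: "c (Suc n) \<subseteq> c n" for n
    unfolding c_def using dec[of n] set_add_incl[OF isym[of n] iX]
    by (intro prime_sat_mono set_add_least[OF isx]) auto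
  have symsat: "prime_sat R P0 (sym n) \<subseteq> sym n" "prime_sat R P (sym n) \<subseteq> sym n" for n
    unfolding sym_def using prime_sat_idem[OF P0 P0 subset_refl] prime_sat_idem[OF P0 P] sub
      ideal_closed(8)[OF iQn[of n]] by auto
  have csat: "prime_sat R P (c n) \<subseteq> c n" for n
    unfolding c_def by (rule prime_sat_idem[OF P P subset_refl ideal_closed(8)[OF isx]])
  have "prime_sat R P a \<subseteq> c n" for n
    unfolding c_def a_def
    by (intro prime_sat_mono set_add_least[OF isx] set_add_incl[OF isym[of n] iX]
        order_trans[OF base(1)[of n] set_add_incl(1)[OF isym[of n] iX]])
  then have cN: "ideal_pow R P N \<subseteq> c n" for n using N by auto
  obtain s where "cyc_filt R P (carrier R) (ideal_pow R P N) s"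
    using cyc_filt_powers[OF iP ideal_pow_ideal[OF iP] subset_refl] by auto
  from cyc_filt_length[OF P this] obtain f :: "'a set \<Rightarrow> nat" where f: "\<And>c c'. ideal c R \<Longrightarrow> ideal c' R \<Longrightarrow>
      prime_sat R P c' \<subseteq> c' \<Longrightarrow> ideal_pow R P N \<subseteq> c' \<Longrightarrow> c' \<subseteq> c
      \<Longrightarrow> f c' \<le> f c \<and> (f c' = f c \<longrightarrow> c \<inter> carrier R \<subseteq> c')" by metis
  have "\<exists>n. f (c (Suc n)) = f (c n)"
  proof (rule ccontr)
    assume "\<nexists>n. f (c (Suc n)) = f (c n)"
    then have less: "f (c (Suc n)) < f (c n)" for n
      using f[OF ic ic csat cN cdec, of n] by (metis le_neq_implies_less)
    have "f (c n) + n \<le> f (c 0)" for n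
    proof (induction n)
      case (Suc n)
      then show ?case using less[of n] by linarith
    qed simp
    from this[of "Suc (f (c 0))"] show False by simp
  qed
  then obtain n where "f (c (Suc n)) = f (c n)" by auto
  then have cn: "c n \<subseteq> c (Suc n)"
    using f[OF ic ic csat cN cdec, of n] ideal_closed(8)[OF ic[of n]] by auto
  have iPs: "ideal (P \<cdot> sym n) R" by (intro ideal_prod_is_ideal iP isym)
  have "sym n \<subseteq> prime_sat R P (sym (Suc n) <+>\<^bsub>R\<^esub> P \<cdot> sym n)"
  proof
    fix r assume r: "r \<in> sym n"
    have rc: "r \<in> carrier R" using r ideal_closed[OF isym] by auto
    have "r \<in> c n" unfolding c_def
      using r set_add_incl[OF isym[of n] iX] prime_sat_incl[OF P ideal_closed(8)[OF isx[of n]]] by auto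
    then have "r \<in> c (Suc n)" using cn by auto
    then obtain t r' v where t: "t \<in> carrier R - P" "r' \<in> sym (Suc n)" "v \<in> carrier R"
      "t \<otimes> r = r' \<oplus> v \<otimes> x" unfolding c_def prime_sat_def set_add_iff cgenideal_def by auto
    have tc: "t \<in> carrier R" and r'c: "r' \<in> carrier R" using t ideal_closed[OF isym] by auto
    \<comment> \<open>\<open>sym n\<close> is saturated with respect to \<open>P0\<close> and
      \<open>x\<close> is not in \<open>P0\<close>, so \<open>v x\<close> in \<open>sym n\<close>
      forces \<open>v\<close> in \<open>sym n\<close>. Over \<open>R_P\<close> this gives
      \<open>sym n\<close> inside \<open>sym (Suc n) + P sym n\<close>, ready for Nakayama's
      lemma.\<close>
    have "x \<otimes> v = t \<otimes> r \<ominus> r'" unfolding t(4) using r'c t(3) xc by algebra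
    moreover have "t \<otimes> r \<ominus> r' \<in> sym n"
      using dec[of n] t(2) by (intro ideal_closed(4,5)[OF isym[of n]] r tc) auto
    ultimately have "x \<otimes> v \<in> sym n" by simp
    then have "v \<in> prime_sat R P0 (sym n)" using t(3) xP0 xc unfolding prime_sat_def by blast
    then have "v \<in> sym n" using symsat by auto
    then have "x \<otimes> v \<in> P \<cdot> sym n" using x by (auto intro: ideal_prod.prod)
    moreover have "t \<otimes> r = r' \<oplus> x \<otimes> v" using t xc by (simp add: m_comm)
    ultimately show "r \<in> prime_sat R P (sym (Suc n) <+>\<^bsub>R\<^esub> P \<cdot> sym n)"
      using t rc unfolding prime_sat_def set_add_iff by blast
  qed
  then have "sym n \<subseteq> prime_sat R P (sym (Suc n))" by (rule nakayama_prime[OF P isym isym])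
  then have symn: "sym n \<subseteq> sym (Suc n)" using symsat by blast
  \<comment> \<open>Over the localization at \<open>P0\<close> symbolic powers become ordinary
    powers modulo \<open>Q\<close>. A second use of Nakayama's lemma, now at \<open>P0\<close>, puts
    \<open>P0^n\<close> into \<open>Q\<close>.\<close>
  have "P0 \<cdot> ideal_pow R P0 n = ideal_pow R P0 (Suc n)"
    unfolding ideal_pow_Suc by (rule ideal_prod_commute[OF iP0 ideal_pow_ideal[OF iP0]])
  then have "ideal_pow R P0 n \<subseteq> prime_sat R P0 (Q <+>\<^bsub>R\<^esub> P0 \<cdot> ideal_pow R P0 n)"
    using order_trans[OF base(2)[of n] symn] unfolding sym_def by metis
  then have "ideal_pow R P0 n \<subseteq> prime_sat R P0 Q"
    by (rule nakayama_prime[OF P0 ideal_pow_ideal[OF iP0] iQ])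
  then have Pn: "ideal_pow R P0 n \<subseteq> Q" using prime_sat_prime[OF P0 Q] sub by auto
  have "P0 \<subseteq> Q"
  proof
    fix y assume y: "y \<in> P0"
    then have "y [^] n \<in> Q" using pow_mem_ideal_pow[OF iP0 y] Pn by auto
    then show "y \<in> Q" using primeideal_pow[OF Q] y ideal_closed[OF iP0] by auto
  qed
  then show False using sub by auto
qed

end

section \<open>Krull dimension of Noetherian local rings\<close>

definition prime_chain :: "('a, 'b) ring_scheme \<Rightarrow> (nat \<Rightarrow> 'a set) \<Rightarrow> nat \<Rightarrow> bool" where
  "prime_chain R P e \<longleftrightarrow> (\<forall>i\<le>e. primeideal (P i) R) \<and> (\<forall>i<e. P i \<subset> P (Suc i))"

lemma prime_chain_extend:
  assumes "prime_chain R P e" "primeideal Q R" "P e \<subset> Q"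
  shows "prime_chain R (P(Suc e := Q)) (Suc e)"
  using assms by (auto simp: prime_chain_def less_Suc_eq le_Suc_eq)

lemma prime_chain_krull_dim:
  assumes "prime_chain R P e"
  shows "enat e \<le> krull_dim R"
  unfolding krull_dim_def using assms by (intro Sup_upper) (auto simp: prime_chain_def)

context noetherian_cring
begin

text \<open>From the top down, each inner prime is replaced by a prime between its current
  neighbours that contains \<open>x\<close>, as supplied by \<open>prime_between\<close>; the bottom
  prime is dropped. Iteration over a list yields Krull's height theorem.\<close>

lemma prime_chain_shift:
  assumes "prime_chain R P (Suc e)" "x \<in> P (Suc e)"
  shows "\<exists>Q. prime_chain R Q e \<and> Q e = P (Suc e) \<and> P 0 \<subseteq> Q 0 \<and> x \<in> Q 0"
  using assms
proof (induction e arbitrary: P)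
  case 0
  then show ?case by (intro exI[of _ "\<lambda>i. P (Suc i)"]) (auto simp: prime_chain_def)
next
  case (Suc e)
  have "primeideal (P e) R" "primeideal (P (Suc e)) R" "primeideal (P (Suc (Suc e))) R"
    "P e \<subset> P (Suc e)" "P (Suc e) \<subset> P (Suc (Suc e))"
    using Suc.prems(1) by (auto simp: prime_chain_def)
  from prime_between[OF this Suc.prems(2)] obtain P' where P': "primeideal P' R" "P e \<subset> P'"
    "P' \<subset> P (Suc (Suc e))" "x \<in> P'" by auto
  have "prime_chain R P e" using Suc.prems(1) by (auto simp: prime_chain_def)
  note c = prime_chain_extend[OF this P'(1,2)]
  obtain Q where "prime_chain R Q e" "Q e = (P(Suc e := P')) (Suc e)"
    "(P(Suc e := P')) 0 \<subseteq> Q 0" "x \<in> Q 0"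
    using Suc.IH[OF c] P'(4) by (metis fun_upd_same)
  then have Q: "prime_chain R Q e" "Q e = P'" "P 0 \<subseteq> Q 0" "x \<in> Q 0" by auto
  have "prime_chain R (Q(Suc e := P (Suc (Suc e)))) (Suc e)"
    using Suc.prems(1) Q P' by (intro prime_chain_extend) (auto simp: prime_chain_def)
  moreover have "(Q(Suc e := P (Suc (Suc e)))) 0 = Q 0" by simp
  ultimately show ?case using Q(3,4) by (metis fun_upd_same)
qed

lemma prime_chain_shift_list:
  assumes "prime_chain R P (length xs + e)" "set xs \<subseteq> P (length xs + e)"
  shows "\<exists>Q. prime_chain R Q e \<and> P 0 \<subseteq> Q 0 \<and> set xs \<subseteq> Q 0"
  using assms
proof (induction xs arbitrary: P)
  case Nil
  then show ?case by auto
next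
  case (Cons x xs)
  from prime_chain_shift[of P "length xs + e" x] Cons.prems
  obtain P' where P': "prime_chain R P' (length xs + e)"
    "P' (length xs + e) = P (length (x # xs) + e)" "P 0 \<subseteq> P' 0" "x \<in> P' 0" by auto
  from Cons.IH[of P'] P' Cons.prems
  obtain Q where "prime_chain R Q e" "P' 0 \<subseteq> Q 0" "set xs \<subseteq> Q 0" by auto
  then show ?case using P'(3,4) by (intro exI[of _ Q]) auto
qed

text \<open>The last element is regular modulo the ideal \<open>A\<close> of the preceding ones, so
  it cannot be nilpotent modulo \<open>A\<close> at \<open>P\<close>, and
  \<open>exists_prime_below\<close> finds a smaller prime over \<open>A\<close>. Thus a prime over a
  regular sequence of length \<open>i\<close> has height at least \<open>i\<close>.\<close>

lemma regular_sequence_prime_chain: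
  assumes reg: "regular_sequence R ys" and "i \<le> length ys"
    and "primeideal P R" "set (take i ys) \<subseteq> P"
  shows "\<exists>Q. prime_chain R Q i \<and> Q i = P"
  using assms(2-)
proof (induction i arbitrary: P)
  case 0
  then show ?case by (intro exI[of _ "\<lambda>_. P"]) (auto simp: prime_chain_def)
next
  case (Suc i)
  define A y where "A = Idl (set (take i ys))" and "y = ys ! i"
  have ys: "set ys \<subseteq> carrier R" using reg by (auto simp: regular_sequence_def)
  then have ti: "set (take i ys) \<subseteq> carrier R" and y: "y \<in> carrier R"
    using Suc.prems(1) set_take_subset[of i ys] by (auto simp: y_def)
  have iA: "ideal A R" unfolding A_def using ti by (rule genideal_ideal)
  have iP: "ideal P R" using Suc.prems primeideal.axioms by auto
  have yP: "y \<in> P" and AP: "A \<subseteq> P"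
    using Suc.prems Idl_least[OF iP, of "set (take i ys)"]
    by (auto simp: A_def y_def take_Suc_conv_app_nth)
  have regy: "a \<in> A" if "a \<in> carrier R" "y \<otimes> a \<in> A" for a
    using reg Suc.prems(1) that by (auto simp: regular_sequence_def A_def y_def)
  have regyk: "a \<in> A" if "a \<in> carrier R" "a \<otimes> y [^] (k::nat) \<in> A" for a k
    using that
  proof (induction k)
    case (Suc k)
    then show ?case using regy[of "a \<otimes> y [^] k"] y by (simp add: m_ac)
  qed simp
  have "y [^] k \<notin> prime_sat R P A" for k :: nat
    using regyk AP by (auto simp: prime_sat_def)
  then obtain P' where P': "primeideal P' R" "A \<subseteq> P'" and sub: "P' \<subset> P"
    using exists_prime_below[OF iA Suc.prems(2) yP] by blast
  have "set (take i ys) \<subseteq> P'" using P'(2) genideal_self[OF ti] by (auto simp: A_def)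
  then obtain Q where Q: "prime_chain R Q i" "Q i = P'" using Suc.IH[OF _ P'(1)] Suc.prems(1) by auto
  then have "prime_chain R (Q(Suc i := P)) (Suc i)"
    using sub by (intro prime_chain_extend Suc.prems(2)) auto
  then show ?case by (metis fun_upd_same)
qed

end

section \<open>Local rings: units, Nakayama's lemma at the maximal ideal, dimension\<close>

locale noetherian_local_cring = noetherian_cring R for R (structure) +
  fixes m
  assumes m_max: "maximalideal m R" and m_unique: "maximalideal n R \<Longrightarrow> n = m"
begin

lemma m_ideal: "ideal m R"
  using m_max maximalideal.axioms by auto

lemma m_prime: "primeideal m R"
  using maximalideal_prime[OF m_max] .

lemma one_notin_m: "\<one> \<notin> m"
  using primeideal_one[OF m_prime] by auto

lemma proper_ideal_le_m:
  assumes A: "ideal A R" "A \<noteq> carrier R"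
  shows "A \<subseteq> m"
proof -
  define \<F> where "\<F> = {K. ideal K R \<and> A \<subseteq> K \<and> K \<noteq> carrier R}"
  have "\<exists>M\<in>\<F>. \<forall>K\<in>\<F>. M \<subseteq> K \<longrightarrow> K = M"
    using A by (intro exists_maximal_ideal) (auto simp: \<F>_def)
  then obtain M where M: "M \<in> \<F>" and max: "\<And>K. K \<in> \<F> \<Longrightarrow> M \<subseteq> K \<Longrightarrow> K = M" by blast
  have "maximalideal M R"
  proof (rule maximalidealI)
    show "ideal M R" "carrier R \<noteq> M" using M by (auto simp: \<F>_def)
    fix J assume "ideal J R" "M \<subseteq> J" "J \<subseteq> carrier R"
    then show "J = M \<or> J = carrier R" using max[of J] M by (auto simp: \<F>_def)
  qed
  then show ?thesis using m_unique M by (auto simp: \<F>_def)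
qed

lemma unit_of_notin_m:
  assumes "r \<in> carrier R" "r \<notin> m"
  shows "\<exists>s\<in>carrier R. s \<otimes> r = \<one>"
proof -
  have "PIdl r = carrier R"
    using proper_ideal_le_m[OF cgenideal_ideal] cgenideal_self assms by auto
  then have "\<one> \<in> PIdl r" by auto
  then show ?thesis by (auto simp: cgenideal_def)
qed

lemma prime_le_m: "primeideal P R \<Longrightarrow> P \<subseteq> m"
  using proper_ideal_le_m primeideal.axioms(1) primeideal.I_notcarr by metis

lemma ideal_unit_cancel:
  assumes C: "ideal C R" and "t \<in> carrier R" "t \<notin> m" "r \<in> carrier R" "t \<otimes> r \<in> C"
  shows "r \<in> C"
proof -
  obtain s where s: "s \<in> carrier R" "s \<otimes> t = \<one>" using unit_of_notin_m assms by auto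
  have "r = s \<otimes> (t \<otimes> r)" using s assms by (simp flip: m_assoc)
  then show ?thesis using s assms ideal_closed(5)[OF C, of "t \<otimes> r" s] by simp
qed

lemma m_sat: "ideal C R \<Longrightarrow> prime_sat R m C \<subseteq> C"
  using ideal_unit_cancel by (auto simp: prime_sat_def)

lemma nakayama:
  assumes "ideal B R" "ideal C R" "B \<subseteq> C <+>\<^bsub>R\<^esub> m \<cdot> B"
  shows "B \<subseteq> C"
proof -
  have "ideal (C <+>\<^bsub>R\<^esub> m \<cdot> B) R" by (intro add_ideals ideal_prod_is_ideal assms m_ideal)
  from prime_sat_incl[OF m_prime ideal_closed(8)[OF this]]
  have "B \<subseteq> prime_sat R m (C <+>\<^bsub>R\<^esub> m \<cdot> B)" using assms(3) by auto
  from nakayama_prime[OF m_prime assms(1,2) this] show ?thesis using m_sat[OF assms(2)] by auto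
qed

text \<open>The height theorem for \<open>m\<close>: a chain with more than \<open>length xs\<close>
  steps ending in \<open>m\<close> would shift to a chain with at least one strict inclusion between
  primes containing \<open>xs\<close>.\<close>

lemma krull_dim_le:
  assumes "set xs \<subseteq> m" and only: "\<And>P. primeideal P R \<Longrightarrow> set xs \<subseteq> P \<Longrightarrow> P = m"
  shows "krull_dim R \<le> enat (length xs)"
proof -
  have *: "e \<le> length xs" if ch: "prime_chain R P e" and top: "P e = m" for P e
  proof (rule ccontr)
    assume "\<not> ?thesis"
    then obtain k where k: "e = length xs + Suc k" by (metis add_Suc_right less_imp_Suc_add not_le)
    obtain Q where Q: "prime_chain R Q (Suc k)" "set xs \<subseteq> Q 0"
      using prime_chain_shift_list[of P xs "Suc k"] ch top assms(1) k by auto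
    have "primeideal (Q 0) R" "primeideal (Q 1) R" "Q 0 \<subset> Q 1"
      using Q(1) by (auto simp: prime_chain_def)
    then show False using only[of "Q 0"] only[of "Q 1"] Q(2) by auto
  qed
  have "e \<le> length xs" if ch: "prime_chain R P e" for P e
  proof (cases "P e = m")
    case False
    then have "P e \<subset> m" using ch prime_le_m by (auto simp: prime_chain_def)
    from prime_chain_extend[OF ch m_prime this] *[of "P(Suc e := m)" "Suc e"] show ?thesis by auto
  qed (use * ch in auto)
  then show ?thesis unfolding krull_dim_def by (intro Sup_least) (auto simp: prime_chain_def)
qed

text \<open>If no power of some \<open>p\<close> in \<open>m\<close> lay in \<open>A\<close>, a
  prime over \<open>A\<close> avoiding the powers of \<open>p\<close> would differ from
  \<open>m\<close>.\<close>

lemma m_primary_radical: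
  assumes A: "ideal A R" and only: "\<And>P. primeideal P R \<Longrightarrow> A \<subseteq> P \<Longrightarrow> P = m"
  shows "\<exists>N. ideal_pow R m N \<subseteq> A"
proof (rule power_in_ideal[OF m_ideal A])
  fix p assume p: "p \<in> m"
  then have pc: "p \<in> carrier R" using ideal_closed[OF m_ideal] by auto
  show "\<exists>k::nat. p [^] k \<in> A"
  proof (rule ccontr)
    assume no: "\<not> ?thesis"
    define T where "T = range (\<lambda>k::nat. p [^] k)"
    have "\<exists>P. primeideal P R \<and> A \<subseteq> P \<and> P \<inter> T = {}"
    proof (rule exists_prime_avoiding[OF A])
      show "\<one> \<in> T" unfolding T_def by (rule range_eqI[of _ _ "0::nat"]) simp
      show "A \<inter> T = {}" using no by (auto simp: T_def)
      show "s \<otimes> t \<in> T" if "s \<in> T" "t \<in> T" for s t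
        using that pc by (auto simp: T_def nat_pow_mult)
    qed
    then obtain P where P: "primeideal P R" "A \<subseteq> P" "P \<inter> T = {}" by auto
    have "p [^] (1::nat) \<in> T" unfolding T_def by (rule rangeI)
    then have "p \<notin> P" using P(3) pc by auto
    then show False using only[OF P(1,2)] p by auto
  qed
qed

lemma krull_dim_finite: "\<exists>d. krull_dim R = enat d"
proof -
  obtain S where S: "finite S" "S \<subseteq> carrier R" "m = Idl S" using fg_ideal[OF m_ideal] .
  obtain xs where xs: "set xs = S" using finite_list[OF S(1)] by auto
  have "krull_dim R \<le> enat (length xs)"
  proof (rule krull_dim_le)
    show "set xs \<subseteq> m" using genideal_self[OF S(2)] S xs by auto
    fix P assume P: "primeideal P R" "set xs \<subseteq> P"
    then have "m \<subseteq> P" using Idl_least[of P S] S xs primeideal.axioms(1) by auto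
    then show "P = m" using prime_le_m[OF P(1)] by auto
  qed
  then show ?thesis by (cases "krull_dim R") auto
qed

end

text \<open>Equality of depth and dimension provides a regular sequence of length \<open>d\<close>,
  and a prime containing it has height at least \<open>d\<close>, hence equals \<open>m\<close>. The
  elements \<open>ys\<close> serve to bound the growth of lengths from above.\<close>

lemma cohen_macaulay_system_of_parameters:
  fixes R (structure)
  assumes "cohen_macaulay_local R m"
  shows "\<exists>d ys. krull_dim R = enat d \<and> length ys = d \<and> set ys \<subseteq> m \<and> (\<exists>N. ideal_pow R m N \<subseteq> Idl (set ys))"
proof -
  interpret noetherian_local_cring R m
    using assms by (auto simp: cohen_macaulay_local_def noetherian_local_def noetherian_local_cring_def
        noetherian_local_cring_axioms_def noetherian_cring_def)
  obtain d where d: "krull_dim R = enat d" using krull_dim_finite by auto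
  have depth: "local_depth R m = enat d" using assms d by (auto simp: cohen_macaulay_local_def)
  have "\<exists>ys. length ys = d \<and> set ys \<subseteq> m \<and> regular_sequence R ys"
  \<comment> \<open>The supremum in \<open>local_depth\<close> is 0 for an empty set too, so for
    \<open>d = 0\<close> the empty sequence is exhibited directly. For \<open>d = Suc d'\<close> a
    supremum above \<open>d'\<close> forces a sequence of length at least \<open>d\<close>.\<close>
  proof (cases d)
    case 0
    have "Idl {} \<noteq> carrier R"
      using Idl_least[OF m_ideal, of "{}"] one_notin_m by auto
    then show ?thesis using 0 by (intro exI[of _ "[]"]) (auto simp: regular_sequence_def)
  next
    case (Suc d')
    have "\<exists>ys. length ys \<ge> d \<and> set ys \<subseteq> m \<and> regular_sequence R ys"
    proof (rule ccontr)
      assume no: "\<not> ?thesis"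
      have "local_depth R m \<le> enat d'" unfolding local_depth_def
        using no Suc by (intro Sup_least) (force simp: not_le)
      then show False using depth Suc by auto
    qed
    then obtain ys where ys: "length ys \<ge> d" "set ys \<subseteq> m" "regular_sequence R ys" by auto
    have "enat (length ys) \<le> local_depth R m"
      unfolding local_depth_def using ys by (intro Sup_upper) auto
    then show ?thesis using ys depth by (intro exI[of _ ys]) auto
  qed
  then obtain ys where ys: "length ys = d" "set ys \<subseteq> m" "regular_sequence R ys" by auto
  have yc: "set ys \<subseteq> carrier R" using ys ideal_closed(8)[OF m_ideal] by auto
  have "\<exists>N. ideal_pow R m N \<subseteq> Idl (set ys)"
  proof (rule m_primary_radical[OF genideal_ideal[OF yc]])
    fix P assume P: "primeideal P R" "Idl (set ys) \<subseteq> P"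
    then have "set (take d ys) \<subseteq> P" using genideal_self[OF yc] ys(1) by auto
    then obtain Q where Q: "prime_chain R Q d" "Q d = P"
      using regular_sequence_prime_chain[OF ys(3) _ P(1), of d] ys(1) by auto
    show "P = m"
    proof (rule ccontr)
      assume "P \<noteq> m"
      then have "Q d \<subset> m" using prime_le_m[OF P(1)] Q by auto
      from prime_chain_krull_dim[OF prime_chain_extend[OF Q(1) m_prime this]] d show False by auto
    qed
  qed
  then show ?thesis using d ys by auto
qed

section \<open>Polynomial functions\<close>

definition monomial :: "('a, 'b) ring_scheme \<Rightarrow> 'i set \<Rightarrow> ('i \<Rightarrow> nat) \<Rightarrow> ('i \<Rightarrow> 'a) \<Rightarrow> 'a" where
  "monomial R S \<alpha> x = (\<Otimes>\<^bsub>R\<^esub>i\<in>S. x i [^]\<^bsub>R\<^esub> \<alpha> i)"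

lemma (in cring) monomial_closed [simp]:
  "x \<in> S \<rightarrow> carrier R \<Longrightarrow> monomial R S \<alpha> x \<in> carrier R"
  unfolding monomial_def by (intro finprod_closed) auto

lemma (in cring) monomial_insert:
  assumes "finite S" "s \<notin> S" "x \<in> insert s S \<rightarrow> carrier R"
  shows "monomial R (insert s S) \<alpha> x = x s [^] \<alpha> s \<otimes> monomial R S \<alpha> x"
  unfolding monomial_def using assms by (subst finprod_insert) auto

lemma (in cring) monomial_cong:
  assumes "\<And>i. i \<in> S \<Longrightarrow> x i = y i" "\<And>i. i \<in> S \<Longrightarrow> \<alpha> i = \<beta> i" "y \<in> S \<rightarrow> carrier R"
  shows "monomial R S \<alpha> x = monomial R S \<beta> y"
  unfolding monomial_def using assms by (intro finprod_cong') (auto simp: Pi_iff)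

lemma (in domain) finite_zeros_eval:
  assumes "set p \<subseteq> carrier R" "\<not> set p \<subseteq> {\<zero>}"
  shows "finite {t \<in> carrier R. eval p t = \<zero>}"
proof -
  have "normalize p \<noteq> []" using assms(2)
  proof (induction p)
    case (Cons a p)
    then show ?case by (cases "a = \<zero>") auto
  qed simp
  moreover have "normalize p \<in> carrier (poly_ring R)"
    using normalize_gives_polynomial[OF assms(1)] by (simp add: univ_poly_carrier)
  ultimately have "finite {t \<in> carrier R. eval (normalize p) t = \<zero>}"
    using finite_number_of_roots[of "normalize p"] by (simp add: is_root_def)
  then show ?thesis using eval_normalize[OF assms(1)] by (simp cong: conj_cong)
qed

text \<open>\<open>eval\<close> reads coefficient lists from the highest power downwards, hence the
  \<open>rev\<close>.\<close>

lemma (in cring) eval_power_sum: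
  assumes "\<And>j. j < n \<Longrightarrow> d j \<in> carrier R" "t \<in> carrier R"
  shows "eval (map d (rev [0..<n])) t = (\<Oplus>j\<in>{..<n::nat}. d j \<otimes> t [^] j)"
  using assms(1)
proof (induction n)
  case (Suc n)
  have "(\<Oplus>j\<in>{..<Suc n}. d j \<otimes> t [^] j) = d n \<otimes> t [^] n \<oplus> (\<Oplus>j\<in>{..<n}. d j \<otimes> t [^] j)"
    unfolding lessThan_Suc using Suc.prems assms(2) by (subst finsum_insert) auto
  then show ?case using Suc by simp
qed simp

text \<open>Induction on the variables: with the others fixed, the function is a polynomial in the
  variable \<open>s\<close> with infinitely many zeros. Exponents are given by an index set
  \<open>J\<close> and a map \<open>e\<close>, so that the induction step can ignore the exponent of
  \<open>s\<close> instead of changing the exponent vectors.\<close>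

lemma (in field) polynomial_coeffs_zero:
  assumes inf: "infinite (carrier R)" and "finite S" "finite J" "C \<in> J \<rightarrow> carrier R"
    and "\<And>a b. a \<in> J \<Longrightarrow> b \<in> J \<Longrightarrow> (\<And>i. i \<in> S \<Longrightarrow> e a i = e b i) \<Longrightarrow> a = b"
    and "\<And>x. x \<in> S \<rightarrow> carrier R \<Longrightarrow> (\<Oplus>a\<in>J. C a \<otimes> monomial R S (e a) x) = \<zero>"
    and "a \<in> J"
  shows "C a = \<zero>"
  using assms(2-)
proof (induction S arbitrary: J a rule: finite_induct)
  case empty
  then have "J = {a}" by auto
  then show ?case using empty(4)[of "\<lambda>_. \<zero>"] empty(2) by (simp add: monomial_def)
next
  case (insert s S)
  \<comment> \<open>Grouping by the exponent of \<open>s\<close>: the terms indexed by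
    \<open>J' j\<close> form the coefficient of the \<open>j\<close>-th power of
    \<open>s\<close>.\<close>
  define J' where "J' j = {b \<in> J. e b s = j}" for j
  define N where "N = Suc (Max ((\<lambda>b. e b s) ` J))"
  have less: "e b s < N" if "b \<in> J" for b
    unfolding N_def using that insert.prems(1) by (simp add: le_imp_less_Suc)
  have finJ': "finite (J' j)" and J'sub: "J' j \<subseteq> J" for j using insert.prems(1) by (auto simp: J'_def)
  have Jun: "J = (\<Union>j\<in>{..<N}. J' j)" using less by (auto simp: J'_def)
  have "(\<Oplus>b\<in>J' (e a s). C b \<otimes> monomial R S (e b) x) = \<zero>" if x: "x \<in> S \<rightarrow> carrier R" for x
  proof (rule ccontr)
    assume nz: "\<not> ?thesis"
    define d where "d j = (\<Oplus>b\<in>J' j. C b \<otimes> monomial R S (e b) x)" for j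
    have dc: "d j \<in> carrier R" for j
      unfolding d_def using x insert.prems(2) J'sub[of j]
      by (intro finsum_closed) (auto simp: Pi_iff subset_iff)
    have "eval (map d (rev [0..<N])) t = \<zero>" if t: "t \<in> carrier R" for t
    proof -
      define y where "y = x(s := t)"
      have y: "y \<in> insert s S \<rightarrow> carrier R" using x t by (auto simp: y_def)
      have mon: "monomial R (insert s S) (e b) y = monomial R S (e b) x \<otimes> t [^] e b s" for b
      proof -
        have "monomial R S (e b) y = monomial R S (e b) x"
          using x insert.hyps by (intro monomial_cong) (auto simp: y_def)
        then show ?thesis using monomial_insert[OF insert.hyps y] t x by (simp add: y_def m_comm)
      qed
      have "\<zero> = (\<Oplus>b\<in>J. C b \<otimes> monomial R (insert s S) (e b) y)"
        using insert.prems(4)[OF y] by simp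
      also have "\<dots> = (\<Oplus>b\<in>J. C b \<otimes> monomial R S (e b) x \<otimes> t [^] e b s)"
        using insert.prems(2) x t by (intro finsum_cong') (auto simp: mon m_assoc Pi_iff)
      also have "\<dots> = (\<Oplus>j\<in>{..<N}. \<Oplus>b\<in>J' j. C b \<otimes> monomial R S (e b) x \<otimes> t [^] e b s)"
        using insert.prems(2) x t J'sub finJ' unfolding Jun
        by (subst add.finprod_UN_disjoint) (auto simp: Pi_iff pairwise_def disjnt_def J'_def)
      also have "\<dots> = (\<Oplus>j\<in>{..<N}. d j \<otimes> t [^] j)"
      proof (intro finsum_cong' refl)
        fix j
        have "(\<Oplus>b\<in>J' j. C b \<otimes> monomial R S (e b) x \<otimes> t [^] e b s)
          = (\<Oplus>b\<in>J' j. C b \<otimes> monomial R S (e b) x \<otimes> t [^] j)"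
          using insert.prems(2) x t J'sub[of j] by (intro finsum_cong') (auto simp: J'_def Pi_iff)
        also have "\<dots> = d j \<otimes> t [^] j"
          unfolding d_def using insert.prems(2) x t J'sub[of j] finJ'
          by (intro finsum_ldistr[symmetric]) (auto simp: Pi_iff)
        finally show "(\<Oplus>b\<in>J' j. C b \<otimes> monomial R S (e b) x \<otimes> t [^] e b s) = d j \<otimes> t [^] j" .
      qed (use dc t in auto)
      also have "\<dots> = eval (map d (rev [0..<N])) t"
        by (rule eval_power_sum[symmetric]) (use dc t in auto)
      finally show ?thesis by simp
    qed
    then have "{t \<in> carrier R. eval (map d (rev [0..<N])) t = \<zero>} = carrier R" by auto
    moreover have "finite {t \<in> carrier R. eval (map d (rev [0..<N])) t = \<zero>}"
    proof (rule finite_zeros_eval)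
      show "set (map d (rev [0..<N])) \<subseteq> carrier R" using dc by auto
      have "d (e a s) \<in> set (map d (rev [0..<N]))" using less[OF insert.prems(5)] by auto
      then show "\<not> set (map d (rev [0..<N])) \<subseteq> {\<zero>}" using nz unfolding d_def[symmetric] by blast
    qed
    ultimately show False using inf by simp
  qed
  then show ?case
  proof (rule insert.IH[OF finJ', rotated 2])
    show "C \<in> J' (e a s) \<rightarrow> carrier R" using insert.prems(2) J'sub by auto
    show "b = c" if "b \<in> J' (e a s)" "c \<in> J' (e a s)" "\<And>i. i \<in> S \<Longrightarrow> e b i = e c i" for b c
      using that by (intro insert.prems(3)) (auto simp: J'_def)
    show "a \<in> J' (e a s)" using insert.prems(5) by (auto simp: J'_def)
  qed auto
qed

lemma poly_funs_cong:
  assumes "f \<in> poly_funs K S" "\<And>i. i \<in> S \<Longrightarrow> x i = y i"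
  shows "f x = f y"
  using assms by induction auto

lemma (in ring) poly_funs_closed:
  assumes "f \<in> poly_funs R S" "x \<in> S \<rightarrow> carrier R"
  shows "f x \<in> carrier R"
  using assms by induction auto

lemma (in cring) poly_funs_line:
  assumes "f \<in> poly_funs R S" "a \<in> S \<rightarrow> carrier R" "b \<in> S \<rightarrow> carrier R"
  shows "\<exists>p. set p \<subseteq> carrier R \<and> (\<forall>t\<in>carrier R. f (\<lambda>i\<in>S. a i \<oplus> t \<otimes> b i) = eval p t)"
proof -
  define l where "l t = (\<lambda>i\<in>S. a i \<oplus> t \<otimes> b i)" for t
  show ?thesis unfolding l_def[symmetric] using assms(1)
  proof induction
    case (const c)
    then show ?case by (intro exI[of _ "[c]"]) auto
  next
    case (var i)
    then have "a i \<in> carrier R" "b i \<in> carrier R" using assms by auto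
    then show ?case using var by (intro exI[of _ "[b i, a i]"]) (auto simp: l_def m_comm a_comm)
  next
    case (add f g)
    obtain p q where "set p \<subseteq> carrier R" "\<forall>t\<in>carrier R. f (l t) = eval p t"
      "set q \<subseteq> carrier R" "\<forall>t\<in>carrier R. g (l t) = eval q t"
      using add.IH by blast
    then show ?case
      by (intro exI[of _ "poly_add p q"] conjI poly_add_in_carrier)
        (auto simp: eval_poly_add simp del: poly_add.simps)
  next
    case (mult f g)
    obtain p q where "set p \<subseteq> carrier R" "\<forall>t\<in>carrier R. f (l t) = eval p t"
      "set q \<subseteq> carrier R" "\<forall>t\<in>carrier R. g (l t) = eval q t"
      using mult.IH by blast
    then show ?case
      by (intro exI[of _ "poly_mult p q"] conjI poly_mult_in_carrier)
        (auto simp: eval_poly_mult simp del: poly_mult.simps)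
  qed
qed

text \<open>Restriction to the line through a point where \<open>f\<close> does not vanish and a point where \<open>g\<close>
  does not vanish.\<close>

lemma (in field) poly_funs_nonzero_mult:
  assumes inf: "infinite (carrier R)" and f: "f \<in> poly_funs R S" and g: "g \<in> poly_funs R S"
    and a: "a \<in> S \<rightarrow> carrier R" "f a \<noteq> \<zero>" and b: "b \<in> S \<rightarrow> carrier R" "g b \<noteq> \<zero>"
  shows "\<exists>x \<in> S \<rightarrow>\<^sub>E carrier R. f x \<otimes> g x \<noteq> \<zero>"
proof -
  define v where "v i = b i \<ominus> a i" for i
  have v: "v \<in> S \<rightarrow> carrier R" using a b by (auto simp: v_def Pi_iff)
  define l where "l t = (\<lambda>i\<in>S. a i \<oplus> t \<otimes> v i)" for t
  obtain p q where p: "set p \<subseteq> carrier R" "\<And>t. t \<in> carrier R \<Longrightarrow> f (l t) = eval p t"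
    and q: "set q \<subseteq> carrier R" "\<And>t. t \<in> carrier R \<Longrightarrow> g (l t) = eval q t"
    using poly_funs_line[OF f a(1) v] poly_funs_line[OF g a(1) v] unfolding l_def by auto
  have zero: "eval r t = \<zero>" if "set r \<subseteq> {\<zero>}" "t \<in> carrier R" for r t
    using that by (induction r) auto
  have "f (l \<zero>) = f a"
    by (rule poly_funs_cong[OF f]) (use a v in \<open>auto simp: l_def Pi_iff\<close>)
  then have "\<not> set p \<subseteq> {\<zero>}" using a(2) p(2)[of \<zero>] zero[of p \<zero>] by auto
  note fin1 = finite_zeros_eval[OF p(1) this]
  have "g (l \<one>) = g b"
  proof (rule poly_funs_cong[OF g])
    fix i assume "i \<in> S"
    then have "a i \<in> carrier R" "b i \<in> carrier R" using a b by auto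
    then have "a i \<oplus> \<one> \<otimes> (b i \<ominus> a i) = b i" by algebra
    then show "l \<one> i = b i" using \<open>i \<in> S\<close> by (simp add: l_def v_def)
  qed
  then have "\<not> set q \<subseteq> {\<zero>}" using b(2) q(2)[of \<one>] zero[of q \<one>] by auto
  note fin2 = finite_zeros_eval[OF q(1) this]
  obtain t where t: "t \<in> carrier R" "eval p t \<noteq> \<zero>" "eval q t \<noteq> \<zero>"
  proof -
    have "\<not> carrier R \<subseteq> {t \<in> carrier R. eval p t = \<zero>} \<union> {t \<in> carrier R. eval q t = \<zero>}"
      using fin1 fin2 inf by (meson finite_UnI finite_subset)
    then show ?thesis using that by auto
  qed
  have "l t \<in> S \<rightarrow>\<^sub>E carrier R" using t(1) a(1) v by (auto simp: l_def Pi_iff)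
  moreover have "f (l t) \<otimes> g (l t) \<noteq> \<zero>"
    using t p q integral[of "eval p t" "eval q t"] eval_in_carrier by auto
  ultimately show ?thesis by auto
qed

text \<open>A polynomial function vanishing on \<open>U\<close> has zero product with
  \<open>p\<close> at every point, so by \<open>poly_funs_nonzero_mult\<close> it vanishes
  everywhere. This is the irreducibility of affine space over an infinite field.\<close>

lemma (in field) poly_funs_open_dense:
  assumes inf: "infinite (carrier R)" and p: "p \<in> poly_funs R S"
    and a: "a \<in> S \<rightarrow> carrier R" "p a \<noteq> \<zero>"
  defines "U \<equiv> {x \<in> S \<rightarrow>\<^sub>E carrier R. p x \<noteq> \<zero>}"
  shows "zariski_open R S U" "zariski_dense R S U"
proof -
  show "zariski_open R S U"
    unfolding zariski_open_def zariski_closed_def U_def using p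
    by (intro conjI exI[of _ "{p}"]) auto
  have "C = S \<rightarrow>\<^sub>E carrier R" if C: "zariski_closed R S C" "U \<subseteq> C" for C
  proof -
    obtain F where F: "F \<subseteq> poly_funs R S" "C = {x \<in> S \<rightarrow>\<^sub>E carrier R. \<forall>f\<in>F. f x = \<zero>}"
      using C(1) by (auto simp: zariski_closed_def)
    have "f b = \<zero>" if f: "f \<in> F" and b: "b \<in> S \<rightarrow>\<^sub>E carrier R" for f b
    proof (rule ccontr)
      assume "f b \<noteq> \<zero>"
      then obtain x where x: "x \<in> S \<rightarrow>\<^sub>E carrier R" "p x \<otimes> f x \<noteq> \<zero>"
        using poly_funs_nonzero_mult[OF inf p _ a, of f b] f F b by (auto simp: PiE_def)
      have xs: "x \<in> S \<rightarrow> carrier R" using x by (auto simp: PiE_def)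
      have fx: "f x \<in> carrier R" "p x \<in> carrier R"
        using poly_funs_closed[OF _ xs] f F p by auto
      then have "p x \<noteq> \<zero>" "f x \<noteq> \<zero>" using x(2) by auto
      then have "x \<in> U" using x(1) by (simp add: U_def)
      then show False using C(2) F(2) f \<open>f x \<noteq> \<zero>\<close> by auto
    qed
    then show ?thesis using F(2) by auto
  qed
  then show "zariski_dense R S U" unfolding zariski_dense_def U_def by auto
qed

context cring
begin

text \<open>Lists of terms may repeat exponents, so a sum is a concatenation and a product is formed
  term by term. Equal exponents are collected in \<open>poly_funs_coeffs\<close>.\<close>

lemma poly_funs_monomial_list:
  assumes "f \<in> poly_funs R S" "finite S"
  shows "\<exists>l. set l \<subseteq> carrier R \<times> UNIV \<and>
    (\<forall>x \<in> S \<rightarrow> carrier R. f x = foldr (\<lambda>(c, \<alpha>) r. c \<otimes> monomial R S \<alpha> x \<oplus> r) l \<zero>)"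
proof -
  define L where "L l x = foldr (\<lambda>(c, \<alpha>) r. c \<otimes> monomial R S \<alpha> x \<oplus> r) l \<zero>" for l x
  have L_Nil: "L [] x = \<zero>" for x by (simp add: L_def)
  have L_Cons: "L ((c, \<alpha>) # l) x = c \<otimes> monomial R S \<alpha> x \<oplus> L l x" for c \<alpha> l x by (simp add: L_def)
  have Lc: "L l x \<in> carrier R" if "set l \<subseteq> carrier R \<times> UNIV" "x \<in> S \<rightarrow> carrier R" for l x
    using that by (induction l) (auto simp: L_Nil L_Cons)
  have Lapp: "L (l @ l') x = L l x \<oplus> L l' x"
    if "set l \<subseteq> carrier R \<times> UNIV" "set l' \<subseteq> carrier R \<times> UNIV" "x \<in> S \<rightarrow> carrier R" for l l' x
    using that(1)
  proof (induction l)
    case Nil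
    then show ?case using Lc[OF that(2,3)] by (simp add: L_Nil)
  next
    case (Cons ca l)
    then show ?case using Lc[OF that(2,3)] Lc[of l x] that(3)
      by (cases ca) (auto simp: L_Cons a_assoc)
  qed
  have mon_add: "monomial R S \<alpha> x \<otimes> monomial R S \<beta> x = monomial R S (\<lambda>i. \<alpha> i + \<beta> i) x"
    if "x \<in> S \<rightarrow> carrier R" for \<alpha> \<beta> x
  proof -
    have "monomial R S \<alpha> x \<otimes> monomial R S \<beta> x = (\<Otimes>i\<in>S. x i [^] \<alpha> i \<otimes> x i [^] \<beta> i)"
      unfolding monomial_def using that by (intro finprod_multf[symmetric]) auto
    also have "\<dots> = monomial R S (\<lambda>i. \<alpha> i + \<beta> i) x"
      unfolding monomial_def using that by (intro finprod_cong') (auto simp: Pi_iff nat_pow_mult)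
    finally show ?thesis .
  qed
  have Lmon: "\<exists>l'. set l' \<subseteq> carrier R \<times> UNIV \<and>
      (\<forall>x \<in> S \<rightarrow> carrier R. L l' x = (c \<otimes> monomial R S \<alpha> x) \<otimes> L l x)"
    if "set l \<subseteq> carrier R \<times> UNIV" "c \<in> carrier R" for c \<alpha> l
    using that(1)
  proof (induction l)
    case Nil
    then show ?case using that(2) by (intro exI[of _ "[]"]) (auto simp: L_Nil)
  next
    case (Cons b l)
    obtain c' \<beta> where b: "b = (c', \<beta>)" "c' \<in> carrier R" using Cons.prems by (cases b) auto
    obtain l' where l': "set l' \<subseteq> carrier R \<times> UNIV"
      "\<forall>x \<in> S \<rightarrow> carrier R. L l' x = (c \<otimes> monomial R S \<alpha> x) \<otimes> L l x" using Cons by auto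
    have "L ((c \<otimes> c', \<lambda>i. \<alpha> i + \<beta> i) # l') x = (c \<otimes> monomial R S \<alpha> x) \<otimes> L (b # l) x"
      if x: "x \<in> S \<rightarrow> carrier R" for x
    proof -
      have lx: "L l x \<in> carrier R" using Lc Cons.prems x by auto
      have "(c \<otimes> monomial R S \<alpha> x) \<otimes> L (b # l) x
        = (c \<otimes> c') \<otimes> (monomial R S \<alpha> x \<otimes> monomial R S \<beta> x) \<oplus> (c \<otimes> monomial R S \<alpha> x) \<otimes> L l x"
        unfolding b(1) L_Cons using that(1) lx b(2) \<open>c \<in> carrier R\<close>
          monomial_closed[OF x, of \<alpha>] monomial_closed[OF x, of \<beta>] by algebra
      then show ?thesis unfolding L_Cons mon_add[OF x] using l'(2) x by simp
    qed
    then show ?case using l'(1) b that(2)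
      by (intro exI[of _ "(c \<otimes> c', \<lambda>i. \<alpha> i + \<beta> i) # l'"]) auto
  qed
  have Lmult: "\<exists>l''. set l'' \<subseteq> carrier R \<times> UNIV \<and> (\<forall>x \<in> S \<rightarrow> carrier R. L l'' x = L l x \<otimes> L l' x)"
    if "set l \<subseteq> carrier R \<times> UNIV" and l': "set l' \<subseteq> carrier R \<times> UNIV" for l l'
    using that(1)
  proof (induction l)
    case Nil
    then show ?case using Lc[OF l'] by (intro exI[of _ "[]"]) (auto simp: L_Nil)
  next
    case (Cons b l)
    obtain c \<alpha> where b: "b = (c, \<alpha>)" "c \<in> carrier R" using Cons.prems by (cases b) auto
    obtain k where k: "set k \<subseteq> carrier R \<times> UNIV"
      "\<forall>x \<in> S \<rightarrow> carrier R. L k x = L l x \<otimes> L l' x" using Cons by auto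
    obtain k' where k': "set k' \<subseteq> carrier R \<times> UNIV"
      "\<forall>x \<in> S \<rightarrow> carrier R. L k' x = (c \<otimes> monomial R S \<alpha> x) \<otimes> L l' x" using Lmon[OF l' b(2), of \<alpha>] by blast
    have "L (k' @ k) x = L (b # l) x \<otimes> L l' x" if x: "x \<in> S \<rightarrow> carrier R" for x
      using Lapp[OF k'(1) k(1) x] k k' x b Lc[OF l' x] Lc[of l x] Cons.prems
      by (auto simp: L_Cons l_distr)
    then show ?case using k k' by (intro exI[of _ "k' @ k"]) auto
  qed
  have mon0: "monomial R S (\<lambda>_. 0) x = \<one>" for x
    unfolding monomial_def by simp
  have mon1: "monomial R S (\<lambda>j. if j = i then 1 else 0) x = x i" if "i \<in> S" "x \<in> S \<rightarrow> carrier R" for i x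
  proof -
    have "monomial R S (\<lambda>j. if j = i then 1 else 0) x = (\<Otimes>j\<in>S. if i = j then x j else \<one>)"
      unfolding monomial_def using that by (intro finprod_cong') (auto simp: Pi_iff)
    also have "\<dots> = x i" using that assms(2) by (intro finprod_singleton) auto
    finally show ?thesis .
  qed
  show ?thesis unfolding L_def[symmetric] using assms(1)
  proof induction
    case (const c)
    then show ?case by (intro exI[of _ "[(c, \<lambda>_. 0)]"]) (auto simp: L_Cons L_Nil mon0)
  next
    case (var i)
    then show ?case
      by (intro exI[of _ "[(\<one>, \<lambda>j. if j = i then 1 else 0)]"]) (auto simp: L_Cons L_Nil mon1 Pi_iff)
  next
    case (add f g)
    then obtain l l' where "set l \<subseteq> carrier R \<times> UNIV" "\<forall>x\<in>S \<rightarrow> carrier R. f x = L l x"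
      "set l' \<subseteq> carrier R \<times> UNIV" "\<forall>x\<in>S \<rightarrow> carrier R. g x = L l' x" by auto
    then show ?case by (intro exI[of _ "l @ l'"]) (auto simp: Lapp)
  next
    case (mult f g)
    then obtain l l' where "set l \<subseteq> carrier R \<times> UNIV" "\<forall>x\<in>S \<rightarrow> carrier R. f x = L l x"
      "set l' \<subseteq> carrier R \<times> UNIV" "\<forall>x\<in>S \<rightarrow> carrier R. g x = L l' x" by auto
    then show ?case using Lmult[of l l'] by auto
  qed
qed

text \<open>Terms with equal exponents are merged. The exponents are extensional on
  \<open>S\<close>, so that distinct indices in \<open>J\<close> differ on \<open>S\<close>, as the
  comparison of coefficients requires.\<close>

lemma poly_funs_coeffs:
  assumes "f \<in> poly_funs R S" "finite S"
  shows "\<exists>J C. finite J \<and> J \<subseteq> S \<rightarrow>\<^sub>E UNIV \<and> C \<in> J \<rightarrow> carrier R \<and>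
    (\<forall>x \<in> S \<rightarrow> carrier R. f x = (\<Oplus>\<alpha>\<in>J. C \<alpha> \<otimes> monomial R S \<alpha> x))"
proof -
  have rep: "\<exists>J C. finite J \<and> J \<subseteq> S \<rightarrow>\<^sub>E UNIV \<and> C \<in> J \<rightarrow> carrier R \<and>
    (\<forall>x \<in> S \<rightarrow> carrier R. foldr (\<lambda>(c, \<alpha>) r. c \<otimes> monomial R S \<alpha> x \<oplus> r) l \<zero>
      = (\<Oplus>\<alpha>\<in>J. C \<alpha> \<otimes> monomial R S \<alpha> x))" if "set l \<subseteq> carrier R \<times> UNIV" for l
    using that
  proof (induction l)
    case Nil
    then show ?case by (intro exI[of _ "{}"]) auto
  next
    case (Cons b l)
    obtain c \<alpha>' where b: "b = (c, \<alpha>')" "c \<in> carrier R" using Cons.prems by (cases b) auto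
    define \<alpha> where "\<alpha> = restrict \<alpha>' S"
    have mon: "monomial R S \<alpha>' x = monomial R S \<alpha> x" if "x \<in> S \<rightarrow> carrier R" for x
      using that by (intro monomial_cong) (auto simp: \<alpha>_def)
    obtain J C where J: "finite J" "J \<subseteq> S \<rightarrow>\<^sub>E UNIV" "C \<in> J \<rightarrow> carrier R"
      and eq: "\<And>x. x \<in> S \<rightarrow> carrier R \<Longrightarrow> foldr (\<lambda>(c, \<alpha>) r. c \<otimes> monomial R S \<alpha> x \<oplus> r) l \<zero>
        = (\<Oplus>\<alpha>\<in>J. C \<alpha> \<otimes> monomial R S \<alpha> x)" using Cons by auto
    \<comment> \<open>Extension of \<open>C\<close> by zero treats a new exponent
      \<open>\<alpha>\<close> and one that is already present in the same way.\<close>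
    define C' where "C' \<beta> = (if \<beta> \<in> J then C \<beta> else \<zero>)" for \<beta>
    have C'c: "C' \<beta> \<in> carrier R" for \<beta> using J by (auto simp: C'_def)
    have "c \<otimes> monomial R S \<alpha>' x \<oplus> (\<Oplus>\<beta>\<in>J. C \<beta> \<otimes> monomial R S \<beta> x)
      = (\<Oplus>\<beta>\<in>insert \<alpha> J. (C'(\<alpha> := c \<oplus> C' \<alpha>)) \<beta> \<otimes> monomial R S \<beta> x)"
      if x: "x \<in> S \<rightarrow> carrier R" for x
    proof -
      let ?g = "\<lambda>\<beta>. C' \<beta> \<otimes> monomial R S \<beta> x"
      have g: "?g \<beta> \<in> carrier R" for \<beta> using C'c x by auto
      have 1: "(\<Oplus>\<beta>\<in>J. C \<beta> \<otimes> monomial R S \<beta> x) = (\<Oplus>\<beta>\<in>J. ?g \<beta>)"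
        using g by (intro finsum_cong') (auto simp: C'_def)
      have 2: "(\<Oplus>\<beta>\<in>J. ?g \<beta>) = ?g \<alpha> \<oplus> (\<Oplus>\<beta>\<in>J - {\<alpha>}. ?g \<beta>)"
      proof (cases "\<alpha> \<in> J")
        case True
        have "(\<Oplus>\<beta>\<in>insert \<alpha> (J - {\<alpha>}). ?g \<beta>) = ?g \<alpha> \<oplus> (\<Oplus>\<beta>\<in>J - {\<alpha>}. ?g \<beta>)"
          using g J(1) by (intro finsum_insert) auto
        then show ?thesis using True by (simp add: insert_absorb)
      next
        case False
        then have "?g \<alpha> = \<zero>" using x by (auto simp: C'_def)
        then show ?thesis using False g by (simp add: finsum_closed)
      qed
      have "(\<Oplus>\<beta>\<in>insert \<alpha> (J - {\<alpha>}). (C'(\<alpha> := c \<oplus> C' \<alpha>)) \<beta> \<otimes> monomial R S \<beta> x)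
        = (c \<oplus> C' \<alpha>) \<otimes> monomial R S \<alpha> x \<oplus> (\<Oplus>\<beta>\<in>J - {\<alpha>}. (C'(\<alpha> := c \<oplus> C' \<alpha>)) \<beta> \<otimes> monomial R S \<beta> x)"
        using J(1) C'c b x by (subst finsum_insert) auto
      also have "(\<Oplus>\<beta>\<in>J - {\<alpha>}. (C'(\<alpha> := c \<oplus> C' \<alpha>)) \<beta> \<otimes> monomial R S \<beta> x) = (\<Oplus>\<beta>\<in>J - {\<alpha>}. ?g \<beta>)"
        using g by (intro finsum_cong') auto
      finally have 3: "(\<Oplus>\<beta>\<in>insert \<alpha> J. (C'(\<alpha> := c \<oplus> C' \<alpha>)) \<beta> \<otimes> monomial R S \<beta> x)
        = (c \<oplus> C' \<alpha>) \<otimes> monomial R S \<alpha> x \<oplus> (\<Oplus>\<beta>\<in>J - {\<alpha>}. ?g \<beta>)" by simp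
      have "(\<Oplus>\<beta>\<in>J - {\<alpha>}. ?g \<beta>) \<in> carrier R" using g by (intro finsum_closed) auto
      then show ?thesis unfolding 1 2 3 mon[OF x] using b(2) C'c[of \<alpha>] monomial_closed[OF x, of \<alpha>]
        by (simp add: l_distr a_assoc)
    qed
    then show ?case using J b eq C'c
      by (intro exI[of _ "insert \<alpha> J"] exI[of _ "C'(\<alpha> := c \<oplus> C' \<alpha>)"]) (auto simp: \<alpha>_def)
  qed
  obtain l where l: "set l \<subseteq> carrier R \<times> UNIV"
    "\<And>x. x \<in> S \<rightarrow> carrier R \<Longrightarrow> f x = foldr (\<lambda>(c, \<alpha>) r. c \<otimes> monomial R S \<alpha> x \<oplus> r) l \<zero>"
    using poly_funs_monomial_list[OF assms] by auto
  obtain J C where "finite J" "J \<subseteq> S \<rightarrow>\<^sub>E UNIV" "C \<in> J \<rightarrow> carrier R"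
    "\<And>x. x \<in> S \<rightarrow> carrier R \<Longrightarrow> foldr (\<lambda>(c, \<alpha>) r. c \<otimes> monomial R S \<alpha> x \<oplus> r) l \<zero>
      = (\<Oplus>\<alpha>\<in>J. C \<alpha> \<otimes> monomial R S \<alpha> x)"
    using rep[OF l(1)] by blast
  then show ?thesis using l(2) by (intro exI[of _ J] exI[of _ C]) auto
qed

end

section \<open>Polynomial functions modulo the maximal ideal\<close>

locale infinite_residue_local_cring = noetherian_local_cring +
  assumes inf_res: "infinite (carrier (R Quot m))"
begin

lemma residue_field: "field (R Quot m)"
  using maximalideal.quotient_is_field[OF m_max is_cring] .

lemma residue_cring: "cring (R Quot m)"
  using ideal.quotient_is_cring[OF m_ideal is_cring] .

lemma residue_hom: "ring_hom_cring R (R Quot m) (\<lambda>a. m +> a)"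
  using ideal.rcos_ring_hom_cring[OF m_ideal is_cring] .

lemma residue_simps [simp]:
  "a \<in> carrier R \<Longrightarrow> m +> a \<in> carrier (R Quot m)"
  "a \<in> carrier R \<Longrightarrow> b \<in> carrier R \<Longrightarrow> m +> (a \<oplus> b) = (m +> a) \<oplus>\<^bsub>R Quot m\<^esub> (m +> b)"
  "a \<in> carrier R \<Longrightarrow> b \<in> carrier R \<Longrightarrow> m +> (a \<otimes> b) = (m +> a) \<otimes>\<^bsub>R Quot m\<^esub> (m +> b)"
  "a \<in> carrier R \<Longrightarrow> m +> (a [^] (n::nat)) = (m +> a) [^]\<^bsub>R Quot m\<^esub> n"
proof -
  note h = ideal.rcos_ring_hom[OF m_ideal]
  show "a \<in> carrier R \<Longrightarrow> m +> a \<in> carrier (R Quot m)"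
    "a \<in> carrier R \<Longrightarrow> b \<in> carrier R \<Longrightarrow> m +> (a \<oplus> b) = (m +> a) \<oplus>\<^bsub>R Quot m\<^esub> (m +> b)"
    "a \<in> carrier R \<Longrightarrow> b \<in> carrier R \<Longrightarrow> m +> (a \<otimes> b) = (m +> a) \<otimes>\<^bsub>R Quot m\<^esub> (m +> b)"
    by (rule ring_hom_closed[OF h] ring_hom_add[OF h] ring_hom_mult[OF h]; assumption)+
  show "a \<in> carrier R \<Longrightarrow> m +> (a [^] (n::nat)) = (m +> a) [^]\<^bsub>R Quot m\<^esub> n"
    by (rule ring_hom_ring.hom_nat_pow[OF ideal.rcos_ring_hom_ring[OF m_ideal]])
qed

lemma residue_zero:
  assumes "a \<in> carrier R"
  shows "m +> a = \<zero>\<^bsub>R Quot m\<^esub> \<longleftrightarrow> a \<in> m"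
  using ideal.rcos_const_imp_mem[OF m_ideal assms] a_rcos_zero[OF m_ideal]
  by (auto simp: FactRing_def)

lemma residue_lift:
  assumes "y \<in> S \<rightarrow>\<^sub>E carrier (R Quot m)"
  shows "\<exists>x \<in> S \<rightarrow> carrier R. y = (\<lambda>s\<in>S. m +> x s)"
proof -
  have "\<forall>s\<in>S. \<exists>a\<in>carrier R. y s = m +> a"
    using assms by (auto simp: FactRing_simps PiE_def Pi_iff)
  then obtain x where "\<forall>s\<in>S. x s \<in> carrier R \<and> y s = m +> x s" by metis
  then show ?thesis using assms by (intro bexI[of _ x]) (auto simp: PiE_def extensional_def fun_eq_iff)
qed

lemma residue_poly_funs:
  assumes "f \<in> poly_funs R S"
  shows "\<exists>g\<in>poly_funs (R Quot m) S. \<forall>x \<in> S \<rightarrow> carrier R. g (\<lambda>s\<in>S. m +> x s) = m +> f x"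
proof -
  define r where "r x = (\<lambda>s\<in>S. m +> x s)" for x
  have "\<exists>g\<in>poly_funs (R Quot m) S. \<forall>x \<in> S \<rightarrow> carrier R. g (r x) = m +> f x" using assms
  proof induction
    case (const c)
    then show ?case by (intro bexI[of _ "\<lambda>_. m +> c"] poly_funs.const) auto
  next
    case (var i)
    then show ?case by (intro bexI[of _ "\<lambda>x. x i"] poly_funs.var) (auto simp: r_def)
  next
    case (add f g)
    obtain f' g' where "f' \<in> poly_funs (R Quot m) S" "g' \<in> poly_funs (R Quot m) S"
      "\<forall>x \<in> S \<rightarrow> carrier R. f' (r x) = m +> f x" "\<forall>x \<in> S \<rightarrow> carrier R. g' (r x) = m +> g x"
      using add.IH by blast
    then show ?case using poly_funs_closed[OF add.hyps(1)] poly_funs_closed[OF add.hyps(2)]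
      by (intro bexI[of _ "\<lambda>x. f' x \<oplus>\<^bsub>R Quot m\<^esub> g' x"] poly_funs.add) auto
  next
    case (mult f g)
    obtain f' g' where "f' \<in> poly_funs (R Quot m) S" "g' \<in> poly_funs (R Quot m) S"
      "\<forall>x \<in> S \<rightarrow> carrier R. f' (r x) = m +> f x" "\<forall>x \<in> S \<rightarrow> carrier R. g' (r x) = m +> g x"
      using mult.IH by blast
    then show ?case using poly_funs_closed[OF mult.hyps(1)] poly_funs_closed[OF mult.hyps(2)]
      by (intro bexI[of _ "\<lambda>x. f' x \<otimes>\<^bsub>R Quot m\<^esub> g' x"] poly_funs.mult) auto
  qed
  then show ?thesis unfolding r_def .
qed

text \<open>The bridge to the Zariski topology: if \<open>p\<close> takes a unit value at one
  parameter, then it does so at a general one.\<close>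

lemma generic_open:
  assumes p: "p \<in> poly_funs R S" and a: "a \<in> S \<rightarrow> carrier R" "p a \<notin> m"
  shows "\<exists>U. zariski_open (R Quot m) S U \<and> zariski_dense (R Quot m) S U \<and>
    (\<forall>L \<in> S \<rightarrow> carrier R. (\<lambda>s\<in>S. m +> L s) \<in> U \<longrightarrow> p L \<notin> m)"
proof -
  obtain q where q: "q \<in> poly_funs (R Quot m) S"
    "\<And>x. x \<in> S \<rightarrow> carrier R \<Longrightarrow> q (\<lambda>s\<in>S. m +> x s) = m +> p x"
    using residue_poly_funs[OF p] by blast
  have "(\<lambda>s\<in>S. m +> a s) \<in> S \<rightarrow> carrier (R Quot m)" using a(1) by (auto intro: residue_simps(1))
  moreover have "q (\<lambda>s\<in>S. m +> a s) \<noteq> \<zero>\<^bsub>R Quot m\<^esub>"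
    using q(2)[OF a(1)] a residue_zero[OF poly_funs_closed[OF p a(1)]] by auto
  ultimately have U: "zariski_open (R Quot m) S {x \<in> S \<rightarrow>\<^sub>E carrier (R Quot m). q x \<noteq> \<zero>\<^bsub>R Quot m\<^esub>}"
    "zariski_dense (R Quot m) S {x \<in> S \<rightarrow>\<^sub>E carrier (R Quot m). q x \<noteq> \<zero>\<^bsub>R Quot m\<^esub>}"
    using field.poly_funs_open_dense[OF residue_field inf_res q(1)] by blast+
  have "p L \<notin> m" if L: "L \<in> S \<rightarrow> carrier R" and "q (\<lambda>s\<in>S. m +> L s) \<noteq> \<zero>\<^bsub>R Quot m\<^esub>" for L
    using q(2)[OF L] that(2) residue_zero[OF poly_funs_closed[OF p L]] by auto
  then show ?thesis using U
    by (intro exI[of _ "{x \<in> S \<rightarrow>\<^sub>E carrier (R Quot m). q x \<noteq> \<zero>\<^bsub>R Quot m\<^esub>}"]) auto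
qed

text \<open>Joins conditions whose witnesses are different points; \<open>open_socle\<close>
  supplies a point of its own, which need not be the parameter of the given reduction.\<close>

lemma poly_funs_common_point:
  assumes f: "f \<in> poly_funs R S" and g: "g \<in> poly_funs R S"
    and a: "a \<in> S \<rightarrow> carrier R" "f a \<notin> m" and b: "b \<in> S \<rightarrow> carrier R" "g b \<notin> m"
  shows "\<exists>x \<in> S \<rightarrow> carrier R. f x \<otimes> g x \<notin> m"
proof -
  obtain f' where f': "f' \<in> poly_funs (R Quot m) S"
    "\<And>x. x \<in> S \<rightarrow> carrier R \<Longrightarrow> f' (\<lambda>s\<in>S. m +> x s) = m +> f x"
    using residue_poly_funs[OF f] by blast
  obtain g' where g': "g' \<in> poly_funs (R Quot m) S"
    "\<And>x. x \<in> S \<rightarrow> carrier R \<Longrightarrow> g' (\<lambda>s\<in>S. m +> x s) = m +> g x"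
    using residue_poly_funs[OF g] by blast
  have ac: "(\<lambda>s\<in>S. m +> a s) \<in> S \<rightarrow> carrier (R Quot m)" using a(1) by (auto intro: residue_simps(1))
  have bc: "(\<lambda>s\<in>S. m +> b s) \<in> S \<rightarrow> carrier (R Quot m)" using b(1) by (auto intro: residue_simps(1))
  have "f' (\<lambda>s\<in>S. m +> a s) \<noteq> \<zero>\<^bsub>R Quot m\<^esub>"
    using f'(2)[OF a(1)] a residue_zero[OF poly_funs_closed[OF f a(1)]] by auto
  note 1 = this
  have "g' (\<lambda>s\<in>S. m +> b s) \<noteq> \<zero>\<^bsub>R Quot m\<^esub>"
    using g'(2)[OF b(1)] b residue_zero[OF poly_funs_closed[OF g b(1)]] by auto
  from field.poly_funs_nonzero_mult[where f = f' and g = g' and a = "\<lambda>s\<in>S. m +> a s"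
      and b = "\<lambda>s\<in>S. m +> b s", OF residue_field inf_res f'(1) g'(1) ac 1 bc this]
  obtain y where y: "y \<in> S \<rightarrow>\<^sub>E carrier (R Quot m)"
    "f' y \<otimes>\<^bsub>R Quot m\<^esub> g' y \<noteq> \<zero>\<^bsub>R Quot m\<^esub>" by blast
  obtain x where x: "x \<in> S \<rightarrow> carrier R" "y = (\<lambda>s\<in>S. m +> x s)" using residue_lift[OF y(1)] by auto
  have c: "f x \<in> carrier R" "g x \<in> carrier R" using poly_funs_closed f g x by auto
  then have "m +> (f x \<otimes> g x) = f' y \<otimes>\<^bsub>R Quot m\<^esub> g' y"
    unfolding x(2) f'(2)[OF x(1)] g'(2)[OF x(1)] by simp
  then show ?thesis using y(2) residue_zero[of "f x \<otimes> g x"] c x by (intro bexI[of _ x]) auto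
qed

text \<open>After reduction modulo \<open>m\<close> the function vanishes identically over the
  infinite residue field, where \<open>polynomial_coeffs_zero\<close> applies.\<close>

lemma monomial_coeffs_in_m:
  assumes S: "finite S" and J: "finite J" "C \<in> J \<rightarrow> carrier R"
    and inj: "\<And>a b. a \<in> J \<Longrightarrow> b \<in> J \<Longrightarrow> (\<And>i. i \<in> S \<Longrightarrow> e a i = e b i) \<Longrightarrow> a = b"
    and van: "\<And>x. x \<in> S \<rightarrow> carrier R \<Longrightarrow> (\<Oplus>a\<in>J. C a \<otimes> monomial R S (e a) x) \<in> m"
    and a: "a \<in> J"
  shows "C a \<in> m"
proof -
  have "m +> C a = \<zero>\<^bsub>R Quot m\<^esub>"
  proof (rule field.polynomial_coeffs_zero[OF residue_field inf_res S J(1) _ _ _ a, of "\<lambda>a. m +> C a" e])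
    show "(\<lambda>a. m +> C a) \<in> J \<rightarrow> carrier (R Quot m)" using J(2) by (auto intro: residue_simps(1))
    show "b = c" if "b \<in> J" "c \<in> J" "\<And>i. i \<in> S \<Longrightarrow> e b i = e c i" for b c
      using inj that by blast
    fix y assume y: "y \<in> S \<rightarrow> carrier (R Quot m)"
    then have "restrict y S \<in> S \<rightarrow>\<^sub>E carrier (R Quot m)" by auto
    from residue_lift[OF this] obtain x where x: "x \<in> S \<rightarrow> carrier R"
      "\<And>s. s \<in> S \<Longrightarrow> y s = m +> x s" by (metis restrict_apply')
    have mon: "m +> monomial R S \<alpha> x = monomial (R Quot m) S \<alpha> y" for \<alpha>
    proof -
      have "m +> monomial R S \<alpha> x = (\<Otimes>\<^bsub>R Quot m\<^esub>i\<in>S. ((\<lambda>a. m +> a) \<circ> (\<lambda>i. x i [^] \<alpha> i)) i)"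
        unfolding monomial_def using x(1) by (intro ring_hom_cring.hom_finprod[OF residue_hom]) auto
      also have "\<dots> = monomial (R Quot m) S \<alpha> y"
        unfolding monomial_def using x y by (intro comm_monoid.finprod_cong'[OF cring.axioms(2)[OF residue_cring]]) (auto simp: Pi_iff simp flip: residue_simps(4))
      finally show ?thesis .
    qed
    have "m +> (\<Oplus>a\<in>J. C a \<otimes> monomial R S (e a) x)
      = (\<Oplus>\<^bsub>R Quot m\<^esub>a\<in>J. ((\<lambda>a. m +> a) \<circ> (\<lambda>a. C a \<otimes> monomial R S (e a) x)) a)"
      using J(2) x(1) by (intro ring_hom_cring.hom_finsum[OF residue_hom]) (auto simp: Pi_iff)
    also have "\<dots> = (\<Oplus>\<^bsub>R Quot m\<^esub>a\<in>J. (m +> C a) \<otimes>\<^bsub>R Quot m\<^esub> monomial (R Quot m) S (e a) y)"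
      using J(2) x(1) y by (intro abelian_monoid.finsum_cong'[OF abelian_group.axioms(1)[OF ring.axioms(1)[OF cring.axioms(1)[OF residue_cring]]]]) (auto simp: Pi_iff simp flip: mon residue_simps(3))
    finally have "(\<Oplus>\<^bsub>R Quot m\<^esub>a\<in>J. (m +> C a) \<otimes>\<^bsub>R Quot m\<^esub> monomial (R Quot m) S (e a) y)
      = m +> (\<Oplus>a\<in>J. C a \<otimes> monomial R S (e a) x)" by simp
    also have "\<dots> = \<zero>\<^bsub>R Quot m\<^esub>"
      using van[OF x(1)] residue_zero ideal_closed(7)[OF m_ideal] by auto
    finally show "(\<Oplus>\<^bsub>R Quot m\<^esub>a\<in>J. (m +> C a) \<otimes>\<^bsub>R Quot m\<^esub> monomial (R Quot m) S (e a) y)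
      = \<zero>\<^bsub>R Quot m\<^esub>" .
  qed
  then show ?thesis using residue_zero J(2) a by auto
qed

end

section \<open>Growth of lengths\<close>

context cring
begin

definition mulset :: "'a \<Rightarrow> 'a set \<Rightarrow> 'a set \<Rightarrow> 'a set" where
  "mulset z A D = {z \<otimes> a \<oplus> d | a d. a \<in> A \<and> d \<in> D}"

lemma mulset_ideal:
  assumes z: "z \<in> carrier R" and A: "ideal A R" and D: "ideal D R"
  shows "ideal (mulset z A D) R"
proof (rule cring_idealI)
  note A' = ideal_closed[OF A] and D' = ideal_closed[OF D]
  show "mulset z A D \<subseteq> carrier R" using z A'(7) D'(7) by (auto simp: mulset_def)
  show "\<zero> \<in> mulset z A D" unfolding mulset_def
    using z A'(1) D'(1) by (intro CollectI exI[of _ \<zero>]) auto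
next
  note A' = ideal_closed[OF A] and D' = ideal_closed[OF D]
  fix u v assume "u \<in> mulset z A D" "v \<in> mulset z A D"
  then obtain a d b e where uv: "u = z \<otimes> a \<oplus> d" "v = z \<otimes> b \<oplus> e" "a \<in> A" "b \<in> A" "d \<in> D" "e \<in> D"
    by (auto simp: mulset_def)
  have "u \<oplus> v = z \<otimes> (a \<oplus> b) \<oplus> (d \<oplus> e)"
    unfolding uv using z uv(3,4)[THEN A'(7)] uv(5,6)[THEN D'(7)] by algebra
  then show "u \<oplus> v \<in> mulset z A D" unfolding mulset_def using uv A'(2) D'(2) by blast
next
  note A' = ideal_closed[OF A] and D' = ideal_closed[OF D]
  fix u r assume "u \<in> mulset z A D" and r: "r \<in> carrier R"
  then obtain a d where u: "u = z \<otimes> a \<oplus> d" "a \<in> A" "d \<in> D" by (auto simp: mulset_def)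
  have "r \<otimes> u = z \<otimes> (r \<otimes> a) \<oplus> r \<otimes> d"
    unfolding u using z r A'(7)[OF u(2)] D'(7)[OF u(3)] by algebra
  then show "r \<otimes> u \<in> mulset z A D" unfolding mulset_def using u r A'(5) D'(5) by blast
qed

text \<open>Multiplication by \<open>z\<close> maps \<open>A/B\<close> onto
  \<open>(z A + D)/D\<close>, and the images of the cyclic steps are again cyclic and killed by
  \<open>P\<close>.\<close>

lemma cyc_filt_mult:
  assumes "cyc_filt R P A B s" and z: "z \<in> carrier R" and D: "ideal D R" and P: "P \<subseteq> carrier R"
    and "\<And>b. b \<in> B \<Longrightarrow> z \<otimes> b \<in> D"
  shows "cyc_filt R P (mulset z A D) D s"
  using assms(1,5)
proof induction
  case (trivial A)
  have "mulset z A D = D"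
  proof
    show "mulset z A D \<subseteq> D" using trivial ideal_closed[OF D] by (auto simp: mulset_def)
    show "D \<subseteq> mulset z A D"
    proof
      fix d assume d: "d \<in> D"
      then have "d = z \<otimes> \<zero> \<oplus> d" using z ideal_closed(7)[OF D] by auto
      then show "d \<in> mulset z A D" unfolding mulset_def using d ideal_closed(1)[OF trivial(1)] by blast
    qed
  qed
  then show ?case using cyc_filt.trivial[OF D] by simp
next
  case (step A g B C s)
  note A' = ideal_closed[OF step(1)] and D' = ideal_closed[OF D]
  have iB: "ideal B R" using step cyc_filt_ideal by auto
  note B' = ideal_closed[OF iB]
  have g: "g \<in> carrier R" using step A' by auto
  show ?case
  proof (rule cyc_filt.step[where g = "z \<otimes> g" and B = "mulset z B D"])
    show "ideal (mulset z A D) R" by (rule mulset_ideal[OF z step(1) D])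
    have "z \<otimes> g = z \<otimes> g \<oplus> \<zero>" using z g by simp
    then show "z \<otimes> g \<in> mulset z A D" unfolding mulset_def using step(2) D'(1) by blast
    show "mulset z B D \<subseteq> mulset z A D" using step(3) by (auto simp: mulset_def)
    show "cyc_filt R P (mulset z B D) D s" using step by auto
  next
    fix r assume "r \<in> mulset z A D"
    then obtain a d where r: "r = z \<otimes> a \<oplus> d" "a \<in> A" "d \<in> D" by (auto simp: mulset_def)
    obtain c b where a: "c \<in> carrier R" "b \<in> B" "a = c \<otimes> g \<oplus> b" using step(4)[OF r(2)] by auto
    have "r = c \<otimes> (z \<otimes> g) \<oplus> (z \<otimes> b \<oplus> d)"
      unfolding r(1) a(3) using z g a(1) B'(7)[OF a(2)] D'(7)[OF r(3)] by algebra
    moreover have "z \<otimes> b \<oplus> d \<in> mulset z B D" unfolding mulset_def using a r by blast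
    ultimately show "\<exists>a\<in>carrier R. \<exists>c\<in>mulset z B D. r = a \<otimes> (z \<otimes> g) \<oplus> c" using a(1) by blast
  next
    fix p assume p: "p \<in> P"
    have "p \<otimes> (z \<otimes> g) = z \<otimes> (p \<otimes> g) \<oplus> \<zero>" using z g p P by (auto simp: m_lcomm)
    then show "p \<otimes> (z \<otimes> g) \<in> mulset z B D"
      unfolding mulset_def using step(5)[OF p] D'(1) by blast
  qed
qed

text \<open>The quotient of \<open>(y^i, W)\<close> by \<open>(y^(i+1), W)\<close> is the image of
  \<open>R/(y, W)\<close> under multiplication by \<open>y^i\<close>, so each of the
  \<open>M\<close> layers takes \<open>s\<close> steps.\<close>

lemma cyc_filt_power:
  assumes filt: "cyc_filt R P (carrier R) (Idl (insert y W)) s"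
    and y: "y \<in> carrier R" and W: "W \<subseteq> carrier R" and P: "P \<subseteq> carrier R"
  shows "cyc_filt R P (carrier R) (Idl (insert (y [^] M) W)) (M * s)"
proof (induction M)
  case 0
  have "insert \<one> W \<subseteq> carrier R" using W by auto
  note D = genideal_ideal[OF this] genideal_self[OF this]
  have "Idl (insert \<one> W) = carrier R" using ideal.one_imp_carrier[OF D(1)] D(2) by auto
  then show ?case using cyc_filt.trivial[OF oneideal] by simp
next
  case (Suc M)
  let ?D = "Idl (insert (y [^] Suc M) W)" and ?E = "Idl (insert (y [^] M) W)"
  have sub: "insert (y [^] Suc M) W \<subseteq> carrier R" "insert (y [^] M) W \<subseteq> carrier R" using y W by auto
  note D = genideal_ideal[OF sub(1)] genideal_self[OF sub(1)]
  note E = genideal_ideal[OF sub(2)] genideal_self[OF sub(2)]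
  note W' = genideal_ideal[OF W]
  have yM: "y [^] M \<in> carrier R" using y by simp
  have WD: "Idl W \<subseteq> ?D" using D by (intro Idl_least) auto
  have "cyc_filt R P (mulset (y [^] M) (carrier R) ?D) ?D s"
  proof (rule cyc_filt_mult[OF filt yM D(1) P])
    fix b assume "b \<in> Idl (insert y W)"
    then obtain a c where b: "a \<in> carrier R" "c \<in> Idl W" "b = a \<otimes> y \<oplus> c" using Idl_insert[OF y W, of b] by blast
    have "y [^] M \<otimes> b = a \<otimes> y [^] Suc M \<oplus> y [^] M \<otimes> c"
      unfolding b(3) nat_pow_Suc using b(1) y yM ideal_closed(7)[OF W' b(2)] by algebra
    moreover have "y [^] Suc M \<in> ?D" using D by auto
    ultimately show "y [^] M \<otimes> b \<in> ?D"
      using b WD yM ideal_closed(2,5)[OF D(1)] by auto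
  qed
  moreover have "mulset (y [^] M) (carrier R) ?D = ?E"
  proof
    have "y [^] M \<in> ?E" using E by auto
    moreover have "y [^] Suc M \<in> ?E"
      unfolding nat_pow_Suc using ideal_closed(6)[OF E(1) calculation y] .
    then have "?D \<subseteq> ?E" using E by (intro Idl_least[OF E(1)]) auto
    ultimately show "mulset (y [^] M) (carrier R) ?D \<subseteq> ?E"
      using ideal_closed[OF E(1)] by (auto simp: mulset_def)
    show "?E \<subseteq> mulset (y [^] M) (carrier R) ?D"
    proof (intro Idl_least[OF mulset_ideal[OF yM oneideal D(1)]] subsetI)
      fix w assume "w \<in> insert (y [^] M) W"
      then consider "w = y [^] M" | "w \<in> W" by auto
      then show "w \<in> mulset (y [^] M) (carrier R) ?D"
      proof cases
        case 1
        then have "w = y [^] M \<otimes> \<one> \<oplus> \<zero>" using yM by simp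
        then show ?thesis unfolding mulset_def using ideal_closed(1)[OF D(1)] by blast
      next
        case 2
        then have "w = y [^] M \<otimes> \<zero> \<oplus> w" using yM W by auto
        moreover have "w \<in> ?D" using 2 D by auto
        ultimately show ?thesis unfolding mulset_def by blast
      qed
    qed
  qed
  ultimately show ?case using cyc_filt_trans[OF Suc.IH] by (simp add: add.commute)
qed

text \<open>One element after the other is raised to the power \<open>M\<close>, while
  \<open>W\<close> collects those already treated. The bound is polynomial in \<open>M\<close>, of
  degree \<open>length ys\<close>.\<close>

lemma cyc_filt_powers_list:
  assumes "cyc_filt R P (carrier R) (Idl (set ys \<union> W)) s"
    and "set ys \<subseteq> carrier R" "W \<subseteq> carrier R" "P \<subseteq> carrier R"
  shows "cyc_filt R P (carrier R) (Idl ((\<lambda>y. y [^] (M::nat)) ` set ys \<union> W)) (M ^ length ys * s)"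
  using assms
proof (induction ys arbitrary: W s)
  case (Cons y ys)
  have "cyc_filt R P (carrier R) (Idl (insert (y [^] M) (set ys \<union> W))) (M * s)"
    using Cons.prems by (intro cyc_filt_power) auto
  then have "cyc_filt R P (carrier R) (Idl (set ys \<union> insert (y [^] M) W)) (M * s)" by simp
  from Cons.IH[OF this] Cons.prems show ?case by (simp add: mult.assoc mult.left_commute)
qed simp

end

section \<open>Counting monomials by degree\<close>

definition exponents :: "nat \<Rightarrow> nat \<Rightarrow> (nat \<Rightarrow> nat) set" where
  "exponents n r = {\<alpha> \<in> {..<n} \<rightarrow>\<^sub>E UNIV. (\<Sum>i<n. \<alpha> i) = r}"

lemma finite_exponents: "finite (exponents n r)"
proof (rule finite_subset)
  show "exponents n r \<subseteq> {..<n} \<rightarrow>\<^sub>E {..r}"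
  proof
    fix \<alpha> assume a: "\<alpha> \<in> exponents n r"
    have "\<alpha> i \<le> r" if "i < n" for i
      using member_le_sum[of i "{..<n}" \<alpha>] that a by (auto simp: exponents_def)
    then show "\<alpha> \<in> {..<n} \<rightarrow>\<^sub>E {..r}" using a by (auto simp: exponents_def PiE_iff)
  qed
qed (simp add: finite_PiE)

text \<open>The cube of exponent vectors with all entries below \<open>M\<close> lies in degrees
  below \<open>n * M\<close>. This is the lower bound of order \<open>n\<close> that is played
  against the upper bound of order \<open>length ys\<close>.\<close>

lemma exponents_count: "M ^ n \<le> (\<Sum>r<n * M. card (exponents n r))" if "0 < n"
proof (cases "M = 0")
  case False
  have "({..<n} \<rightarrow>\<^sub>E {..<M}) \<subseteq> (\<Union>r\<in>{..<n * M}. exponents n r)"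
  proof
    fix \<alpha> assume a: "\<alpha> \<in> {..<n} \<rightarrow>\<^sub>E {..<M}"
    have "(\<Sum>i<n. \<alpha> i) < (\<Sum>i<n. M)"
      using a that by (intro sum_strict_mono) (auto simp: PiE_iff lessThan_empty_iff)
    then show "\<alpha> \<in> (\<Union>r\<in>{..<n * M}. exponents n r)" using a by (auto simp: exponents_def PiE_iff)
  qed
  then have "card ({..<n} \<rightarrow>\<^sub>E {..<M}) \<le> card (\<Union>r\<in>{..<n * M}. exponents n r)"
    by (intro card_mono) (auto simp: finite_exponents)
  also have "\<dots> \<le> (\<Sum>r<n * M. card (exponents n r))" by (rule card_UN_le) auto
  finally show ?thesis by (simp add: card_PiE)
qed (use that in simp)

lemma (in cring) monomial_in_ideal_pow:
  assumes J: "ideal J R" and "finite S" "x \<in> S \<rightarrow> J"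
  shows "monomial R S \<alpha> x \<in> ideal_pow R J (\<Sum>i\<in>S. \<alpha> i)"
  using assms(2,3)
proof (induction S rule: finite_induct)
  case empty
  then show ?case by (simp add: monomial_def)
next
  case (insert s S)
  have "x \<in> insert s S \<rightarrow> carrier R" using insert.prems ideal_closed(7)[OF J] by auto
  then have "monomial R (insert s S) \<alpha> x = x s [^] \<alpha> s \<otimes> monomial R S \<alpha> x"
    using insert.hyps by (intro monomial_insert) auto
  moreover have "x s [^] \<alpha> s \<in> ideal_pow R J (\<alpha> s)" using insert.prems by (intro pow_mem_ideal_pow J) auto
  moreover have "monomial R S \<alpha> x \<in> ideal_pow R J (\<Sum>i\<in>S. \<alpha> i)" using insert by auto
  ultimately show ?case
    using insert.hyps by (simp add: ideal_pow_add[OF J] ideal_prod.prod)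
qed

context noetherian_local_cring
begin

text \<open>Counting lengths modulo powers of \<open>J\<close>: the parameters \<open>ys\<close> bound them by a polynomial of
  degree \<open>length ys\<close>, whereas \<open>n\<close> generators of \<open>J\<close> without such a relation would force growth
  of degree \<open>n\<close>.\<close>

lemma exists_form_relation:
  assumes x: "x \<in> {..<n} \<rightarrow> carrier R" and J: "J = Idl (x ` {..<n})" and Jm: "J \<subseteq> m"
    and ys: "set ys \<subseteq> m" "ideal_pow R m N0 \<subseteq> Idl (set ys)"
    and c: "\<And>y. y \<in> set ys \<Longrightarrow> y [^] (c::nat) \<in> J" and n: "length ys < n"
  shows "\<exists>r C. C \<in> exponents n r \<rightarrow> carrier R \<and>
    (\<Oplus>\<alpha>\<in>exponents n r. C \<alpha> \<otimes> monomial R {..<n} \<alpha> x) \<in> m \<cdot> ideal_pow R J r \<and>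
    (\<exists>\<alpha>\<in>exponents n r. C \<alpha> \<notin> m)"
proof (rule ccontr)
  assume neg: "\<not> ?thesis"
  \<comment> \<open>The negated claim says that in every degree \<open>r\<close> the monomials are
    linearly independent over the residue field modulo \<open>m J^r\<close>.\<close>
  have indep: "C \<alpha> \<in> m" if "C \<in> exponents n r \<rightarrow> carrier R" "\<alpha> \<in> exponents n r"
    "(\<Oplus>\<alpha>\<in>exponents n r. C \<alpha> \<otimes> monomial R {..<n} \<alpha> x) \<in> m \<cdot> ideal_pow R J r" for r C \<alpha>
    using neg that by blast
  have xJ: "x \<in> {..<n} \<rightarrow> J" and iJ: "ideal J R"
    using genideal_self[of "x ` {..<n}"] genideal_ideal[of "x ` {..<n}"] x unfolding J by auto
  define mon where "mon \<alpha> = monomial R {..<n} \<alpha> x" for \<alpha>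
  have monc: "mon \<alpha> \<in> carrier R" for \<alpha> unfolding mon_def using x by (rule monomial_closed)
  have monJ: "mon \<alpha> \<in> ideal_pow R J r" if "\<alpha> \<in> exponents n r" for \<alpha> r
    using monomial_in_ideal_pow[OF iJ _ xJ, of \<alpha>] that by (auto simp: mon_def exponents_def)
  note iJr = ideal_pow_ideal[OF iJ]
  have imJ: "ideal (m \<cdot> ideal_pow R J r) R" for r by (intro ideal_prod_is_ideal m_ideal iJr)
  have yc: "set ys \<subseteq> carrier R" using ys ideal_closed(8)[OF m_ideal] by auto
  obtain s0 where s0: "cyc_filt R m (carrier R) (Idl (set ys)) s0"
    using cyc_filt_powers[OF m_ideal genideal_ideal[OF yc] ys(2)] by auto
  define d where "d = length ys"
  \<comment> \<open>Chosen so that \<open>(c N)^d s0 = (c n)^d s0 M'^d < M'^(d+1)\<close>, which is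
    at most \<open>M'^n\<close> because \<open>d < n\<close>. The left side bounds the length from
    above, and the monomials of degree below \<open>N = n M'\<close> number at least
    \<open>M'^n\<close>.\<close>
  define M' where "M' = (c * n) ^ d * s0 + 1"
  define N where "N = n * M'"
  \<comment> \<open>As \<open>y^c\<close> lies in \<open>J\<close>, the exponent \<open>c N\<close>
    places \<open>B\<close> inside \<open>J^N\<close>, below all the ideals compared in the
    count.\<close>
  define B where "B = Idl ((\<lambda>y. y [^] (c * N)) ` set ys)"
  have "cyc_filt R m (carrier R) (Idl (set ys \<union> {})) s0" using s0 by simp
  from cyc_filt_powers_list[OF this yc _ ideal_closed(8)[OF m_ideal], of "c * N"]
  have filt: "cyc_filt R m (carrier R) B ((c * N) ^ d * s0)" by (simp add: B_def d_def)
  have "B \<subseteq> ideal_pow R J N"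
    unfolding B_def
  proof (intro Idl_least iJr subsetI)
    fix z assume "z \<in> (\<lambda>y. y [^] (c * N)) ` set ys"
    then obtain y where y: "y \<in> set ys" "z = (y [^] c) [^] N"
      using yc by (auto simp: nat_pow_pow)
    then show "z \<in> ideal_pow R J N" using pow_mem_ideal_pow[OF iJ c] by auto
  qed
  then have BJ: "B \<subseteq> ideal_pow R J r" if "r \<le> N" for r
    using ideal_pow_decreasing[OF iJ that] by auto
  obtain f :: "'a set \<Rightarrow> nat" where f1: "\<And>a. f a \<le> (c * N) ^ d * s0"
    and f2: "\<And>a a'. ideal a R \<and> ideal a' R \<and> prime_sat R m a' \<subseteq> a' \<and> B \<subseteq> a' \<and> a' \<subseteq> a
      \<longrightarrow> f a' \<le> f a \<and> (f a' = f a \<longrightarrow> a \<inter> carrier R \<subseteq> a')"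
    using cyc_filt_length[OF m_prime filt] by blast
  have fmono: "f a' \<le> f a" if "ideal a R" "ideal a' R" "B \<subseteq> a'" "a' \<subseteq> a" for a a'
    using f2[of a a'] that m_sat by auto
  have fstrict: "f a' < f a" if "ideal a R" "ideal a' R" "B \<subseteq> a'" "a' \<subseteq> a" "z \<in> a" "z \<notin> a'" for a a' z
    using f2[of a a'] that m_sat[of a'] ideal_closed(7)[OF that(1,5)] by (auto simp: nat_less_le)
  \<comment> \<open>\<open>m J^r\<close> contains \<open>J^(r+1)\<close>, and adjoining the
    monomials of degree \<open>r\<close> to it one at a time gives a strictly increasing chain
    inside \<open>J^r\<close>. So \<open>f\<close> increases by at least the number of
    monomials.\<close>
  have step: "f (ideal_pow R J (Suc r)) + card (exponents n r) \<le> f (ideal_pow R J r)" if r: "r < N" for r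
  proof -
    define V where "V E = m \<cdot> ideal_pow R J r <+>\<^bsub>R\<^esub> Idl (mon ` E)" for E
    have iI: "ideal (Idl (mon ` E)) R" for E using monc by (intro genideal_ideal) auto
    have iV: "ideal (V E) R" for E unfolding V_def by (intro add_ideals imJ iI)
    note Vi = set_add_incl[OF imJ[of r] iI, folded V_def]
    have "ideal_pow R J (Suc r) = J \<cdot> ideal_pow R J r"
      unfolding ideal_pow_Suc by (rule ideal_prod_commute[OF iJr iJ])
    then have JmJ: "ideal_pow R J (Suc r) \<subseteq> m \<cdot> ideal_pow R J r"
      using ideal_prod_mono[OF Jm subset_refl] by auto
    then have Bm: "B \<subseteq> m \<cdot> ideal_pow R J r" using BJ[of "Suc r"] r by auto
    have VB: "B \<subseteq> V E" for E using Bm Vi(1) by blast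
    have "f (m \<cdot> ideal_pow R J r) + card E \<le> f (V E)" if "finite E" "E \<subseteq> exponents n r" for E
      using that
    proof (induction E rule: finite_induct)
      case empty
      then show ?case using fmono[OF iV imJ Bm Vi(1)] by auto
    next
      case (insert \<beta> E)
      have "mon ` insert \<beta> E \<subseteq> carrier R" using monc by auto
      note self = genideal_self[OF this]
      have "Idl (mon ` E) \<subseteq> Idl (mon ` insert \<beta> E)" using self by (intro Idl_least iI) auto
      then have sub: "V E \<subseteq> V (insert \<beta> E)"
        using Vi(1)[of "insert \<beta> E"] Vi(2)[of "insert \<beta> E"]
        unfolding V_def[of E] by (intro set_add_least iV) auto
      have "mon \<beta> \<in> V (insert \<beta> E)" using self Vi(2)[of "insert \<beta> E"] by auto
      moreover have "mon \<beta> \<notin> V E"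
      proof
        assume "mon \<beta> \<in> V E"
        then obtain u v where u: "u \<in> m \<cdot> ideal_pow R J r" "v \<in> Idl (mon ` E)" "mon \<beta> = u \<oplus> v"
          unfolding V_def set_add_iff by auto
        obtain C where C: "C \<in> E \<rightarrow> carrier R" "v = (\<Oplus>\<alpha>\<in>E. C \<alpha> \<otimes> mon \<alpha>)"
          using u(2) Idl_image[OF insert.hyps(1), of mon] monc by auto
        \<comment> \<open>Membership of \<open>mon \<beta>\<close> in \<open>V E\<close>, read as a
          relation with coefficient 1 at \<open>\<beta>\<close>; independence would put 1 into
          \<open>m\<close>.\<close>
        define C' where "C' \<alpha> = (if \<alpha> = \<beta> then \<one> else if \<alpha> \<in> E then \<ominus> C \<alpha> else \<zero>)" for \<alpha>
        have C': "C' \<alpha> \<in> carrier R" for \<alpha> using C by (auto simp: C'_def)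
        have uc: "u \<in> carrier R" "v \<in> carrier R"
          using u ideal_closed(7)[OF imJ] ideal_closed(7)[OF iI] by auto
        have "(\<Oplus>\<alpha>\<in>exponents n r. C' \<alpha> \<otimes> mon \<alpha>) = (\<Oplus>\<alpha>\<in>insert \<beta> E. C' \<alpha> \<otimes> mon \<alpha>)"
          using insert.prems finite_exponents[of n r] monc C'
          by (intro add.finprod_mono_neutral_cong_right) (auto simp: C'_def)
        also have "\<dots> = mon \<beta> \<oplus> (\<Oplus>\<alpha>\<in>E. C' \<alpha> \<otimes> mon \<alpha>)"
          using insert.hyps C' monc by (subst finsum_insert) (auto simp: C'_def)
        also have "(\<Oplus>\<alpha>\<in>E. C' \<alpha> \<otimes> mon \<alpha>) = (\<Oplus>\<alpha>\<in>E. \<ominus> \<one> \<otimes> (C \<alpha> \<otimes> mon \<alpha>))"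
          using insert.hyps C monc by (intro finsum_cong') (auto simp: C'_def l_minus Pi_iff)
        also have "\<dots> = \<ominus> \<one> \<otimes> v" unfolding C(2)
          using insert.hyps C monc by (intro finsum_rdistr[symmetric]) (auto simp: Pi_iff)
        also have "mon \<beta> \<oplus> \<ominus> \<one> \<otimes> v = u" unfolding u(3) using uc by algebra
        finally have "(\<Oplus>\<alpha>\<in>exponents n r. C' \<alpha> \<otimes> mon \<alpha>) \<in> m \<cdot> ideal_pow R J r" using u by simp
        then have "C' \<beta> \<in> m" using insert.prems C' unfolding mon_def by (intro indep[of C' r \<beta>]) auto
        then show False using one_notin_m by (simp add: C'_def)
      qed
      ultimately have "f (V E) < f (V (insert \<beta> E))" using fstrict[OF iV iV VB sub] by blast
      then show ?case using insert by auto
    qed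
    from this[OF finite_exponents subset_refl]
    have "f (m \<cdot> ideal_pow R J r) + card (exponents n r) \<le> f (V (exponents n r))" .
    also have "V (exponents n r) \<subseteq> ideal_pow R J r"
      unfolding V_def using monJ ideal_prod_inter[OF m_ideal iJr[of r]]
      by (intro set_add_least iJr Idl_least) auto
    then have "f (V (exponents n r)) \<le> f (ideal_pow R J r)" by (intro fmono iJr iV VB)
    finally have "f (m \<cdot> ideal_pow R J r) + card (exponents n r) \<le> f (ideal_pow R J r)" .
    moreover have "f (ideal_pow R J (Suc r)) \<le> f (m \<cdot> ideal_pow R J r)"
      using r BJ[of "Suc r"] by (intro fmono imJ iJr JmJ) auto
    ultimately show ?thesis by linarith
  qed
  have "(\<Sum>r<k. card (exponents n r)) + f (ideal_pow R J k) \<le> f (ideal_pow R J 0)" if "k \<le> N" for k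
    using that
  proof (induction k)
    case (Suc k)
    then show ?case using step[of k] by simp
  qed simp
  from this[of N] f1[of "ideal_pow R J 0"]
  have "(\<Sum>r<N. card (exponents n r)) \<le> (c * N) ^ d * s0" by linarith
  moreover have "M' ^ n \<le> (\<Sum>r<N. card (exponents n r))"
    unfolding N_def using n by (intro exponents_count) auto
  ultimately have "M' ^ n \<le> (c * N) ^ d * s0" by linarith
  also have "\<dots> = (c * n) ^ d * s0 * M' ^ d" by (simp add: N_def power_mult_distrib)
  also have "\<dots> < M' * M' ^ d" unfolding M'_def by (intro mult_strict_right_mono) auto
  also have "\<dots> = M' ^ Suc d" by simp
  also have "\<dots> \<le> M' ^ n" using n by (intro power_increasing) (auto simp: d_def M'_def)
  finally show False by simp
qed

end

section \<open>Reductions\<close>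

text \<open>Telescoping: exchanging one factor \<open>p i\<close> for \<open>q i\<close> produces a
  difference in \<open>K\<close> times \<open>k - 1\<close> remaining factors in \<open>J\<close>.
  Hence the role of \<open>D k\<close> as \<open>K J^(k-1)\<close>; \<open>D 0\<close> is zero
  because monomials of degree 0 agree.\<close>

lemma (in cring) pow_diff_ideal:
  assumes K: "ideal K R" and J: "ideal J R" and KJ: "K \<subseteq> J"
  defines "D \<equiv> \<lambda>k. case k of 0 \<Rightarrow> {\<zero>} | Suc j \<Rightarrow> K \<cdot> ideal_pow R J j"
  shows "ideal (D k) R" and "D k \<subseteq> ideal_pow R J k"
    and "\<And>a b. a \<in> ideal_pow R J i \<Longrightarrow> b \<in> D k \<Longrightarrow> a \<otimes> b \<in> D (i + k)"
    and "u \<in> J \<Longrightarrow> v \<in> J \<Longrightarrow> u \<ominus> v \<in> K \<Longrightarrow> u [^] k \<ominus> v [^] k \<in> D k"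
    and "finite S \<Longrightarrow> p \<in> S \<rightarrow> J \<Longrightarrow> q \<in> S \<rightarrow> J \<Longrightarrow> (\<And>i. i \<in> S \<Longrightarrow> p i \<ominus> q i \<in> K) \<Longrightarrow>
      monomial R S \<alpha> p \<ominus> monomial R S \<alpha> q \<in> D (\<Sum>i\<in>S. \<alpha> i)"
proof -
  note iJ = ideal_pow_ideal[OF J]
  have D0: "D 0 = {\<zero>}" and DS: "D (Suc j) = K \<cdot> ideal_pow R J j" for j by (simp_all add: D_def)
  show iD: "ideal (D k) R" for k by (cases k) (auto simp: D0 DS zeroideal ideal_prod_is_ideal K iJ)
  show "D k \<subseteq> ideal_pow R J k" for k
  proof (cases k)
    case (Suc j)
    have "K \<cdot> ideal_pow R J j \<subseteq> J \<cdot> ideal_pow R J j" by (intro ideal_prod_mono KJ subset_refl)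
    also have "\<dots> = ideal_pow R J (Suc j)" unfolding ideal_pow_Suc by (rule ideal_prod_commute[OF J iJ])
    finally show ?thesis by (simp add: DS Suc)
  qed (simp add: D0 ideal_pow_0)
  show mult: "a \<otimes> b \<in> D (i + k)" if "a \<in> ideal_pow R J i" "b \<in> D k" for a b i k
  proof (cases k)
    case 0
    then show ?thesis using that ideal_closed(7)[OF iJ] ideal_closed(1)[OF iD] by (auto simp: D0)
  next
    case (Suc j)
    have "a \<otimes> b \<in> ideal_pow R J i \<cdot> (K \<cdot> ideal_pow R J j)" using that by (auto simp: DS Suc intro: ideal_prod.prod)
    also have "\<dots> = K \<cdot> (ideal_pow R J i \<cdot> ideal_pow R J j)"
      by (metis K iJ ideal_prod_assoc ideal_prod_commute)
    also have "\<dots> = D (i + k)" by (simp add: Suc DS ideal_pow_add[OF J])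
    finally show ?thesis .
  qed
  show pow: "u [^] k \<ominus> v [^] k \<in> D k" if uv: "u \<in> J" "v \<in> J" "u \<ominus> v \<in> K" for u v k
  proof (induction k)
    case 0
    then show ?case by (simp add: D0)
  next
    case (Suc k)
    have c: "u \<in> carrier R" "v \<in> carrier R" using uv ideal_closed(7)[OF J] by auto
    then have c': "u [^] k \<in> carrier R" "v [^] k \<in> carrier R" by auto
    have "u [^] Suc k \<ominus> v [^] Suc k = u \<otimes> (u [^] k \<ominus> v [^] k) \<oplus> (u \<ominus> v) \<otimes> v [^] k"
      unfolding nat_pow_Suc using c c' by algebra
    moreover have "u \<otimes> (u [^] k \<ominus> v [^] k) \<in> D (1 + k)"
      using uv Suc by (intro mult) (auto simp: ideal_pow_one[OF J] simp del: One_nat_def)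
    moreover have "(u \<ominus> v) \<otimes> v [^] k \<in> D (1 + k)"
      using uv pow_mem_ideal_pow[OF J uv(2)] by (auto simp: DS intro: ideal_prod.prod)
    ultimately show ?case using ideal_closed(2)[OF iD] by simp
  qed
  show "monomial R S \<alpha> p \<ominus> monomial R S \<alpha> q \<in> D (\<Sum>i\<in>S. \<alpha> i)"
    if "finite S" "p \<in> S \<rightarrow> J" "q \<in> S \<rightarrow> J" "\<And>i. i \<in> S \<Longrightarrow> p i \<ominus> q i \<in> K"
    using that
  proof (induction S rule: finite_induct)
    case empty
    then show ?case by (simp add: monomial_def D0)
  next
    case (insert s S)
    have c: "p \<in> insert s S \<rightarrow> carrier R" "q \<in> insert s S \<rightarrow> carrier R"
      using insert.prems ideal_closed(7)[OF J] by auto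
    define P Q where "P = monomial R S \<alpha> p" and "Q = monomial R S \<alpha> q"
    have PQ: "P \<in> carrier R" "Q \<in> carrier R" "p s [^] \<alpha> s \<in> carrier R" "q s [^] \<alpha> s \<in> carrier R"
      using c by (auto simp: P_def Q_def intro!: monomial_closed)
    have "monomial R (insert s S) \<alpha> p \<ominus> monomial R (insert s S) \<alpha> q
      = p s [^] \<alpha> s \<otimes> (P \<ominus> Q) \<oplus> Q \<otimes> (p s [^] \<alpha> s \<ominus> q s [^] \<alpha> s)"
      unfolding monomial_insert[OF insert.hyps c(1)] monomial_insert[OF insert.hyps c(2)]
        P_def[symmetric] Q_def[symmetric] using PQ by algebra
    moreover have "p s [^] \<alpha> s \<otimes> (P \<ominus> Q) \<in> D (\<alpha> s + (\<Sum>i\<in>S. \<alpha> i))"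
      using insert by (intro mult pow_mem_ideal_pow J) (auto simp: P_def Q_def)
    moreover have "Q \<otimes> (p s [^] \<alpha> s \<ominus> q s [^] \<alpha> s) \<in> D ((\<Sum>i\<in>S. \<alpha> i) + \<alpha> s)"
      using insert.prems unfolding Q_def by (intro mult pow monomial_in_ideal_pow J insert.hyps) auto
    ultimately show ?case using insert.hyps ideal_closed(2)[OF iD] by (simp add: add.commute)
  qed
qed

lemma (in cring) monomial_mult:
  assumes "p \<in> S \<rightarrow> carrier R" "q \<in> S \<rightarrow> carrier R"
  shows "monomial R S \<alpha> (\<lambda>i. p i \<otimes> q i) = monomial R S \<alpha> p \<otimes> monomial R S \<alpha> q"
proof -
  have "monomial R S \<alpha> (\<lambda>i. p i \<otimes> q i) = (\<Otimes>i\<in>S. p i [^] \<alpha> i \<otimes> q i [^] \<alpha> i)"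
    unfolding monomial_def using assms by (intro finprod_cong') (auto simp: Pi_iff nat_pow_distrib)
  also have "\<dots> = monomial R S \<alpha> p \<otimes> monomial R S \<alpha> q"
    unfolding monomial_def using assms by (intro finprod_multf) auto
  finally show ?thesis .
qed

lemma (in cring) monomial_const:
  assumes "finite S" "z \<in> carrier R"
  shows "monomial R S \<alpha> (\<lambda>_. z) = z [^] (\<Sum>i\<in>S. \<alpha> i)"
  using assms(1)
proof (induction S rule: finite_induct)
  case (insert s S)
  then show ?case using assms(2) by (subst monomial_insert) (auto simp: nat_pow_mult)
qed (simp add: monomial_def)

lemma (in cring) ideal_prod_distrib_incl:
  assumes "ideal A R" "ideal B R" "ideal C R"
  shows "(A <+>\<^bsub>R\<^esub> B) \<cdot> C \<subseteq> A \<cdot> C <+>\<^bsub>R\<^esub> B \<cdot> C"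
proof (rule ideal_prod_least)
  show "ideal (A \<cdot> C <+>\<^bsub>R\<^esub> B \<cdot> C) R" by (intro add_ideals ideal_prod_is_ideal assms)
  fix u c assume "u \<in> A <+>\<^bsub>R\<^esub> B" and c: "c \<in> C"
  then obtain a b where u: "a \<in> A" "b \<in> B" "u = a \<oplus> b" by (auto simp: set_add_iff)
  then have "u \<otimes> c = a \<otimes> c \<oplus> b \<otimes> c"
    using c ideal_closed(7)[OF assms(1)] ideal_closed(7)[OF assms(2)] ideal_closed(7)[OF assms(3)]
    by (auto simp: l_distr)
  then show "u \<otimes> c \<in> A \<cdot> C <+>\<^bsub>R\<^esub> B \<cdot> C"
    unfolding set_add_iff using u c by (auto intro: ideal_prod.prod)
qed

context infinite_residue_local_cring
begin

text \<open>Noether normalization in one step: a form with a unit coefficient does not vanish at some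
  \<open>a\<close> with \<open>a l\<close> a unit, and the elements \<open>a l x\<^sub>i - a i x\<^sub>l\<close> generate a reduction.\<close>

lemma reduction_drop:
  assumes x: "x \<in> {..<n} \<rightarrow> carrier R" and J: "J = Idl (x ` {..<n})"
    and C: "C \<in> exponents n r \<rightarrow> carrier R"
    and rel: "(\<Oplus>\<alpha>\<in>exponents n r. C \<alpha> \<otimes> monomial R {..<n} \<alpha> x) \<in> m \<cdot> ideal_pow R J r"
    and nt: "\<exists>\<alpha>\<in>exponents n r. C \<alpha> \<notin> m"
  shows "\<exists>l<n. \<exists>g \<in> {..<n} - {l} \<rightarrow> J. \<exists>q.
    ideal_pow R J (Suc q) = (Idl (g ` ({..<n} - {l}))) \<cdot> ideal_pow R J q"
proof -
  have xJ: "x \<in> {..<n} \<rightarrow> J" and iJ: "ideal J R"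
    using genideal_self[of "x ` {..<n}"] genideal_ideal[of "x ` {..<n}"] x unfolding J by auto
  note iJr = ideal_pow_ideal[OF iJ]
  have imJ: "ideal (m \<cdot> ideal_pow R J k) R" for k by (intro ideal_prod_is_ideal m_ideal iJr)
  define F where "F z = (\<Oplus>\<alpha>\<in>exponents n r. C \<alpha> \<otimes> monomial R {..<n} \<alpha> z)" for z
  have Fx: "F x \<in> m \<cdot> ideal_pow R J r" using rel by (simp add: F_def)
  \<comment> \<open>If the form took all its values in \<open>m\<close>, its coefficients would lie
    in \<open>m\<close>, since the residue field is infinite.\<close>
  have "\<exists>a \<in> {..<n} \<rightarrow> carrier R. F a \<notin> m"
  proof (rule ccontr)
    assume neg: "\<not> ?thesis"
    have "C \<alpha> \<in> m" if "\<alpha> \<in> exponents n r" for \<alpha>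
    proof (rule monomial_coeffs_in_m[of "{..<n}" "exponents n r" C "\<lambda>\<alpha>. \<alpha>"])
      show "a = b" if "a \<in> exponents n r" "b \<in> exponents n r" "\<And>i. i \<in> {..<n} \<Longrightarrow> a i = b i" for a b
        using that by (auto simp: exponents_def intro: PiE_ext)
      show "(\<Oplus>\<alpha>\<in>exponents n r. C \<alpha> \<otimes> monomial R {..<n} \<alpha> z) \<in> m" if "z \<in> {..<n} \<rightarrow> carrier R" for z
        using neg that unfolding F_def by blast
    qed (use C that finite_exponents in auto)
    then show False using nt by auto
  qed
  then obtain a where a: "a \<in> {..<n} \<rightarrow> carrier R" "F a \<notin> m" by auto
  \<comment> \<open>A form of degree 0 takes the same value at \<open>a\<close> and at
    \<open>x\<close>, but \<open>F x\<close> lies in \<open>m\<close> and \<open>F a\<close> does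
    not.\<close>
  have r0: "r \<noteq> 0"
  proof
    assume "r = 0"
    have "monomial R {..<n} \<alpha> z = \<one>" if "\<alpha> \<in> exponents n r" "z \<in> {..<n} \<rightarrow> carrier R" for \<alpha> z
    proof -
      have "monomial R {..<n} \<alpha> z = monomial R {..<n} (\<lambda>_. 0) z"
        using that \<open>r = 0\<close> by (intro monomial_cong) (auto simp: exponents_def)
      then show ?thesis by (simp add: monomial_def)
    qed
    then have "F a = F x"
      unfolding F_def using C x a by (intro finsum_cong') (auto simp: Pi_iff)
    then show False using Fx a(2) ideal_prod_inter[OF m_ideal iJr] by auto
  qed
  have "\<exists>l<n. a l \<notin> m"
  proof (rule ccontr)
    assume "\<not> ?thesis"
    then have am: "a \<in> {..<n} \<rightarrow> m" by auto
    have "monomial R {..<n} \<alpha> a \<in> m" if "\<alpha> \<in> exponents n r" for \<alpha>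
    proof -
      have "monomial R {..<n} \<alpha> a \<in> ideal_pow R m r"
        using monomial_in_ideal_pow[OF m_ideal _ am, of \<alpha>] that by (auto simp: exponents_def)
      then show ?thesis
        using ideal_pow_decreasing[OF m_ideal, of 1 r] r0 ideal_pow_one[OF m_ideal] by auto
    qed
    then have "F a \<in> m" unfolding F_def using C ideal_closed(5)[OF m_ideal]
      by (intro finsum_in_ideal[OF m_ideal]) (auto simp: Pi_iff)
    then show False using a by auto
  qed
  then obtain l where l: "l < n" "a l \<notin> m" by auto
  have al: "a l \<in> carrier R" and xl: "x l \<in> carrier R" "x l \<in> J" using a x xJ l by auto
  define T where "T = {..<n} - {l}"
  define g where "g i = a l \<otimes> x i \<ominus> a i \<otimes> x l" for i
  have gJ: "g i \<in> J" if "i < n" for i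
    unfolding g_def using that xJ a l by (intro ideal_closed(4,5)[OF iJ]) auto
  define K where "K = Idl (g ` T)"
  have gT: "g ` T \<subseteq> J" using gJ by (auto simp: T_def)
  then have gc: "g ` T \<subseteq> carrier R" using ideal_closed(8)[OF iJ] by auto
  have iK: "ideal K R" unfolding K_def by (rule genideal_ideal[OF gc])
  have KJ: "K \<subseteq> J" unfolding K_def by (rule Idl_least[OF iJ gT])
  have gK: "a l \<otimes> x i \<ominus> a i \<otimes> x l \<in> K" if i: "i < n" for i
  proof (cases "i = l")
    case True
    then show ?thesis using ideal_closed(1)[OF iK] al xl by (simp add: a_minus_def r_neg)
  next
    case False
    then show ?thesis using genideal_self[OF gc] i by (auto simp: K_def T_def g_def)
  qed
  define D where "D k = (case k of 0 \<Rightarrow> {\<zero>} | Suc j \<Rightarrow> K \<cdot> ideal_pow R J j)" for k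
  note pd = pow_diff_ideal[OF iK iJ KJ, folded D_def]
  have iD: "ideal (D k) R" for k by (rule pd(1))
  have iX: "ideal (PIdl (x l [^] k)) R" for k :: nat using xl by (intro cgenideal_ideal) auto
  have iDX: "ideal (D k <+>\<^bsub>R\<^esub> PIdl (x l [^] k)) R" for k by (intro add_ideals iD iX)
  \<comment> \<open>As \<open>a l\<close> is a unit, the elements \<open>a l x_i - a i x_l\<close>
    of \<open>K\<close> make every \<open>x_i\<close> a multiple of \<open>x_l\<close> modulo
    \<open>K\<close>. Thus \<open>J\<close> is contained in \<open>K\<close> plus the principal
    ideal of \<open>x l\<close>.\<close>
  have JK: "\<exists>b\<in>K. \<exists>s\<in>carrier R. v = b \<oplus> s \<otimes> x l" if "v \<in> J" for v
  proof -
    have i2: "ideal (K <+>\<^bsub>R\<^esub> PIdl (x l)) R" using xl by (intro add_ideals iK cgenideal_ideal) auto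
    have "x i \<in> K <+>\<^bsub>R\<^esub> PIdl (x l)" if i: "i < n" for i
    proof (rule ideal_unit_cancel[OF i2 al l(2)])
      have c: "a i \<in> carrier R" "x i \<in> carrier R" using a x i by auto
      have "a l \<otimes> x i = (a l \<otimes> x i \<ominus> a i \<otimes> x l) \<oplus> a i \<otimes> x l" using al xl c by algebra
      moreover have "a i \<otimes> x l \<in> PIdl (x l)" using c by (auto simp: cgenideal_def)
      ultimately show "a l \<otimes> x i \<in> K <+>\<^bsub>R\<^esub> PIdl (x l)" unfolding set_add_iff using gK[OF i] by blast
    qed (use x i in auto)
    then have "J \<subseteq> K <+>\<^bsub>R\<^esub> PIdl (x l)" unfolding J by (intro Idl_least[OF i2]) auto
    then have "v \<in> K <+>\<^bsub>R\<^esub> PIdl (x l)" using that by blast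
    then show ?thesis by (auto simp: set_add_iff cgenideal_def)
  qed
  \<comment> \<open>In a product of \<open>k\<close> elements of \<open>J\<close>, every term with a
    factor in \<open>K\<close> has its other factors in \<open>J\<close> and so lies in
    \<open>K J^(k-1)\<close>. Beyond that, the multiples of the \<open>k\<close>-th power of
    \<open>x l\<close> remain.\<close>
  have JD: "ideal_pow R J k \<subseteq> D k <+>\<^bsub>R\<^esub> PIdl (x l [^] k)" for k
  proof (induction k)
    case 0
    have "\<one> \<in> PIdl (x l [^] (0::nat))" using cgenideal_self[OF one_closed] by simp
    then have "PIdl (x l [^] (0::nat)) = carrier R" using ideal.one_imp_carrier[OF iX] by blast
    then show ?case using set_add_incl(2)[OF iD[of 0] iX[of 0]] unfolding ideal_pow_0 by simp
  next
    case (Suc k)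
    have "ideal_pow R J k \<cdot> J \<subseteq> D (Suc k) <+>\<^bsub>R\<^esub> PIdl (x l [^] Suc k)"
    proof (rule ideal_prod_least[OF iDX])
      fix u v assume u: "u \<in> ideal_pow R J k" and v: "v \<in> J"
      obtain d s where d: "d \<in> D k" "s \<in> carrier R" "u = d \<oplus> s \<otimes> x l [^] k"
        using subsetD[OF Suc u] by (auto simp: set_add_iff cgenideal_def)
      obtain b t where b: "b \<in> K" "t \<in> carrier R" "v = b \<oplus> t \<otimes> x l" using JK[OF v] by auto
      have c: "d \<in> carrier R" "b \<in> carrier R" "v \<in> carrier R" "x l [^] k \<in> carrier R" "u \<in> carrier R"
        using d b v u ideal_closed(7)[OF iD] ideal_closed(7)[OF iK] ideal_closed(7)[OF iJ]
          ideal_closed(7)[OF iJr] xl by auto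
      have "u \<otimes> v = (t \<otimes> (x l \<otimes> d) \<oplus> b \<otimes> u) \<oplus> (s \<otimes> t) \<otimes> (x l [^] Suc k)"
      proof -
        have "u \<otimes> v = b \<otimes> u \<oplus> t \<otimes> x l \<otimes> u" unfolding b(3) using c b xl by algebra
        also have "t \<otimes> x l \<otimes> u = t \<otimes> (x l \<otimes> d) \<oplus> (s \<otimes> t) \<otimes> (x l [^] Suc k)"
          unfolding d(3) nat_pow_Suc using c b d(2) xl by algebra
        finally show ?thesis using c b d(2) xl by (simp add: a_ac)
      qed
      moreover have "x l \<otimes> d \<in> D (1 + k)"
        using pd(3)[of "x l" 1 d k] d xl ideal_pow_one[OF iJ] by simp
      then have "t \<otimes> (x l \<otimes> d) \<in> D (Suc k)" using ideal_closed(5)[OF iD] b by simp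
      moreover have "b \<otimes> u \<in> D (Suc k)" using b u by (auto simp: D_def intro: ideal_prod.prod)
      ultimately show "u \<otimes> v \<in> D (Suc k) <+>\<^bsub>R\<^esub> PIdl (x l [^] Suc k)"
        unfolding set_add_iff cgenideal_def using ideal_closed(2)[OF iD] d(2) b(2) by blast
    qed
    then show ?case unfolding ideal_pow_Suc .
  qed
  \<comment> \<open>\<open>u\<close> and \<open>v\<close> agree modulo \<open>K\<close>. By
    homogeneity the form has the value \<open>(a l)^r F(x)\<close> at \<open>u\<close> and
    \<open>F(a) (x l)^r\<close> at \<open>v\<close>, and their difference lies in
    \<open>D r\<close>. Since \<open>F(x)\<close> lies in \<open>m J^r\<close> and
    \<open>F(a)\<close> is a unit, the power \<open>(x l)^r\<close> lies in
    \<open>D r + m J^r\<close>.\<close>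
  define u v where "u i = a l \<otimes> x i" and "v i = a i \<otimes> x l" for i
  have uv: "u \<in> {..<n} \<rightarrow> J" "v \<in> {..<n} \<rightarrow> J"
    using xJ a(1) al xl ideal_closed(5)[OF iJ] by (auto simp: u_def v_def Pi_iff)
  have diff: "C \<alpha> \<otimes> (monomial R {..<n} \<alpha> u \<ominus> monomial R {..<n} \<alpha> v) \<in> D r"
    if al: "\<alpha> \<in> exponents n r" for \<alpha>
    using pd(5)[OF _ uv gK[folded u_def v_def], of \<alpha>] that C ideal_closed(5)[OF iD]
    by (auto simp: exponents_def)
  have mu: "monomial R {..<n} \<alpha> u = a l [^] r \<otimes> monomial R {..<n} \<alpha> x"
    and mv: "monomial R {..<n} \<alpha> v = monomial R {..<n} \<alpha> a \<otimes> x l [^] r" if "\<alpha> \<in> exponents n r" for \<alpha>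
    using monomial_mult[of "\<lambda>_. a l" "{..<n}" x \<alpha>] monomial_mult[of a "{..<n}" "\<lambda>_. x l" \<alpha>]
      monomial_const[of "{..<n}" _ \<alpha>] al xl x a that
    by (auto simp: u_def[abs_def] v_def[abs_def] exponents_def)
  have mc: "monomial R {..<n} \<alpha> x \<in> carrier R" "monomial R {..<n} \<alpha> a \<in> carrier R" for \<alpha>
    using x a by auto
  have p: "a l [^] r \<in> carrier R" "x l [^] r \<in> carrier R" using al xl by auto
  have Fc: "F x \<in> carrier R" "F a \<in> carrier R" unfolding F_def using C mc
    by (auto intro!: finsum_closed simp: Pi_iff)
  have "(\<Oplus>\<alpha>\<in>exponents n r. C \<alpha> \<otimes> (monomial R {..<n} \<alpha> u \<ominus> monomial R {..<n} \<alpha> v)) \<in> D r"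
    using diff by (intro finsum_in_ideal[OF iD]) auto
  also have "(\<Oplus>\<alpha>\<in>exponents n r. C \<alpha> \<otimes> (monomial R {..<n} \<alpha> u \<ominus> monomial R {..<n} \<alpha> v))
    = (\<Oplus>\<alpha>\<in>exponents n r. a l [^] r \<otimes> (C \<alpha> \<otimes> monomial R {..<n} \<alpha> x)
        \<oplus> (\<ominus> (x l [^] r)) \<otimes> (C \<alpha> \<otimes> monomial R {..<n} \<alpha> a))"
  proof (intro finsum_cong' refl)
    fix \<alpha> assume e: "\<alpha> \<in> exponents n r"
    then have "C \<alpha> \<in> carrier R" using C by auto
    then show "C \<alpha> \<otimes> (monomial R {..<n} \<alpha> u \<ominus> monomial R {..<n} \<alpha> v)
      = a l [^] r \<otimes> (C \<alpha> \<otimes> monomial R {..<n} \<alpha> x) \<oplus> (\<ominus> (x l [^] r)) \<otimes> (C \<alpha> \<otimes> monomial R {..<n} \<alpha> a)"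
      unfolding mu[OF e] mv[OF e] using p mc[of \<alpha>] by algebra
  qed (use C p mc in \<open>auto simp: Pi_iff\<close>)
  also have "\<dots> = a l [^] r \<otimes> F x \<oplus> (\<ominus> (x l [^] r)) \<otimes> F a"
    unfolding F_def using C p mc
    by (subst finsum_addf) (auto simp: Pi_iff finsum_rdistr finite_exponents)
  finally have 1: "a l [^] r \<otimes> F x \<oplus> (\<ominus> (x l [^] r)) \<otimes> F a \<in> D r" .
  define Z where "Z = D r <+>\<^bsub>R\<^esub> m \<cdot> ideal_pow R J r"
  have iZ: "ideal Z R" unfolding Z_def by (intro add_ideals iD imJ)
  have Zi: "D r \<subseteq> Z" "m \<cdot> ideal_pow R J r \<subseteq> Z" unfolding Z_def by (rule set_add_incl[OF iD imJ])+
  have "F a \<otimes> x l [^] r = a l [^] r \<otimes> F x \<ominus> (a l [^] r \<otimes> F x \<oplus> (\<ominus> (x l [^] r)) \<otimes> F a)"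
    using p Fc by algebra
  moreover have "\<dots> \<in> Z"
    using Zi 1 Fx p by (intro ideal_closed(4,5)[OF iZ]) auto
  ultimately have "x l [^] r \<in> Z" using ideal_unit_cancel[OF iZ Fc(2) a(2) p(2)] by simp
  then have "PIdl (x l [^] r) \<subseteq> Z" by (rule cgenideal_minimal[OF iZ])
  then have "D r <+>\<^bsub>R\<^esub> PIdl (x l [^] r) \<subseteq> Z" using Zi by (intro set_add_least iZ) auto
  then have "ideal_pow R J r \<subseteq> D r <+>\<^bsub>R\<^esub> m \<cdot> ideal_pow R J r" using JD[of r] unfolding Z_def by auto
  \<comment> \<open>Nakayama's lemma removes \<open>m J^r\<close>. What remains, \<open>J^r\<close>
    inside \<open>K J^(r-1)\<close>, is the reduction equation.\<close>
  then have JrD: "ideal_pow R J r \<subseteq> D r" by (rule nakayama[OF iJr iD])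
  obtain q where q: "r = Suc q" using r0 not0_implies_Suc by auto
  have "ideal_pow R J (Suc q) = K \<cdot> ideal_pow R J q"
    using JrD pd(2)[of r] unfolding q by (auto simp: D_def)
  moreover have "g \<in> {..<n} - {l} \<rightarrow> J" using gJ by auto
  ultimately show ?thesis using l(1) unfolding K_def T_def by blast
qed

end

section \<open>Composition of reductions\<close>

context cring
begin

lemma reduction_pow:
  assumes I: "ideal I R" and J: "ideal J R" and eq: "ideal_pow R I (Suc s) = J \<cdot> ideal_pow R I s"
  shows "ideal_pow R I (s + k) = ideal_pow R J k \<cdot> ideal_pow R I s"
proof (induction k)
  case 0
  then show ?case
    using ideal_prod_one[OF ideal_pow_ideal[OF I]] ideal_prod_commute[OF oneideal ideal_pow_ideal[OF I]]
    by (simp add: ideal_pow_0)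
next
  case (Suc k)
  note i = ideal_pow_ideal[OF I] ideal_pow_ideal[OF J]
  have "ideal_pow R I (s + Suc k) = ideal_pow R J k \<cdot> ideal_pow R I s \<cdot> I"
    using Suc by (simp add: ideal_pow_Suc)
  also have "\<dots> = ideal_pow R J k \<cdot> ideal_pow R I (Suc s)"
    unfolding ideal_pow_Suc by (rule ideal_prod_assoc[OF i(2) i(1) I])
  also have "\<dots> = ideal_pow R J k \<cdot> (J \<cdot> ideal_pow R I s)" unfolding eq ..
  also have "\<dots> = ideal_pow R J (Suc k) \<cdot> ideal_pow R I s"
    unfolding ideal_pow_Suc by (rule ideal_prod_assoc[OF i(2) J i(1), symmetric])
  finally show ?case .
qed

lemma reduction_trans:
  assumes I: "ideal I R" and "reduction R K J" "reduction R J I"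
  shows "reduction R K I"
proof -
  obtain r where K: "ideal K R" "K \<subseteq> J" "ideal_pow R J (Suc r) = K \<cdot> ideal_pow R J r"
    using assms(2) by (auto simp: reduction_def)
  obtain s where J: "ideal J R" "J \<subseteq> I" "ideal_pow R I (Suc s) = J \<cdot> ideal_pow R I s"
    using assms(3) by (auto simp: reduction_def)
  note i = ideal_pow_ideal[OF I] ideal_pow_ideal[OF J(1)]
  have "ideal_pow R I (Suc (s + r)) = ideal_pow R J (Suc r) \<cdot> ideal_pow R I s"
    using reduction_pow[OF I J(1,3), of "Suc r"] by simp
  also have "\<dots> = K \<cdot> (ideal_pow R J r \<cdot> ideal_pow R I s)"
    unfolding K(3) by (rule ideal_prod_assoc[OF K(1) i(2) i(1)])
  also have "\<dots> = K \<cdot> ideal_pow R I (s + r)" using reduction_pow[OF I J(1,3), of r] by simp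
  finally show ?thesis using K J by (auto simp: reduction_def)
qed

lemma reduction_contains_power:
  assumes I: "ideal I R" and "reduction R J I"
  shows "\<exists>s. ideal_pow R I s \<subseteq> J"
proof -
  obtain s where J: "ideal J R" "ideal_pow R I (Suc s) = J \<cdot> ideal_pow R I s"
    using assms(2) by (auto simp: reduction_def)
  have "ideal_pow R I (Suc s) \<subseteq> J"
    unfolding J(2) using ideal_prod_inter[OF J(1) ideal_pow_ideal[OF I]] by auto
  then show ?thesis by blast
qed

end

context infinite_residue_local_cring
begin

text \<open>Among the reductions of \<open>I\<close> inside \<open>J\<close>, take one with the
  least number of generators. If it had more than \<open>length ys\<close>, then
  \<open>exists_form_relation\<close> and \<open>reduction_drop\<close> would produce one with a
  generator less. By minimality of \<open>J\<close> it equals \<open>J\<close>.\<close>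

lemma minimal_reduction_generators:
  assumes I: "ideal I R" "I \<subseteq> m" "ideal_pow R m c \<subseteq> I"
    and min: "minimal_reduction R J I"
    and ys: "set ys \<subseteq> m" "ideal_pow R m N0 \<subseteq> Idl (set ys)"
  shows "\<exists>x \<in> {..<length ys} \<rightarrow> carrier R. J = Idl (x ` {..<length ys})"
proof -
  define gen where "gen n K \<longleftrightarrow> (\<exists>x \<in> {..<n} \<rightarrow> carrier R. K = Idl (x ` {..<n}))" for n :: nat and K
  \<comment> \<open>Padding with zeros gives a family of exactly \<open>length ys\<close> generators
    also when fewer suffice.\<close>
  have gen_mono: "gen n' K" if gen: "gen n K" and "n \<le> n'" for n n' K
  proof -
    obtain x where x: "x \<in> {..<n} \<rightarrow> carrier R" "K = Idl (x ` {..<n})" using gen by (auto simp: gen_def)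
    define x' where "x' i = (if i < n then x i else \<zero>)" for i
    have x'c: "x' ` {..<n'} \<subseteq> carrier R" "x ` {..<n} \<subseteq> carrier R" using x by (auto simp: x'_def)
    note D = genideal_ideal[OF x'c(1)] genideal_self[OF x'c(1)]
    note D' = genideal_ideal[OF x'c(2)] genideal_self[OF x'c(2)]
    have "x i \<in> x' ` {..<n'}" if "i < n" for i
      using that \<open>n \<le> n'\<close> by (intro image_eqI[of _ _ i]) (auto simp: x'_def)
    then have "Idl (x ` {..<n}) \<subseteq> Idl (x' ` {..<n'})" using D by (intro Idl_least) auto
    moreover have "Idl (x' ` {..<n'}) \<subseteq> Idl (x ` {..<n})"
      using D' ideal_closed(1)[OF D'(1)] by (intro Idl_least) (auto simp: x'_def)
    ultimately show ?thesis using x x'c by (auto simp: gen_def intro!: bexI[of _ x'])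
  qed
  define good where "good n \<longleftrightarrow> (\<exists>K. gen n K \<and> K \<subseteq> J \<and> reduction R K I)" for n
  have redJ: "reduction R J I" and iJ: "ideal J R"
    using min by (auto simp: minimal_reduction_def reduction_def)
  obtain S where S: "finite S" "S \<subseteq> carrier R" "J = Idl S" using fg_ideal[OF iJ] .
  obtain h where h: "bij_betw h {0..<card S} S" using ex_bij_betw_nat_finite[OF S(1)] by auto
  have "h ` {..<card S} = S" using h by (auto simp: bij_betw_def atLeast0LessThan)
  then have "gen (card S) J" using S by (auto simp: gen_def intro!: bexI[of _ h])
  then have ex: "good (card S)" using redJ by (auto simp: good_def)
  define n where "n = (LEAST n. good n)"
  have gn: "good n" and least: "\<And>k. good k \<Longrightarrow> n \<le> k"
    unfolding n_def using LeastI[of good, OF ex] Least_le[of good] by auto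
  obtain K where K: "K \<subseteq> J" "reduction R K I" and "gen n K" using gn by (auto simp: good_def)
  then obtain x where x: "x \<in> {..<n} \<rightarrow> carrier R" "K = Idl (x ` {..<n})"
    by (auto simp: gen_def)
  have iK: "ideal K R" using K by (auto simp: reduction_def)
  have "n \<le> length ys"
  proof (rule ccontr)
    assume "\<not> ?thesis"
    then have n: "length ys < n" by simp
    obtain s where s: "ideal_pow R I s \<subseteq> K" using reduction_contains_power[OF I(1) K(2)] by auto
    \<comment> \<open>The exponent combines \<open>m^c\<close> in \<open>I\<close> with
      \<open>I^s\<close> in \<open>K\<close>.\<close>
    have "ideal_pow R m (c * s) \<subseteq> K"
      using ideal_pow_mono[OF I(3), of s] s ideal_pow_mult[OF m_ideal, of c s] by auto
    then have pw: "y [^] (c * s) \<in> K" if "y \<in> set ys" for y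
      using pow_mem_ideal_pow[OF m_ideal, of y "c * s"] ys that by auto
    have "K \<subseteq> m" using K I by (auto simp: reduction_def)
    from exists_form_relation[OF x this ys pw n] obtain r C where
      "C \<in> exponents n r \<rightarrow> carrier R"
      "(\<Oplus>\<alpha>\<in>exponents n r. C \<alpha> \<otimes> monomial R {..<n} \<alpha> x) \<in> m \<cdot> ideal_pow R K r"
      "\<exists>\<alpha>\<in>exponents n r. C \<alpha> \<notin> m" by blast
    from reduction_drop[OF x this] obtain l g q where l: "l < n" and g: "g \<in> {..<n} - {l} \<rightarrow> K"
      and q: "ideal_pow R K (Suc q) = (Idl (g ` ({..<n} - {l}))) \<cdot> ideal_pow R K q" by blast
    define K' where "K' = Idl (g ` ({..<n} - {l}))"
    have gK: "g ` ({..<n} - {l}) \<subseteq> K" using g by auto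
    then have gc: "g ` ({..<n} - {l}) \<subseteq> carrier R" using ideal_closed(8)[OF iK] by auto
    have K'K: "K' \<subseteq> K" unfolding K'_def by (rule Idl_least[OF iK gK])
    have "reduction R K' K" using q K'K genideal_ideal[OF gc] by (auto simp: reduction_def K'_def)
    then have red: "reduction R K' I" using reduction_trans[OF I(1)] K(2) by auto
    obtain h where h: "bij_betw h {0..<card ({..<n} - {l})} ({..<n} - {l})"
      using ex_bij_betw_nat_finite[of "{..<n} - {l}"] by auto
    have card: "card ({..<n} - {l}) = n - 1" using l by simp
    have "h ` {..<n - 1} = {..<n} - {l}" using h by (auto simp: bij_betw_def atLeast0LessThan card)
    then have gh: "(g \<circ> h) ` {..<n - 1} = g ` ({..<n} - {l})" by (metis image_comp)
    then have "g \<circ> h \<in> {..<n - 1} \<rightarrow> carrier R" using gc by (metis image_subset_iff_funcset)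
    then have "gen (n - 1) K'" unfolding gen_def K'_def gh[symmetric] by blast
    then have "good (n - 1)" using red K'K K(1) by (auto simp: good_def)
    then show False using least[of "n - 1"] l by auto
  qed
  moreover have "K = J" using min K by (auto simp: minimal_reduction_def)
  ultimately have "gen (length ys) J" using gen_mono[of n K] x by (auto simp: gen_def)
  then show ?thesis by (simp add: gen_def)
qed

end

context noetherian_local_cring
begin

text \<open>If \<open>J\<close> properly contained a reduction \<open>K\<close>, then replacing generators of \<open>J\<close> by elements of
  \<open>K\<close> as long as possible would produce a reduction with fewer than \<open>d\<close> generators, in
  contradiction to Krull's height theorem.\<close>

lemma minimal_reductionI:
  assumes I: "ideal I R" "I \<subseteq> m" "ideal_pow R m c \<subseteq> I" and red: "reduction R J I"
    and x: "x \<in> {..<d} \<rightarrow> carrier R" "J = Idl (x ` {..<d})" and dim: "krull_dim R = enat d"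
  shows "minimal_reduction R J I"
  unfolding minimal_reduction_def
proof (intro conjI allI impI notI)
  fix K assume redK: "reduction R K I" and KJ: "K \<subset> J"
  obtain s where K: "ideal K R" "K \<subseteq> I" "ideal_pow R I (Suc s) = K \<cdot> ideal_pow R I s"
    using redK by (auto simp: reduction_def)
  have iJ: "ideal J R" and JI: "J \<subseteq> I" using red by (auto simp: reduction_def)
  \<comment> \<open>\<open>Q j\<close> states that \<open>J\<close> has a family of \<open>d\<close>
    generators of which the first \<open>j\<close> lie in \<open>K\<close>; a largest such
    \<open>j\<close> is then examined.\<close>
  define Q where "Q j \<longleftrightarrow> j \<le> d \<and> (\<exists>z. z \<in> {..<d} \<rightarrow> carrier R \<and> J = Idl (z ` {..<d}) \<and> (\<forall>i<j. z i \<in> K))" for j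
  have "Q 0" using x by (auto simp: Q_def)
  moreover have "\<And>j. Q j \<Longrightarrow> j \<le> d" by (auto simp: Q_def)
  ultimately obtain j where j: "Q j" and max: "\<And>i. Q i \<Longrightarrow> i \<le> j"
    using Nat.ex_has_greatest_nat[of Q 0 d] by blast
  obtain z where z: "z \<in> {..<d} \<rightarrow> carrier R" "J = Idl (z ` {..<d})" "\<And>i. i < j \<Longrightarrow> z i \<in> K"
    and jd: "j \<le> d" using j by (auto simp: Q_def)
  have zJ: "z i \<in> J" if "i < d" for i using genideal_self[of "z ` {..<d}"] z that by auto
  have "j < d"
  proof (rule ccontr)
    assume "\<not> ?thesis"
    then have "z ` {..<d} \<subseteq> K" using z(3) by auto
    then have "J \<subseteq> K" unfolding z(2) by (rule Idl_least[OF K(1)])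
    then show False using KJ by auto
  qed
  define Z where "Z = Idl (z ` {..<j})"
  have zc: "z ` {..<j} \<subseteq> carrier R" using z(1) jd by auto
  have iZ: "ideal Z R" unfolding Z_def by (rule genideal_ideal[OF zc])
  have imJ: "ideal (m \<cdot> J) R" by (intro ideal_prod_is_ideal m_ideal iJ)
  have iZm: "ideal (Z <+>\<^bsub>R\<^esub> m \<cdot> J) R" by (intro add_ideals iZ imJ)
  note Zi = set_add_incl[OF iZ imJ]
  have "K \<subseteq> Z <+>\<^bsub>R\<^esub> m \<cdot> J"
  proof
    fix k assume k: "k \<in> K"
    then have "k \<in> Idl (z ` {..<d})" using KJ z by auto
    then obtain r where r: "r \<in> {..<d} \<rightarrow> carrier R" "k = (\<Oplus>i\<in>{..<d}. r i \<otimes> z i)"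
      using Idl_image[of "{..<d}" z] z(1) by auto
    have "r i \<in> m" if i: "j \<le> i" "i < d" for i
    proof (rule ccontr)
      assume ri: "r i \<notin> m"
      \<comment> \<open>A unit coefficient of \<open>k\<close> at \<open>i\<close> allows
        \<open>k\<close> to replace \<open>z i\<close>. The old \<open>z j\<close> moves to place
        \<open>i\<close> and \<open>k\<close> goes to place \<open>j\<close>, so that the first
        \<open>j + 1\<close> generators lie in \<open>K\<close>. For \<open>i = j\<close> the second
        update overrides the first.\<close>
      define z' where "z' = (z(i := z j))(j := k)"
      have kc: "k \<in> carrier R" using k ideal_closed(7)[OF K(1)] by auto
      have z'J: "z' e \<in> J" if "e < d" for e using that zJ k KJ i by (auto simp: z'_def)
      then have z'c: "z' ` {..<d} \<subseteq> carrier R" using ideal_closed(7)[OF iJ] by auto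
      note D = genideal_ideal[OF z'c] genideal_self[OF z'c]
      have kD: "k \<in> Idl (z' ` {..<d})" using D(2) \<open>j < d\<close> by (auto simp: z'_def)
      have oth: "z e \<in> Idl (z' ` {..<d})" if "e < d" "e \<noteq> i" for e
      proof (cases "e = j")
        case True
        then have "z e = z' i" using that by (auto simp: z'_def)
        then show ?thesis using D(2) i by auto
      next
        case False
        then have "z e = z' e" using that by (auto simp: z'_def)
        then show ?thesis using D(2) that by auto
      qed
      have rc: "r e \<in> carrier R" "z e \<in> carrier R" if "e < d" for e using r z that by auto
      define t where "t = (\<Oplus>e\<in>{..<d} - {i}. r e \<otimes> z e)"
      have "(\<Oplus>e\<in>insert i ({..<d} - {i}). r e \<otimes> z e) = r i \<otimes> z i \<oplus> t"
        unfolding t_def using rc i by (intro finsum_insert) auto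
      moreover have "insert i ({..<d} - {i}) = {..<d}" using i by auto
      ultimately have kt: "k = r i \<otimes> z i \<oplus> t" using r(2) by simp
      have t: "t \<in> Idl (z' ` {..<d})"
        unfolding t_def using oth rc
        by (intro finsum_in_ideal[OF D(1)]) (auto intro!: ideal_closed(5)[OF D(1)])
      have "r i \<otimes> z i = k \<ominus> t"
        unfolding kt using rc[OF i(2)] ideal_closed(7)[OF D(1) t] by algebra
      then have "r i \<otimes> z i \<in> Idl (z' ` {..<d})" using ideal_closed(4)[OF D(1) kD t] by simp
      then have "z i \<in> Idl (z' ` {..<d})" using ideal_unit_cancel[OF D(1) _ ri] rc i by auto
      then have "z e \<in> Idl (z' ` {..<d})" if "e < d" for e using oth that by (cases "e = i") auto
      then have "J \<subseteq> Idl (z' ` {..<d})" unfolding z(2) by (intro Idl_least D) auto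
      moreover have "Idl (z' ` {..<d}) \<subseteq> J" using z'J by (intro Idl_least iJ) auto
      moreover have "z' e \<in> K" if "e < Suc j" for e using that z(3) k i by (auto simp: z'_def less_Suc_eq)
      ultimately have "Q (Suc j)" unfolding Q_def using \<open>j < d\<close> z'c by (intro conjI exI[of _ z']) auto
      then show False using max[of "Suc j"] by auto
    qed
    then have "r i \<otimes> z i \<in> Z <+>\<^bsub>R\<^esub> m \<cdot> J" if i: "i < d" for i
    proof (cases "i < j")
      case True
      then have "z i \<in> Z" unfolding Z_def using genideal_self[OF zc] by auto
      then have "r i \<otimes> z i \<in> Z" using ideal_closed(5)[OF iZ] r i by auto
      then show ?thesis using Zi by auto
    next
      case False
      then have "r i \<in> m" using \<open>\<And>i. j \<le> i \<Longrightarrow> i < d \<Longrightarrow> r i \<in> m\<close> i by auto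
      then have "r i \<otimes> z i \<in> m \<cdot> J" using zJ[OF i] by (rule ideal_prod.prod)
      then show ?thesis using Zi by auto
    qed
    then show "k \<in> Z <+>\<^bsub>R\<^esub> m \<cdot> J" unfolding r(2) by (intro finsum_in_ideal[OF iZm]) auto
  qed
  note iIs = ideal_pow_ideal[OF I(1)]
  \<comment> \<open>From \<open>K\<close> inside \<open>Z + m J\<close> it follows that
    \<open>I^(s+1) = K I^s\<close> lies in \<open>Z I^s + m I^(s+1)\<close>. Nakayama's lemma then
    puts a power of \<open>I\<close> into \<open>Z\<close>, an ideal with \<open>j < d\<close>
    generators.\<close>
  have "ideal_pow R I (Suc s) \<subseteq> (Z <+>\<^bsub>R\<^esub> m \<cdot> J) \<cdot> ideal_pow R I s"
    unfolding K(3) by (intro ideal_prod_mono \<open>K \<subseteq> Z <+>\<^bsub>R\<^esub> m \<cdot> J\<close> subset_refl)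
  also have "\<dots> \<subseteq> Z \<cdot> ideal_pow R I s <+>\<^bsub>R\<^esub> (m \<cdot> J) \<cdot> ideal_pow R I s"
    by (rule ideal_prod_distrib_incl[OF iZ imJ iIs])
  also have "\<dots> \<subseteq> Z \<cdot> ideal_pow R I s <+>\<^bsub>R\<^esub> m \<cdot> ideal_pow R I (Suc s)"
  proof -
    have "(m \<cdot> J) \<cdot> ideal_pow R I s = m \<cdot> (J \<cdot> ideal_pow R I s)"
      by (rule ideal_prod_assoc[OF m_ideal iJ iIs])
    also have "\<dots> \<subseteq> m \<cdot> (I \<cdot> ideal_pow R I s)" by (intro ideal_prod_mono subset_refl JI)
    also have "I \<cdot> ideal_pow R I s = ideal_pow R I (Suc s)"
      unfolding ideal_pow_Suc by (rule ideal_prod_commute[OF I(1) iIs])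
    finally show ?thesis by (force simp: set_add_iff)
  qed
  finally have "ideal_pow R I (Suc s) \<subseteq> Z \<cdot> ideal_pow R I s"
    by (intro nakayama[OF iIs ideal_prod_is_ideal[OF iZ iIs]])
  then have IZ: "ideal_pow R I (Suc s) \<subseteq> Z" using ideal_prod_inter[OF iZ iIs] by auto
  have "krull_dim R \<le> enat (length (map z [0..<j]))"
  proof (rule krull_dim_le)
    have "z i \<in> m" if "i < d" for i using zJ[OF that] JI I by auto
    then show "set (map z [0..<j]) \<subseteq> m" using jd by auto
    fix P assume P: "primeideal P R" "set (map z [0..<j]) \<subseteq> P"
    then have iP: "ideal P R" using primeideal.axioms by auto
    have "Z \<subseteq> P" unfolding Z_def using P(2) by (intro Idl_least[OF iP]) (auto simp: atLeast0LessThan)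
    then have "y [^] Suc s \<in> P" if "y \<in> I" for y using pow_mem_ideal_pow[OF I(1) that, of "Suc s"] IZ by auto
    then have "I \<subseteq> P" using primeideal_pow[OF P(1)] ideal_closed(7)[OF I(1)] by blast
    then have "y [^] c \<in> P" if "y \<in> m" for y using pow_mem_ideal_pow[OF m_ideal that, of c] I(3) by auto
    then have "m \<subseteq> P" using primeideal_pow[OF P(1)] ideal_closed(7)[OF m_ideal] by blast
    then show "P = m" using prime_le_m[OF P(1)] by auto
  qed
  then show False using dim \<open>j < d\<close> by simp
qed (rule red)

end

section \<open>Openness\<close>

text \<open>The ambient ring for Nakayama's lemma over polynomial functions. Functions are
  extensional on \<open>\<Lambda>\<close>, so that equality in the ring is equality of the values on
  \<open>\<Lambda>\<close>.\<close>

definition fun_ring :: "('a, 'b) ring_scheme \<Rightarrow> 'c set \<Rightarrow> ('c \<Rightarrow> 'a) ring" where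
  "fun_ring R \<Lambda> = \<lparr>carrier = \<Lambda> \<rightarrow>\<^sub>E carrier R, monoid.mult = (\<lambda>f g. \<lambda>x\<in>\<Lambda>. f x \<otimes>\<^bsub>R\<^esub> g x),
     one = (\<lambda>x\<in>\<Lambda>. \<one>\<^bsub>R\<^esub>), ring.zero = (\<lambda>x\<in>\<Lambda>. \<zero>\<^bsub>R\<^esub>), add = (\<lambda>f g. \<lambda>x\<in>\<Lambda>. f x \<oplus>\<^bsub>R\<^esub> g x)\<rparr>"

lemma fun_ring_simps [simp]:
  "carrier (fun_ring R \<Lambda>) = \<Lambda> \<rightarrow>\<^sub>E carrier R"
  "f \<otimes>\<^bsub>fun_ring R \<Lambda>\<^esub> g = (\<lambda>x\<in>\<Lambda>. f x \<otimes>\<^bsub>R\<^esub> g x)"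
  "f \<oplus>\<^bsub>fun_ring R \<Lambda>\<^esub> g = (\<lambda>x\<in>\<Lambda>. f x \<oplus>\<^bsub>R\<^esub> g x)"
  "\<one>\<^bsub>fun_ring R \<Lambda>\<^esub> = (\<lambda>x\<in>\<Lambda>. \<one>\<^bsub>R\<^esub>)"
  "\<zero>\<^bsub>fun_ring R \<Lambda>\<^esub> = (\<lambda>x\<in>\<Lambda>. \<zero>\<^bsub>R\<^esub>)"
  by (simp_all add: fun_ring_def)

context cring
begin

lemma fun_ring_cring: "cring (fun_ring R \<Lambda>)"
proof (rule cringI)
  show "abelian_group (fun_ring R \<Lambda>)"
  proof (rule abelian_groupI)
    fix f assume f: "f \<in> carrier (fun_ring R \<Lambda>)"
    show "\<exists>g\<in>carrier (fun_ring R \<Lambda>). g \<oplus>\<^bsub>fun_ring R \<Lambda>\<^esub> f = \<zero>\<^bsub>fun_ring R \<Lambda>\<^esub>"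
      using f by (intro bexI[of _ "\<lambda>x\<in>\<Lambda>. \<ominus> f x"]) (auto simp: PiE_iff l_neg intro!: restrict_ext)
    show "\<zero>\<^bsub>fun_ring R \<Lambda>\<^esub> \<oplus>\<^bsub>fun_ring R \<Lambda>\<^esub> f = f"
      using f by (intro PiE_ext[of _ \<Lambda> "\<lambda>_. carrier R"]) (auto simp: PiE_iff)
  qed (auto simp: PiE_iff a_ac intro!: restrict_ext)
  show "comm_monoid (fun_ring R \<Lambda>)"
  proof (rule comm_monoidI)
    fix f assume f: "f \<in> carrier (fun_ring R \<Lambda>)"
    show "\<one>\<^bsub>fun_ring R \<Lambda>\<^esub> \<otimes>\<^bsub>fun_ring R \<Lambda>\<^esub> f = f"
      using f by (intro PiE_ext[of _ \<Lambda> "\<lambda>_. carrier R"]) (auto simp: PiE_iff)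
  qed (auto simp: PiE_iff m_ac intro!: restrict_ext)
qed (auto simp: PiE_iff l_distr intro!: restrict_ext)

lemma fun_ring_finsum:
  assumes "finite E" "f \<in> E \<rightarrow> carrier (fun_ring R \<Lambda>)" "x \<in> \<Lambda>"
  shows "(\<Oplus>\<^bsub>fun_ring R \<Lambda>\<^esub>i\<in>E. f i) x = (\<Oplus>i\<in>E. f i x)"
proof -
  note am = abelian_group.axioms(1)[OF ring.axioms(1)[OF cring.axioms(1)[OF fun_ring_cring[of \<Lambda>]]]]
  show ?thesis using assms(1,2)
  proof (induction E rule: finite_induct)
    case empty
    then show ?case using assms(3) by (simp add: abelian_monoid.finsum_empty[OF am])
  next
    case (insert e E)
    have "(\<Oplus>\<^bsub>fun_ring R \<Lambda>\<^esub>i\<in>insert e E. f i) = f e \<oplus>\<^bsub>fun_ring R \<Lambda>\<^esub> (\<Oplus>\<^bsub>fun_ring R \<Lambda>\<^esub>i\<in>E. f i)"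
      using insert by (intro abelian_monoid.finsum_insert[OF am]) auto
    moreover have "(\<Oplus>i\<in>insert e E. f i x) = f e x \<oplus> (\<Oplus>i\<in>E. f i x)"
      using insert assms(3) by (intro finsum_insert) (auto simp: PiE_iff Pi_iff)
    ultimately show ?case using insert assms(3) by simp
  qed
qed

lemma poly_funs_minus:
  assumes "f \<in> poly_funs R S" "g \<in> poly_funs R S"
  shows "\<exists>h\<in>poly_funs R S. \<forall>x \<in> S \<rightarrow> carrier R. h x = f x \<ominus> g x"
proof (intro bexI ballI)
  show "(\<lambda>x. f x \<oplus> \<ominus> \<one> \<otimes> g x) \<in> poly_funs R S" using assms by (intro poly_funs.intros) auto
  fix x assume "x \<in> S \<rightarrow> carrier R"
  then show "f x \<oplus> \<ominus> \<one> \<otimes> g x = f x \<ominus> g x"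
    using poly_funs_closed[OF assms(1)] poly_funs_closed[OF assms(2)] by (simp add: a_minus_def l_minus)
qed

end

text \<open>The product of \<open>N\<close> with the module spanned by the \<open>g i\<close>, where
  \<open>N\<close> is the prime of polynomial functions whose value at \<open>L0\<close> lies in
  \<open>m\<close>. These are the terms that Nakayama's lemma may discard.\<close>

definition vanishing_combs ::
    "('a, 'b) ring_scheme \<Rightarrow> 'a set \<Rightarrow> 'i set \<Rightarrow> ('i \<Rightarrow> 'a) \<Rightarrow> 'e set \<Rightarrow> ('e \<Rightarrow> 'a) \<Rightarrow> (('i \<Rightarrow> 'a) \<Rightarrow> 'a) set" where
  "vanishing_combs R m S L0 E g = {k. \<exists>n. (\<forall>i\<in>E. n i \<in> poly_funs R S \<and> n i L0 \<in> m) \<and>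
     (\<forall>L \<in> S \<rightarrow> carrier R. k L = (\<Oplus>\<^bsub>R\<^esub>i\<in>E. n i L \<otimes>\<^bsub>R\<^esub> g i))}"

context noetherian_local_cring
begin

lemma vanishing_combs_add:
  assumes k: "k \<in> vanishing_combs R m S L0 E g" "k' \<in> vanishing_combs R m S L0 E g"
    and g: "g \<in> E \<rightarrow> carrier R"
    and eq: "\<And>L. L \<in> S \<rightarrow> carrier R \<Longrightarrow> k'' L = k L \<oplus> k' L"
  shows "k'' \<in> vanishing_combs R m S L0 E g"
proof -
  obtain n n' where n: "\<And>i. i \<in> E \<Longrightarrow> n i \<in> poly_funs R S" "\<And>i. i \<in> E \<Longrightarrow> n i L0 \<in> m"
      "\<And>L. L \<in> S \<rightarrow> carrier R \<Longrightarrow> k L = (\<Oplus>i\<in>E. n i L \<otimes> g i)"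
    and n': "\<And>i. i \<in> E \<Longrightarrow> n' i \<in> poly_funs R S" "\<And>i. i \<in> E \<Longrightarrow> n' i L0 \<in> m"
      "\<And>L. L \<in> S \<rightarrow> carrier R \<Longrightarrow> k' L = (\<Oplus>i\<in>E. n' i L \<otimes> g i)"
    using k unfolding vanishing_combs_def by blast
  have "k'' L = (\<Oplus>i\<in>E. (n i L \<oplus> n' i L) \<otimes> g i)" if L: "L \<in> S \<rightarrow> carrier R" for L
  proof -
    have c: "n i L \<in> carrier R" "n' i L \<in> carrier R" "g i \<in> carrier R" if "i \<in> E" for i
      using poly_funs_closed[OF n(1) L] poly_funs_closed[OF n'(1) L] g that by auto
    have "k'' L = (\<Oplus>i\<in>E. n i L \<otimes> g i \<oplus> n' i L \<otimes> g i)"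
      unfolding eq[OF L] n(3)[OF L] n'(3)[OF L] using c by (intro finsum_addf[symmetric]) auto
    also have "\<dots> = (\<Oplus>i\<in>E. (n i L \<oplus> n' i L) \<otimes> g i)"
      using c by (intro finsum_cong') (auto simp: l_distr)
    finally show ?thesis .
  qed
  then show ?thesis unfolding vanishing_combs_def
    using n n' ideal_closed(2)[OF m_ideal]
    by (intro CollectI exI[of _ "\<lambda>i L. n i L \<oplus> n' i L"]) (auto intro: poly_funs.add)
qed

lemma vanishing_combs_base:
  assumes E: "finite E" "g \<in> E \<rightarrow> carrier R" and c: "c \<in> Idl (g ` E)"
    and p: "p \<in> poly_funs R S" "p L0 \<in> m"
    and eq: "\<And>L. L \<in> S \<rightarrow> carrier R \<Longrightarrow> k L = p L \<otimes> c"
  shows "k \<in> vanishing_combs R m S L0 E g"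
proof -
  obtain b where b: "b \<in> E \<rightarrow> carrier R" "c = (\<Oplus>i\<in>E. b i \<otimes> g i)" using c Idl_image[OF E] by auto
  have "k L = (\<Oplus>i\<in>E. (p L \<otimes> b i) \<otimes> g i)" if L: "L \<in> S \<rightarrow> carrier R" for L
  proof -
    note pc = poly_funs_closed[OF p(1) L]
    have "k L = (\<Oplus>i\<in>E. p L \<otimes> (b i \<otimes> g i))"
      unfolding eq[OF L] b(2) using pc b E by (intro finsum_rdistr) (auto simp: Pi_iff)
    also have "\<dots> = (\<Oplus>i\<in>E. (p L \<otimes> b i) \<otimes> g i)"
      using pc b E by (intro finsum_cong') (auto simp: Pi_iff m_assoc)
    finally show ?thesis .
  qed
  then show ?thesis unfolding vanishing_combs_def
    using p b ideal_closed(6)[OF m_ideal]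
    by (intro CollectI exI[of _ "\<lambda>i L. p L \<otimes> b i"])
      (auto intro!: poly_funs.mult poly_funs.const simp: Pi_iff)
qed

text \<open>Nakayama's lemma over the ring of polynomial functions, localized at the functions that are
  units at \<open>L0\<close>. The ideals \<open>M L\<close> may vary arbitrarily with \<open>L\<close>.\<close>

lemma poly_nakayama:
  assumes L0: "L0 \<in> S \<rightarrow> carrier R" and w: "w \<in> carrier R"
    and M: "\<And>L. L \<in> S \<rightarrow> carrier R \<Longrightarrow> ideal (M L) R"
    and E: "finite E" "g \<in> E \<rightarrow> carrier R"
    and step: "\<And>e. e \<in> E \<Longrightarrow> \<exists>u\<in>poly_funs R S. u L0 \<notin> m \<and> (\<exists>s\<in>poly_funs R S.
      \<exists>k\<in>vanishing_combs R m S L0 E g. \<forall>L \<in> S \<rightarrow> carrier R. u L \<otimes> g e \<ominus> (s L \<otimes> w \<oplus> k L) \<in> M L)"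
  shows "\<exists>u\<in>poly_funs R S. u L0 \<notin> m \<and>
    (\<forall>e\<in>E. \<exists>s\<in>poly_funs R S. \<forall>L \<in> S \<rightarrow> carrier R. u L \<otimes> g e \<ominus> s L \<otimes> w \<in> M L)"
proof -
  define \<Lambda> where "\<Lambda> = S \<rightarrow> carrier R"
  define F where "F = fun_ring R \<Lambda>"
  have F: "cring F" unfolding F_def by (rule fun_ring_cring)
  then have ringF: "ring F" by (rule cring.axioms)
  have carF: "carrier F = \<Lambda> \<rightarrow>\<^sub>E carrier R" by (simp add: F_def)
  have pc: "f L \<in> carrier R" if "f \<in> poly_funs R S" "L \<in> \<Lambda>" for f L
    using that poly_funs_closed by (auto simp: \<Lambda>_def)
  have L0': "L0 \<in> \<Lambda>" using L0 by (simp add: \<Lambda>_def)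
  \<comment> \<open>\<open>A\<close> is the ring of polynomial functions, \<open>N\<close> its prime
    at \<open>L0\<close>, and \<open>H\<close> consists of the functions that for every
    \<open>L\<close> are congruent modulo \<open>M L\<close> to a polynomial multiple of
    \<open>w\<close>. \<open>H\<close> is closed under addition and under multiplication by
    \<open>A\<close> although the ideals \<open>M L\<close> are unrelated to each other.\<close>
  define A where "A = (\<lambda>f. restrict f \<Lambda>) ` poly_funs R S"
  define N where "N = {f \<in> A. f L0 \<in> m}"
  define H where "H = {h \<in> carrier F. \<exists>s\<in>poly_funs R S. \<forall>L\<in>\<Lambda>. h L \<ominus> s L \<otimes> w \<in> M L}"
  define g' where "g' e = (\<lambda>L\<in>\<Lambda>. g e)" for e
  have AF: "A \<subseteq> carrier F" using pc by (auto simp: A_def carF)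
  have Aadd: "(\<lambda>L\<in>\<Lambda>. f L \<oplus> h L) \<in> A" and Amult: "(\<lambda>L\<in>\<Lambda>. f L \<otimes> h L) \<in> A" if "f \<in> A" "h \<in> A" for f h
  proof -
    obtain f' h' where fh: "f' \<in> poly_funs R S" "h' \<in> poly_funs R S" "f = restrict f' \<Lambda>" "h = restrict h' \<Lambda>"
      using \<open>f \<in> A\<close> \<open>h \<in> A\<close> by (auto simp: A_def)
    show "(\<lambda>L\<in>\<Lambda>. f L \<oplus> h L) \<in> A" unfolding A_def
      by (intro image_eqI[of _ _ "\<lambda>L. f' L \<oplus> h' L"] poly_funs.add fh) (auto simp: fh intro!: restrict_ext)
    show "(\<lambda>L\<in>\<Lambda>. f L \<otimes> h L) \<in> A" unfolding A_def
      by (intro image_eqI[of _ _ "\<lambda>L. f' L \<otimes> h' L"] poly_funs.mult fh) (auto simp: fh intro!: restrict_ext)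
  qed
  have Aconst: "(\<lambda>L\<in>\<Lambda>. c) \<in> A" if "c \<in> carrier R" for c
    using that by (auto simp: A_def intro: poly_funs.const)
  have "subring A F"
  proof (rule ring.subringI[OF ringF AF])
    show "\<one>\<^bsub>F\<^esub> \<in> A" unfolding F_def using Aconst by simp
    show "f \<otimes>\<^bsub>F\<^esub> h \<in> A" "f \<oplus>\<^bsub>F\<^esub> h \<in> A" if "f \<in> A" "h \<in> A" for f h
      unfolding F_def using Aadd Amult that by auto
    fix f assume f: "f \<in> A"
    define f' where "f' = (\<lambda>L\<in>\<Lambda>. (\<lambda>L\<in>\<Lambda>. \<ominus> \<one>) L \<otimes> f L)"
    have f': "f' \<in> A" unfolding f'_def using f by (intro Amult Aconst) auto
    have fc: "f L \<in> carrier R" if "L \<in> \<Lambda>" for L using f AF that by (auto simp: carF PiE_iff)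
    have "f' \<oplus>\<^bsub>F\<^esub> f = \<zero>\<^bsub>F\<^esub>"
      unfolding F_def using fc by (auto simp: f'_def l_minus l_neg intro!: restrict_ext)
    then have "\<ominus>\<^bsub>F\<^esub> f = f'"
      using f f' AF by (intro abelian_group.minus_equality[OF ring.axioms(1)[OF ringF]]) auto
    then show "\<ominus>\<^bsub>F\<^esub> f \<in> A" using f' by simp
  qed
  moreover have "\<exists>u\<in>A - N. \<exists>n\<in>E \<rightarrow> N. \<exists>h\<in>H. u \<otimes>\<^bsub>F\<^esub> g' e = h \<oplus>\<^bsub>F\<^esub> (\<Oplus>\<^bsub>F\<^esub>i\<in>E. n i \<otimes>\<^bsub>F\<^esub> g' i)"
    if e: "e \<in> E" for e
  proof -
    obtain u s k where u: "u \<in> poly_funs R S" "u L0 \<notin> m" "s \<in> poly_funs R S"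
      and k: "k \<in> vanishing_combs R m S L0 E g"
      and mem: "\<And>L. L \<in> \<Lambda> \<Longrightarrow> u L \<otimes> g e \<ominus> (s L \<otimes> w \<oplus> k L) \<in> M L"
      using step[OF e] unfolding \<Lambda>_def by blast
    obtain n where n: "\<And>i. i \<in> E \<Longrightarrow> n i \<in> poly_funs R S" "\<And>i. i \<in> E \<Longrightarrow> n i L0 \<in> m"
      "\<And>L. L \<in> \<Lambda> \<Longrightarrow> k L = (\<Oplus>i\<in>E. n i L \<otimes> g i)"
      using k unfolding vanishing_combs_def \<Lambda>_def by blast
    have gc: "g i \<in> carrier R" if "i \<in> E" for i using E that by auto
    have kc: "k L \<in> carrier R" if "L \<in> \<Lambda>" for L
      unfolding n(3)[OF that] using pc[OF n(1) that] gc by (intro finsum_closed) auto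
    \<comment> \<open>Moving \<open>k L\<close> to the other side turns the hypothesis into a
      relation of the kind required by \<open>nakayama_denominators\<close>, with \<open>h\<close>
      as the element of \<open>H\<close>.\<close>
    define h where "h = (\<lambda>L\<in>\<Lambda>. u L \<otimes> g e \<ominus> k L)"
    have hF: "h \<in> carrier F" unfolding carF h_def using pc[OF u(1)] gc[OF e] kc by auto
    have "h L \<ominus> s L \<otimes> w \<in> M L" if L: "L \<in> \<Lambda>" for L
    proof -
      have "h L \<ominus> s L \<otimes> w = u L \<otimes> g e \<ominus> (s L \<otimes> w \<oplus> k L)"
        using L pc[OF u(1) L] pc[OF u(3) L] gc[OF e] kc[OF L] w unfolding h_def restrict_apply'[OF L] by algebra
      then show ?thesis using mem[OF L] by simp
    qed
    then have hH: "h \<in> H" using hF u(3) by (auto simp: H_def)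
    define n' where "n' i = restrict (n i) \<Lambda>" for i
    have n': "n' \<in> E \<rightarrow> N" using n L0' by (auto simp: n'_def N_def A_def)
    have n'F: "n' i \<otimes>\<^bsub>F\<^esub> g' i \<in> carrier F" if "i \<in> E" for i
      using pc[OF n(1)[OF that]] gc[OF that] by (auto simp: F_def n'_def g'_def)
    have sumF: "(\<Oplus>\<^bsub>F\<^esub>i\<in>E. n' i \<otimes>\<^bsub>F\<^esub> g' i) \<in> carrier F"
      using n'F by (intro abelian_monoid.finsum_closed abelian_group.axioms(1) ring.axioms(1) ringF) auto
    have "restrict u \<Lambda> \<otimes>\<^bsub>F\<^esub> g' e = h \<oplus>\<^bsub>F\<^esub> (\<Oplus>\<^bsub>F\<^esub>i\<in>E. n' i \<otimes>\<^bsub>F\<^esub> g' i)"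
    proof (rule PiE_ext[of _ \<Lambda> "\<lambda>_. carrier R"])
      show "restrict u \<Lambda> \<otimes>\<^bsub>F\<^esub> g' e \<in> \<Lambda> \<rightarrow>\<^sub>E carrier R"
        using pc[OF u(1)] gc[OF e] by (auto simp: F_def g'_def)
      show "h \<oplus>\<^bsub>F\<^esub> (\<Oplus>\<^bsub>F\<^esub>i\<in>E. n' i \<otimes>\<^bsub>F\<^esub> g' i) \<in> \<Lambda> \<rightarrow>\<^sub>E carrier R"
        unfolding carF[symmetric] by (rule abelian_monoid.a_closed[OF abelian_group.axioms(1)[OF ring.axioms(1)[OF ringF]] hF sumF])
      fix L assume L: "L \<in> \<Lambda>"
      have "(\<Oplus>\<^bsub>F\<^esub>i\<in>E. n' i \<otimes>\<^bsub>F\<^esub> g' i) L = (\<Oplus>i\<in>E. (n' i \<otimes>\<^bsub>F\<^esub> g' i) L)"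
        unfolding F_def using n'F[unfolded F_def] by (intro fun_ring_finsum E L) auto
      also have "\<dots> = (\<Oplus>i\<in>E. n i L \<otimes> g i)"
        using L pc[OF n(1) L] gc by (intro finsum_cong') (auto simp: F_def n'_def g'_def)
      finally have sum: "(\<Oplus>\<^bsub>F\<^esub>i\<in>E. n' i \<otimes>\<^bsub>F\<^esub> g' i) L = k L" using n(3)[OF L] by simp
      have "(h \<oplus>\<^bsub>F\<^esub> (\<Oplus>\<^bsub>F\<^esub>i\<in>E. n' i \<otimes>\<^bsub>F\<^esub> g' i)) L = h L \<oplus> k L"
        using sum L by (simp add: F_def)
      also have "\<dots> = u L \<otimes> g e"
        unfolding h_def restrict_apply'[OF L] using pc[OF u(1) L] gc[OF e] kc[OF L] by algebra
      finally show "(restrict u \<Lambda> \<otimes>\<^bsub>F\<^esub> g' e) L = (h \<oplus>\<^bsub>F\<^esub> (\<Oplus>\<^bsub>F\<^esub>i\<in>E. n' i \<otimes>\<^bsub>F\<^esub> g' i)) L"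
        using L by (simp add: F_def g'_def)
    qed
    moreover have "restrict u \<Lambda> \<in> A - N" using u L0' by (auto simp: A_def N_def)
    ultimately show ?thesis using hH n' by blast
  qed
  moreover have "N \<subseteq> A" by (auto simp: N_def)
  moreover have "a \<otimes>\<^bsub>F\<^esub> n \<in> N" if "a \<in> A" "n \<in> N" for a n
  proof -
    have "a L0 \<in> carrier R" using that(1) AF L0' by (auto simp: carF PiE_iff)
    then show ?thesis using that Amult L0' ideal_closed(5)[OF m_ideal] by (auto simp: N_def F_def)
  qed
  moreover have "a \<oplus>\<^bsub>F\<^esub> b \<in> N" if "a \<in> N" "b \<in> N" for a b
    using that Aadd L0' ideal_closed(2)[OF m_ideal] by (auto simp: N_def F_def)
  moreover have "\<one>\<^bsub>F\<^esub> \<notin> N" using L0' one_notin_m by (auto simp: N_def F_def)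
  moreover have "a \<otimes>\<^bsub>F\<^esub> b \<notin> N" if "a \<in> A - N" "b \<in> A - N" for a b
  proof -
    have "a L0 \<in> carrier R" "b L0 \<in> carrier R" using that AF L0' by (auto simp: carF PiE_iff)
    then show ?thesis using that L0' primeideal.I_prime[OF m_prime] by (auto simp: N_def F_def)
  qed
  moreover have "H \<subseteq> carrier F" by (auto simp: H_def)
  moreover have "\<zero>\<^bsub>F\<^esub> \<in> H"
  proof -
    have "\<zero> \<ominus> \<zero> \<otimes> w \<in> M L" if "L \<in> \<Lambda>" for L
      using ideal_closed(1)[OF M] that w by (simp add: \<Lambda>_def a_minus_def)
    then show ?thesis unfolding H_def F_def
      by (auto intro!: bexI[of _ "\<lambda>_. \<zero>"] poly_funs.const)
  qed
  moreover have "a \<oplus>\<^bsub>F\<^esub> b \<in> H" if ab: "a \<in> H" "b \<in> H" for a b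
  proof -
    obtain s t where s: "s \<in> poly_funs R S" "\<And>L. L \<in> \<Lambda> \<Longrightarrow> a L \<ominus> s L \<otimes> w \<in> M L"
      and t: "t \<in> poly_funs R S" "\<And>L. L \<in> \<Lambda> \<Longrightarrow> b L \<ominus> t L \<otimes> w \<in> M L"
      and c: "a \<in> \<Lambda> \<rightarrow>\<^sub>E carrier R" "b \<in> \<Lambda> \<rightarrow>\<^sub>E carrier R"
      using ab unfolding H_def carF by blast
    have "(a L \<oplus> b L) \<ominus> (s L \<oplus> t L) \<otimes> w \<in> M L" if L: "L \<in> \<Lambda>" for L
    proof -
      have cc: "a L \<in> carrier R" "b L \<in> carrier R" using c L by auto
      have "(a L \<oplus> b L) \<ominus> (s L \<oplus> t L) \<otimes> w = (a L \<ominus> s L \<otimes> w) \<oplus> (b L \<ominus> t L \<otimes> w)"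
        using cc pc[OF s(1) L] pc[OF t(1) L] w by algebra
      then show ?thesis using ideal_closed(2)[OF M] s t L by (simp add: \<Lambda>_def)
    qed
    then show ?thesis unfolding H_def carF using c poly_funs.add[OF s(1) t(1)]
      by (auto simp: F_def PiE_iff intro!: bexI[of _ "\<lambda>L. s L \<oplus> t L"])
  qed
  moreover have "a \<otimes>\<^bsub>F\<^esub> b \<in> H" if ab: "a \<in> A" "b \<in> H" for a b
  proof -
    obtain t where t: "t \<in> poly_funs R S" "\<And>L. L \<in> \<Lambda> \<Longrightarrow> b L \<ominus> t L \<otimes> w \<in> M L"
      and c: "b \<in> \<Lambda> \<rightarrow>\<^sub>E carrier R"
      using ab unfolding H_def carF by blast
    obtain s where s: "s \<in> poly_funs R S" "a = restrict s \<Lambda>" using ab by (auto simp: A_def)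
    have "s L \<otimes> b L \<ominus> (s L \<otimes> t L) \<otimes> w \<in> M L" if L: "L \<in> \<Lambda>" for L
    proof -
      have cc: "b L \<in> carrier R" using c L by auto
      have "s L \<otimes> b L \<ominus> (s L \<otimes> t L) \<otimes> w = s L \<otimes> (b L \<ominus> t L \<otimes> w)"
        using cc pc[OF s(1) L] pc[OF t(1) L] w by algebra
      then show ?thesis using ideal_closed(5)[OF M] t L pc[OF s(1) L] by (simp add: \<Lambda>_def)
    qed
    then show ?thesis unfolding H_def carF using c pc[OF s(1)] poly_funs.mult[OF s(1) t(1)]
      by (auto simp: F_def s(2) PiE_iff intro!: bexI[of _ "\<lambda>L. s L \<otimes> t L"])
  qed
  moreover have "g' \<in> E \<rightarrow> carrier F" using E by (auto simp: g'_def F_def)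
  ultimately have "\<exists>u\<in>A - N. \<forall>e\<in>E. u \<otimes>\<^bsub>F\<^esub> g' e \<in> H"
    by (intro cring.nakayama_denominators[OF F, of A N H E g'] E(1))
  then obtain u' where u': "u' \<in> A - N" "\<And>e. e \<in> E \<Longrightarrow> u' \<otimes>\<^bsub>F\<^esub> g' e \<in> H" by blast
  obtain u where u: "u \<in> poly_funs R S" "u' = restrict u \<Lambda>" using u' by (auto simp: A_def)
  have "u L0 \<notin> m" using u' u L0' by (auto simp: N_def)
  moreover have "\<exists>s\<in>poly_funs R S. \<forall>L\<in>\<Lambda>. u L \<otimes> g e \<ominus> s L \<otimes> w \<in> M L" if "e \<in> E" for e
    using u'(2)[OF that] by (auto simp: H_def u(2) F_def g'_def)
  ultimately show ?thesis using u(1) unfolding \<Lambda>_def by blast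
qed

end

definition lin_comb :: "('a, 'b) ring_scheme \<Rightarrow> 'a list \<Rightarrow> (nat \<times> nat \<Rightarrow> 'a) \<Rightarrow> nat \<Rightarrow> 'a" where
  "lin_comb R as L i = (\<Oplus>\<^bsub>R\<^esub>j\<in>{..<length as}. L (i, j) \<otimes>\<^bsub>R\<^esub> as ! j)"

text \<open>The error terms that arise when \<open>J L0\<close> is replaced by \<open>J L\<close>:
  elements of \<open>C\<close> with coefficients \<open>L0 s - L s\<close>, which vanish at
  \<open>L0\<close>.\<close>

inductive_set diff_sums ::
    "('a, 'b) ring_scheme \<Rightarrow> 'i set \<Rightarrow> ('i \<Rightarrow> 'a) \<Rightarrow> 'a set \<Rightarrow> (('i \<Rightarrow> 'a) \<Rightarrow> 'a) set"
  for R and S and L0 and C where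
  zero: "(\<lambda>_. \<zero>\<^bsub>R\<^esub>) \<in> diff_sums R S L0 C"
| base: "s \<in> S \<Longrightarrow> c \<in> C \<Longrightarrow> (\<lambda>L. (L0 s \<ominus>\<^bsub>R\<^esub> L s) \<otimes>\<^bsub>R\<^esub> c) \<in> diff_sums R S L0 C"
| add: "k \<in> diff_sums R S L0 C \<Longrightarrow> k' \<in> diff_sums R S L0 C \<Longrightarrow>
    (\<lambda>L. k L \<oplus>\<^bsub>R\<^esub> k' L) \<in> diff_sums R S L0 C"

lemma (in ring) diff_sums_closed:
  assumes "k \<in> diff_sums R S L0 C" "C \<subseteq> carrier R" "L0 \<in> S \<rightarrow> carrier R" "L \<in> S \<rightarrow> carrier R"
  shows "k L \<in> carrier R"
  using assms by induction (auto simp: Pi_iff)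

lemma (in cring) monomial_poly_funs:
  assumes "finite G" "G \<subseteq> S"
  shows "\<exists>h\<in>poly_funs R S. \<forall>L \<in> S \<rightarrow> carrier R. h L = monomial R G \<alpha> L"
  using assms
proof (induction G rule: finite_induct)
  case empty
  then show ?case by (intro bexI[of _ "\<lambda>_. \<one>"] poly_funs.const) (auto simp: monomial_def)
next
  case (insert s G)
  then obtain h where h: "h \<in> poly_funs R S" "\<forall>L \<in> S \<rightarrow> carrier R. h L = monomial R G \<alpha> L" by auto
  have "\<exists>p\<in>poly_funs R S. \<forall>L \<in> S \<rightarrow> carrier R. p L = L s [^] (k::nat)" for k
  proof (induction k)
    case 0
    then show ?case by (intro bexI[of _ "\<lambda>_. \<one>"] poly_funs.const) auto
  next
    case (Suc k)
    then obtain p where "p \<in> poly_funs R S" "\<forall>L \<in> S \<rightarrow> carrier R. p L = L s [^] k" by auto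
    then show ?case using insert.prems
      by (intro bexI[of _ "\<lambda>L. p L \<otimes> L s"] poly_funs.mult poly_funs.var) auto
  qed
  then obtain p where p: "p \<in> poly_funs R S" "\<forall>L \<in> S \<rightarrow> carrier R. p L = L s [^] \<alpha> s" by blast
  have "monomial R (insert s G) \<alpha> L = L s [^] \<alpha> s \<otimes> monomial R G \<alpha> L" if "L \<in> S \<rightarrow> carrier R" for L
    using that insert by (intro monomial_insert) auto
  then show ?case using p h by (intro bexI[of _ "\<lambda>L. p L \<otimes> h L"] poly_funs.mult) auto
qed

context noetherian_local_cring
begin

lemma diff_sums_vanishing:
  assumes "k \<in> diff_sums R S L0 C" and C: "C \<subseteq> Idl (g ` E)" and E: "finite E" "g \<in> E \<rightarrow> carrier R"
    and L0: "L0 \<in> S \<rightarrow> carrier R"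
  shows "k \<in> vanishing_combs R m S L0 E g"
  using assms(1)
proof induction
  case zero
  have gc: "g ` E \<subseteq> carrier R" using E by auto
  then have "\<zero> \<in> Idl (g ` E)" using ideal_closed(1)[OF genideal_ideal] by auto
  then show ?case
    using ideal_closed(1)[OF m_ideal]
    by (intro vanishing_combs_base[OF E, of \<zero> "\<lambda>_. \<zero>"] poly_funs.const) auto
next
  case (base s c)
  obtain h where h: "h \<in> poly_funs R S" "\<And>L. L \<in> S \<rightarrow> carrier R \<Longrightarrow> h L = L0 s \<ominus> L s"
    using poly_funs_minus[of "\<lambda>_. L0 s" S "\<lambda>L. L s"] base L0 by (blast intro: poly_funs.intros)
  have "h L0 = \<zero>" using h(2)[OF L0] funcset_mem[OF L0 base(1)] by (simp add: a_minus_def r_neg)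
  then show ?case
    using h base C ideal_closed(1)[OF m_ideal] by (intro vanishing_combs_base[OF E, of c h]) auto
next
  case (add k k')
  then show ?case by (intro vanishing_combs_add[OF add.IH E(2)]) auto
qed

text \<open>For a polynomial function \<open>p\<close> with coefficients \<open>C \<alpha>\<close>,
  the difference \<open>p L - p L0\<close> is a combination of the \<open>C \<alpha>\<close> with
  factors that vanish at \<open>L0\<close>. It is applied with generators of \<open>m\<close>, once
  the coefficients are known to lie in \<open>m\<close>.\<close>

lemma vanishing_combs_of_m_coeffs:
  assumes S: "finite S" and G: "finite G" "\<And>\<alpha>. \<alpha> \<in> G \<Longrightarrow> C \<alpha> \<in> Idl (g ` E)"
    and E: "finite E" "g \<in> E \<rightarrow> carrier R" and L0: "L0 \<in> S \<rightarrow> carrier R"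
  shows "(\<lambda>L. (\<Oplus>\<alpha>\<in>G. C \<alpha> \<otimes> monomial R S \<alpha> L) \<ominus> (\<Oplus>\<alpha>\<in>G. C \<alpha> \<otimes> monomial R S \<alpha> L0))
    \<in> vanishing_combs R m S L0 E g"
  using G
proof (induction G rule: finite_induct)
  case empty
  have gc: "g ` E \<subseteq> carrier R" using E by auto
  then have "\<zero> \<in> Idl (g ` E)" using ideal_closed(1)[OF genideal_ideal] by auto
  then show ?case
    using ideal_closed(1)[OF m_ideal]
    by (intro vanishing_combs_base[OF E, of \<zero> "\<lambda>_. \<zero>"] poly_funs.const) (auto simp: a_minus_def)
next
  case (insert \<beta> G)
  have gc: "g ` E \<subseteq> carrier R" using E by auto
  have Cc: "C \<alpha> \<in> carrier R" if "\<alpha> \<in> insert \<beta> G" for \<alpha>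
    using insert.prems[OF that] ideal_closed(7)[OF genideal_ideal[OF gc]] by auto
  obtain h0 where h0: "h0 \<in> poly_funs R S" "\<And>L. L \<in> S \<rightarrow> carrier R \<Longrightarrow> h0 L = monomial R S \<beta> L"
    using monomial_poly_funs[OF S subset_refl] by blast
  have L0c: "monomial R S \<beta> L0 \<in> carrier R" using L0 by auto
  then obtain h where h: "h \<in> poly_funs R S"
    "\<And>L. L \<in> S \<rightarrow> carrier R \<Longrightarrow> h L = h0 L \<ominus> monomial R S \<beta> L0"
    using poly_funs_minus[OF h0(1), of "\<lambda>_. monomial R S \<beta> L0"] by (blast intro: poly_funs.const)
  have hL0: "h L0 \<in> m" using h(2)[OF L0] h0(2)[OF L0] L0c ideal_closed(1)[OF m_ideal]
    by (simp add: a_minus_def r_neg)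
  have base: "(\<lambda>L. h L \<otimes> C \<beta>) \<in> vanishing_combs R m S L0 E g"
    by (rule vanishing_combs_base[OF E insert.prems h(1) hL0]) auto
  have IH: "(\<lambda>L. (\<Oplus>\<alpha>\<in>G. C \<alpha> \<otimes> monomial R S \<alpha> L) \<ominus> (\<Oplus>\<alpha>\<in>G. C \<alpha> \<otimes> monomial R S \<alpha> L0))
    \<in> vanishing_combs R m S L0 E g" using insert by auto
  show ?case
  proof (rule vanishing_combs_add[OF base IH E(2)])
    fix L assume L: "L \<in> S \<rightarrow> carrier R"
    define a b where "a = (\<Oplus>\<alpha>\<in>G. C \<alpha> \<otimes> monomial R S \<alpha> L)" and "b = (\<Oplus>\<alpha>\<in>G. C \<alpha> \<otimes> monomial R S \<alpha> L0)"
    have ab: "a \<in> carrier R" "b \<in> carrier R"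
      unfolding a_def b_def using Cc L L0 by (auto intro!: finsum_closed)
    have "(\<Oplus>\<alpha>\<in>insert \<beta> G. C \<alpha> \<otimes> monomial R S \<alpha> L) = C \<beta> \<otimes> monomial R S \<beta> L \<oplus> a"
      "(\<Oplus>\<alpha>\<in>insert \<beta> G. C \<alpha> \<otimes> monomial R S \<alpha> L0) = C \<beta> \<otimes> monomial R S \<beta> L0 \<oplus> b"
      unfolding a_def b_def using insert.hyps Cc L L0 by (auto intro!: finsum_insert)
    moreover have "(C \<beta> \<otimes> monomial R S \<beta> L \<oplus> a) \<ominus> (C \<beta> \<otimes> monomial R S \<beta> L0 \<oplus> b)
      = h L \<otimes> C \<beta> \<oplus> (a \<ominus> b)"
      unfolding h(2)[OF L] h0(2)[OF L]
      using ab Cc[of \<beta>] L0c monomial_closed[OF L, of \<beta>] by (simp, algebra)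
    ultimately show "(\<Oplus>\<alpha>\<in>insert \<beta> G. C \<alpha> \<otimes> monomial R S \<alpha> L) \<ominus> (\<Oplus>\<alpha>\<in>insert \<beta> G. C \<alpha> \<otimes> monomial R S \<alpha> L0)
      = h L \<otimes> C \<beta> \<oplus> ((\<Oplus>\<alpha>\<in>G. C \<alpha> \<otimes> monomial R S \<alpha> L) \<ominus> (\<Oplus>\<alpha>\<in>G. C \<alpha> \<otimes> monomial R S \<alpha> L0))"
      unfolding a_def b_def by simp
  qed
qed

end

section \<open>The family of ideals \<open>J L\<close> and openness of the conditions on
  \<open>L\<close>\<close>

locale reduction_family = infinite_residue_local_cring R m for R (structure) and m +
  fixes as :: "'a list" and d :: nat
  assumes as_carrier: "set as \<subseteq> carrier R"
begin

definition idx :: "(nat \<times> nat) set" where "idx = {..<d} \<times> {..<length as}"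
definition I :: "'a set" where "I = Idl (set as)"
definition J :: "(nat \<times> nat \<Rightarrow> 'a) \<Rightarrow> 'a set" where "J L = Idl (lin_comb R as L ` {..<d})"

lemma finite_idx: "finite idx"
  by (simp add: idx_def)

lemma I_ideal: "ideal I R"
  unfolding I_def by (rule genideal_ideal[OF as_carrier])

lemma as_I: "j < length as \<Longrightarrow> as ! j \<in> I"
  unfolding I_def using genideal_self[OF as_carrier] nth_mem by auto

lemma lin_comb_I:
  assumes "L \<in> idx \<rightarrow> carrier R" "i < d"
  shows "lin_comb R as L i \<in> I"
  unfolding lin_comb_def using assms
  by (intro finsum_in_ideal[OF I_ideal]) (auto simp: idx_def intro!: ideal_closed(5)[OF I_ideal] as_I)

lemma lin_comb_closed:
  "L \<in> idx \<rightarrow> carrier R \<Longrightarrow> lin_comb R as L ` {..<d} \<subseteq> carrier R"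
  using lin_comb_I ideal_closed(7)[OF I_ideal] by auto

lemma J_ideal: "L \<in> idx \<rightarrow> carrier R \<Longrightarrow> ideal (J L) R"
  unfolding J_def by (intro genideal_ideal lin_comb_closed)

lemma J_I: "L \<in> idx \<rightarrow> carrier R \<Longrightarrow> J L \<subseteq> I"
  unfolding J_def using lin_comb_I by (intro Idl_least[OF I_ideal]) auto

text \<open>\<open>y\<close> is a sum of terms \<open>b i x_i(L0)\<close> with \<open>b i\<close> in
  \<open>B\<close>. Exchanging \<open>x_i(L0)\<close> for \<open>x_i(L)\<close> costs terms
  \<open>(L0 (i, j) - L (i, j)) a_j b i\<close>. A single function \<open>k\<close> serves all
  \<open>L\<close>, so the error is polynomial in \<open>L\<close>.\<close>

lemma diff_expand:
  assumes L0: "L0 \<in> idx \<rightarrow> carrier R" and B: "ideal B R" and y: "y \<in> J L0 \<cdot> B"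
  shows "\<exists>k\<in>diff_sums R idx L0 (I \<cdot> B). \<forall>L \<in> idx \<rightarrow> carrier R. y \<ominus> k L \<in> J L \<cdot> B"
proof -
  have IB: "I \<cdot> B \<subseteq> carrier R" by (rule ideal_prod_in_carrier[OF I_ideal B])
  have "y \<in> B \<cdot> (Idl (lin_comb R as L0 ` {..<d}))"
    using y ideal_prod_commute[OF J_ideal[OF L0] B] by (simp add: J_def)
  then obtain b where b: "b \<in> {..<d} \<rightarrow> B" "y = (\<Oplus>i\<in>{..<d}. b i \<otimes> lin_comb R as L0 i)"
    using mem_ideal_prod_Idl[OF B, of "{..<d}" "lin_comb R as L0"] lin_comb_closed[OF L0] by blast
  have bc: "b i \<in> carrier R" if "i < d" for i using b that ideal_closed(7)[OF B] by auto
  have lc: "lin_comb R as L i \<in> carrier R" if "L \<in> idx \<rightarrow> carrier R" "i < d" for L i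
    using lin_comb_closed[OF that(1)] that(2) by auto
  have one: "\<exists>k\<in>diff_sums R idx L0 (I \<cdot> B). \<forall>L \<in> idx \<rightarrow> carrier R.
      b i \<otimes> lin_comb R as L0 i = b i \<otimes> lin_comb R as L i \<oplus> k L" if i: "i < d" for i
  proof -
    define P where "P G L = (\<Oplus>j\<in>G. L (i, j) \<otimes> as ! j)" for G L
    have Lc: "L (i, j) \<in> carrier R" if "L \<in> idx \<rightarrow> carrier R" "j < length as" for L j
      using that i by (auto simp: idx_def)
    have ac: "as ! j \<in> carrier R" if "j < length as" for j using as_I[OF that] ideal_closed(7)[OF I_ideal] by auto
    have Pc: "P G L \<in> carrier R" if "L \<in> idx \<rightarrow> carrier R" "G \<subseteq> {..<length as}" for G L
      unfolding P_def using that Lc ac by (intro finsum_closed) auto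
    have "\<exists>k\<in>diff_sums R idx L0 (I \<cdot> B). \<forall>L \<in> idx \<rightarrow> carrier R. b i \<otimes> P G L0 = b i \<otimes> P G L \<oplus> k L"
      if "finite G" "G \<subseteq> {..<length as}" for G
      using that
    proof (induction G rule: finite_induct)
      case empty
      then show ?case using bc[OF i] by (intro bexI[of _ "\<lambda>_. \<zero>"] diff_sums.zero) (auto simp: P_def)
    next
      case (insert j G)
      then obtain k where k: "k \<in> diff_sums R idx L0 (I \<cdot> B)"
        "\<And>L. L \<in> idx \<rightarrow> carrier R \<Longrightarrow> b i \<otimes> P G L0 = b i \<otimes> P G L \<oplus> k L" by auto
      have j: "j < length as" and ij: "(i, j) \<in> idx" using insert.prems i by (auto simp: idx_def)
      define c where "c = as ! j \<otimes> b i"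
      have cIB: "c \<in> I \<cdot> B" unfolding c_def using as_I[OF j] b i by (auto intro: ideal_prod.prod)
      have "b i \<otimes> P (insert j G) L0 = b i \<otimes> P (insert j G) L \<oplus> ((L0 (i, j) \<ominus> L (i, j)) \<otimes> c \<oplus> k L)"
        if L: "L \<in> idx \<rightarrow> carrier R" for L
      proof -
        have ins: "P (insert j G) L = L (i, j) \<otimes> as ! j \<oplus> P G L" if "L \<in> idx \<rightarrow> carrier R" for L
          unfolding P_def using insert Lc[OF that] ac by (intro finsum_insert) auto
        have kL: "k L \<in> carrier R" by (rule diff_sums_closed[OF k(1) IB L0 L])
        have cc: "L (i, j) \<in> carrier R" "L0 (i, j) \<in> carrier R" "P G L \<in> carrier R" "P G L0 \<in> carrier R"
          using Lc[OF L j] Lc[OF L0 j] Pc[OF L] Pc[OF L0] insert.prems by auto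
        have "b i \<otimes> P (insert j G) L0 = b i \<otimes> (L0 (i, j) \<otimes> as ! j) \<oplus> b i \<otimes> P G L0"
          unfolding ins[OF L0] using cc ac[OF j] bc[OF i] by algebra
        also have "\<dots> = b i \<otimes> (L (i, j) \<otimes> as ! j \<oplus> P G L) \<oplus> ((L0 (i, j) \<ominus> L (i, j)) \<otimes> c \<oplus> k L)"
          unfolding k(2)[OF L] c_def using cc ac[OF j] bc[OF i] kL by algebra
        finally show ?thesis unfolding ins[OF L] .
      qed
      then show ?case
        by (intro bexI[of _ "\<lambda>L. (L0 (i, j) \<ominus> L (i, j)) \<otimes> c \<oplus> k L"] diff_sums.add k(1)
            diff_sums.base ij cIB) auto
    qed
    from this[OF _ subset_refl] show ?thesis unfolding P_def lin_comb_def by auto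
  qed
  have "\<exists>k\<in>diff_sums R idx L0 (I \<cdot> B). \<forall>L \<in> idx \<rightarrow> carrier R.
      (\<Oplus>i\<in>G. b i \<otimes> lin_comb R as L0 i) \<ominus> k L \<in> J L \<cdot> B" if "finite G" "G \<subseteq> {..<d}" for G
    using that
  proof (induction G rule: finite_induct)
    case empty
    have "\<zero> \<in> J L \<cdot> B" if "L \<in> idx \<rightarrow> carrier R" for L
      using ideal_closed(1)[OF ideal_prod_is_ideal[OF J_ideal[OF that] B]] .
    then show ?case by (intro bexI[of _ "\<lambda>_. \<zero>"] diff_sums.zero) (auto simp: a_minus_def)
  next
    case (insert i G)
    then obtain k where k: "k \<in> diff_sums R idx L0 (I \<cdot> B)"
      "\<And>L. L \<in> idx \<rightarrow> carrier R \<Longrightarrow> (\<Oplus>i\<in>G. b i \<otimes> lin_comb R as L0 i) \<ominus> k L \<in> J L \<cdot> B" by auto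
    have i: "i < d" using insert.prems by auto
    obtain k' where k': "k' \<in> diff_sums R idx L0 (I \<cdot> B)"
      "\<And>L. L \<in> idx \<rightarrow> carrier R \<Longrightarrow> b i \<otimes> lin_comb R as L0 i = b i \<otimes> lin_comb R as L i \<oplus> k' L"
      using one[OF i] by auto
    define a where "a = (\<Oplus>i\<in>G. b i \<otimes> lin_comb R as L0 i)"
    have ac: "a \<in> carrier R" unfolding a_def using insert.prems bc lc[OF L0] by (intro finsum_closed) auto
    have sum: "(\<Oplus>i\<in>insert i G. b i \<otimes> lin_comb R as L0 i) = b i \<otimes> lin_comb R as L0 i \<oplus> a"
      unfolding a_def using insert bc lc[OF L0] by (intro finsum_insert) auto
    have "(\<Oplus>i\<in>insert i G. b i \<otimes> lin_comb R as L0 i) \<ominus> (k' L \<oplus> k L) \<in> J L \<cdot> B"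
      if L: "L \<in> idx \<rightarrow> carrier R" for L
    proof -
      have kL: "k L \<in> carrier R" "k' L \<in> carrier R"
        using diff_sums_closed[OF k(1) IB L0 L] diff_sums_closed[OF k'(1) IB L0 L] by auto
      have "(\<Oplus>i\<in>insert i G. b i \<otimes> lin_comb R as L0 i) \<ominus> (k' L \<oplus> k L)
        = lin_comb R as L i \<otimes> b i \<oplus> (a \<ominus> k L)"
        unfolding sum k'(2)[OF L] using kL ac bc[OF i] lc[OF L i] by algebra
      moreover have "lin_comb R as L i \<in> J L"
        unfolding J_def using genideal_self[OF lin_comb_closed[OF L]] i by auto
      then have "lin_comb R as L i \<otimes> b i \<in> J L \<cdot> B" using b i by (auto intro: ideal_prod.prod)
      moreover have "a \<ominus> k L \<in> J L \<cdot> B" using k(2)[OF L] by (simp add: a_def)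
      ultimately show ?thesis
        using ideal_closed(2)[OF ideal_prod_is_ideal[OF J_ideal[OF L] B]] by simp
    qed
    then show ?case by (intro bexI[of _ "\<lambda>L. k' L \<oplus> k L"] diff_sums.add k k') auto
  qed
  from this[OF _ subset_refl] show ?thesis using b(2) by auto
qed

text \<open>Serves two purposes: \<open>w\<close> and \<open>D\<close> zero and \<open>B\<close> a
  power of \<open>I\<close> for the reduction equation, \<open>B = I\<close> and
  \<open>D = I^3\<close> for the generation of \<open>I^2\<close> by \<open>w\<close>. Passing from
  \<open>J L0\<close> to \<open>J L\<close> leaves an error that vanishes at \<open>L0\<close>,
  which Nakayama's lemma absorbs.\<close>

lemma open_span:
  assumes L0: "L0 \<in> idx \<rightarrow> carrier R" and w: "w \<in> carrier R" and B: "ideal B R" and D: "ideal D R"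
    and hyp: "\<And>c. c \<in> I \<cdot> B \<Longrightarrow> \<exists>s\<in>carrier R. c \<ominus> s \<otimes> w \<in> J L0 \<cdot> B <+>\<^bsub>R\<^esub> D"
  shows "\<exists>u\<in>poly_funs R idx. u L0 \<notin> m \<and> (\<forall>c\<in>I \<cdot> B. \<exists>s\<in>poly_funs R idx.
    \<forall>L \<in> idx \<rightarrow> carrier R. u L \<otimes> c \<ominus> s L \<otimes> w \<in> J L \<cdot> B <+>\<^bsub>R\<^esub> D)"
proof -
  have iIB: "ideal (I \<cdot> B) R" by (intro ideal_prod_is_ideal I_ideal B)
  have iJB: "ideal (J L \<cdot> B) R" if "L \<in> idx \<rightarrow> carrier R" for L
    by (intro ideal_prod_is_ideal J_ideal that B)
  have iM: "ideal (J L \<cdot> B <+>\<^bsub>R\<^esub> D) R" if "L \<in> idx \<rightarrow> carrier R" for L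
    by (intro add_ideals iJB that D)
  obtain E where E: "finite E" "E \<subseteq> carrier R" "I \<cdot> B = Idl E" using fg_ideal[OF iIB] .
  have "\<exists>u\<in>poly_funs R idx. u L0 \<notin> m \<and> (\<forall>e\<in>E. \<exists>s\<in>poly_funs R idx.
    \<forall>L \<in> idx \<rightarrow> carrier R. u L \<otimes> (\<lambda>e. e) e \<ominus> s L \<otimes> w \<in> J L \<cdot> B <+>\<^bsub>R\<^esub> D)"
  proof (rule poly_nakayama[OF L0 w iM E(1)])
    show "(\<lambda>e. e) \<in> E \<rightarrow> carrier R" using E by auto
    fix e assume "e \<in> E"
    then have e: "e \<in> I \<cdot> B" "e \<in> carrier R" using E genideal_self[OF E(2)] by auto
    obtain s y z where s: "s \<in> carrier R" "y \<in> J L0 \<cdot> B" "z \<in> D" "e \<ominus> s \<otimes> w = y \<oplus> z"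
      using hyp[OF e(1)] by (auto simp: set_add_iff)
    obtain k where k: "k \<in> diff_sums R idx L0 (I \<cdot> B)"
      "\<And>L. L \<in> idx \<rightarrow> carrier R \<Longrightarrow> y \<ominus> k L \<in> J L \<cdot> B" using diff_expand[OF L0 B s(2)] by auto
    have kv: "k \<in> vanishing_combs R m idx L0 E (\<lambda>e. e)"
      using E by (intro diff_sums_vanishing[OF k(1)] L0) auto
    have "\<one> \<otimes> e \<ominus> (s \<otimes> w \<oplus> k L) \<in> J L \<cdot> B <+>\<^bsub>R\<^esub> D" if L: "L \<in> idx \<rightarrow> carrier R" for L
    proof -
      have c: "k L \<in> carrier R" "y \<in> carrier R" "z \<in> carrier R"
        using diff_sums_closed[OF k(1) ideal_closed(8)[OF iIB] L0 L] s ideal_closed(7)[OF iJB[OF L0]]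
          ideal_closed(7)[OF D] by auto
      have "\<one> \<otimes> e \<ominus> (s \<otimes> w \<oplus> k L) = (e \<ominus> s \<otimes> w) \<ominus> k L" using c e(2) s(1) w by algebra
      also have "\<dots> = (y \<ominus> k L) \<oplus> z" unfolding s(4) using c by algebra
      finally show ?thesis using k(2)[OF L] s(3) by (auto simp: set_add_iff)
    qed
    then show "\<exists>u\<in>poly_funs R idx. u L0 \<notin> m \<and> (\<exists>s\<in>poly_funs R idx.
      \<exists>k\<in>vanishing_combs R m idx L0 E (\<lambda>e. e). \<forall>L \<in> idx \<rightarrow> carrier R.
        u L \<otimes> e \<ominus> (s L \<otimes> w \<oplus> k L) \<in> J L \<cdot> B <+>\<^bsub>R\<^esub> D)"
      using one_notin_m s(1) kv
      by (intro bexI[of _ "\<lambda>_. \<one>"] conjI bexI[of _ "\<lambda>_. s"] bexI[of _ k] poly_funs.const) auto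
  qed auto
  then obtain u where u: "u \<in> poly_funs R idx" "u L0 \<notin> m" "\<And>e. e \<in> E \<Longrightarrow> \<exists>s\<in>poly_funs R idx.
    \<forall>L \<in> idx \<rightarrow> carrier R. u L \<otimes> e \<ominus> s L \<otimes> w \<in> J L \<cdot> B <+>\<^bsub>R\<^esub> D" by auto
  \<comment> \<open>With \<open>u\<close> fixed, the elements \<open>c\<close> for which the
    conclusion holds form an ideal, so it is enough to have the generators in
    \<open>E\<close>.\<close>
  define G where "G = {c \<in> carrier R. \<exists>s\<in>poly_funs R idx.
    \<forall>L \<in> idx \<rightarrow> carrier R. u L \<otimes> c \<ominus> s L \<otimes> w \<in> J L \<cdot> B <+>\<^bsub>R\<^esub> D}"
  have uc: "u L \<in> carrier R" if "L \<in> idx \<rightarrow> carrier R" for L by (rule poly_funs_closed[OF u(1) that])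
  have "ideal G R"
  proof (rule cring_idealI)
    show "G \<subseteq> carrier R" by (auto simp: G_def)
    have "u L \<otimes> \<zero> \<ominus> \<zero> \<otimes> w \<in> J L \<cdot> B <+>\<^bsub>R\<^esub> D" if "L \<in> idx \<rightarrow> carrier R" for L
      using ideal_closed(1)[OF iM[OF that]] uc[OF that] w by (simp add: a_minus_def)
    then show "\<zero> \<in> G" unfolding G_def by (auto intro!: bexI[of _ "\<lambda>_. \<zero>"] poly_funs.const)
  next
    fix a b assume "a \<in> G" "b \<in> G"
    then obtain s t where st: "a \<in> carrier R" "b \<in> carrier R" "s \<in> poly_funs R idx" "t \<in> poly_funs R idx"
      "\<And>L. L \<in> idx \<rightarrow> carrier R \<Longrightarrow> u L \<otimes> a \<ominus> s L \<otimes> w \<in> J L \<cdot> B <+>\<^bsub>R\<^esub> D"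
      "\<And>L. L \<in> idx \<rightarrow> carrier R \<Longrightarrow> u L \<otimes> b \<ominus> t L \<otimes> w \<in> J L \<cdot> B <+>\<^bsub>R\<^esub> D"
      unfolding G_def by blast
    have "u L \<otimes> (a \<oplus> b) \<ominus> (s L \<oplus> t L) \<otimes> w \<in> J L \<cdot> B <+>\<^bsub>R\<^esub> D" if L: "L \<in> idx \<rightarrow> carrier R" for L
    proof -
      have "u L \<otimes> (a \<oplus> b) \<ominus> (s L \<oplus> t L) \<otimes> w = (u L \<otimes> a \<ominus> s L \<otimes> w) \<oplus> (u L \<otimes> b \<ominus> t L \<otimes> w)"
        using uc[OF L] st(1,2) w poly_funs_closed[OF st(3) L] poly_funs_closed[OF st(4) L] by algebra
      then show ?thesis using ideal_closed(2)[OF iM[OF L] st(5)[OF L] st(6)[OF L]] by simp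
    qed
    then show "a \<oplus> b \<in> G" unfolding G_def using st poly_funs.add[OF st(3,4)]
      by (auto intro!: bexI[of _ "\<lambda>L. s L \<oplus> t L"])
  next
    fix a r assume "a \<in> G" and r: "r \<in> carrier R"
    then obtain s where s: "a \<in> carrier R" "s \<in> poly_funs R idx"
      "\<And>L. L \<in> idx \<rightarrow> carrier R \<Longrightarrow> u L \<otimes> a \<ominus> s L \<otimes> w \<in> J L \<cdot> B <+>\<^bsub>R\<^esub> D"
      unfolding G_def by blast
    have "u L \<otimes> (r \<otimes> a) \<ominus> (r \<otimes> s L) \<otimes> w \<in> J L \<cdot> B <+>\<^bsub>R\<^esub> D" if L: "L \<in> idx \<rightarrow> carrier R" for L
    proof -
      have "u L \<otimes> (r \<otimes> a) \<ominus> (r \<otimes> s L) \<otimes> w = r \<otimes> (u L \<otimes> a \<ominus> s L \<otimes> w)"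
        using uc[OF L] s(1) r w poly_funs_closed[OF s(2) L] by algebra
      then show ?thesis using ideal_closed(5)[OF iM[OF L] s(3)[OF L] r] by simp
    qed
    then show "r \<otimes> a \<in> G" unfolding G_def using s r poly_funs.mult[OF poly_funs.const[OF r] s(2)]
      by (auto intro!: bexI[of _ "\<lambda>L. r \<otimes> s L"])
  qed
  moreover have "E \<subseteq> G" using u(3) E(2) by (auto simp: G_def)
  ultimately have "I \<cdot> B \<subseteq> G" unfolding E(3) by (rule Idl_least)
  then show ?thesis using u(1,2) by (auto simp: G_def)
qed

text \<open>Where \<open>u L\<close> is a unit, \<open>open_span\<close> with \<open>w = 0\<close>
  yields the reduction equation for \<open>J L\<close> with the same exponent \<open>r\<close> as
  for \<open>J L0\<close>.\<close>

lemma open_reduction: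
  assumes L0: "L0 \<in> idx \<rightarrow> carrier R" and red: "reduction R (J L0) I"
  shows "\<exists>u\<in>poly_funs R idx. u L0 \<notin> m \<and>
    (\<forall>L \<in> idx \<rightarrow> carrier R. u L \<notin> m \<longrightarrow> reduction R (J L) I)"
proof -
  obtain r where r: "ideal_pow R I (Suc r) = J L0 \<cdot> ideal_pow R I r" using red by (auto simp: reduction_def)
  note iB = ideal_pow_ideal[OF I_ideal, of r]
  have IB: "I \<cdot> ideal_pow R I r = ideal_pow R I (Suc r)"
    unfolding ideal_pow_Suc by (rule ideal_prod_commute[OF I_ideal iB])
  have "\<exists>u\<in>poly_funs R idx. u L0 \<notin> m \<and> (\<forall>c\<in>I \<cdot> ideal_pow R I r. \<exists>s\<in>poly_funs R idx.
    \<forall>L \<in> idx \<rightarrow> carrier R. u L \<otimes> c \<ominus> s L \<otimes> \<zero> \<in> J L \<cdot> ideal_pow R I r <+>\<^bsub>R\<^esub> {\<zero>})"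
  proof (rule open_span[OF L0 zero_closed iB zeroideal])
    fix c assume "c \<in> I \<cdot> ideal_pow R I r"
    then have c: "c \<in> J L0 \<cdot> ideal_pow R I r" using IB r by simp
    then have "c \<in> carrier R" using ideal_prod_in_carrier[OF J_ideal[OF L0] iB] by auto
    then have "c \<ominus> \<zero> \<otimes> \<zero> = c \<oplus> \<zero>" by (simp add: a_minus_def)
    then show "\<exists>s\<in>carrier R. c \<ominus> s \<otimes> \<zero> \<in> J L0 \<cdot> ideal_pow R I r <+>\<^bsub>R\<^esub> {\<zero>}"
      using c by (intro bexI[of _ \<zero>]) (auto simp: set_add_iff)
  qed
  then obtain u where u: "u \<in> poly_funs R idx" "u L0 \<notin> m"
    "\<And>c. c \<in> I \<cdot> ideal_pow R I r \<Longrightarrow> \<exists>s\<in>poly_funs R idx.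
      \<forall>L \<in> idx \<rightarrow> carrier R. u L \<otimes> c \<ominus> s L \<otimes> \<zero> \<in> J L \<cdot> ideal_pow R I r <+>\<^bsub>R\<^esub> {\<zero>}" by blast
  have "reduction R (J L) I" if L: "L \<in> idx \<rightarrow> carrier R" and uL: "u L \<notin> m" for L
  proof -
    note iJB = ideal_prod_is_ideal[OF J_ideal[OF L] iB]
    note uc = poly_funs_closed[OF u(1) L]
    have "ideal_pow R I (Suc r) \<subseteq> J L \<cdot> ideal_pow R I r"
    proof
      fix c assume "c \<in> ideal_pow R I (Suc r)"
      then have c: "c \<in> I \<cdot> ideal_pow R I r" using IB by simp
      then have cc: "c \<in> carrier R" using ideal_prod_in_carrier[OF I_ideal iB] by auto
      obtain s where s: "s \<in> poly_funs R idx"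
        "u L \<otimes> c \<ominus> s L \<otimes> \<zero> \<in> J L \<cdot> ideal_pow R I r <+>\<^bsub>R\<^esub> {\<zero>}" using u(3)[OF c] L by blast
      then obtain v where v: "v \<in> J L \<cdot> ideal_pow R I r" "u L \<otimes> c \<ominus> s L \<otimes> \<zero> = v \<oplus> \<zero>"
        by (auto simp: set_add_iff)
      moreover have "u L \<otimes> c \<ominus> s L \<otimes> \<zero> = u L \<otimes> c"
        using uc cc poly_funs_closed[OF s(1) L] by (simp add: a_minus_def)
      ultimately have "u L \<otimes> c \<in> J L \<cdot> ideal_pow R I r" using ideal_closed(7)[OF iJB] by simp
      then show "c \<in> J L \<cdot> ideal_pow R I r" by (rule ideal_unit_cancel[OF iJB uc uL cc])
    qed
    moreover have "J L \<cdot> ideal_pow R I r \<subseteq> ideal_pow R I (Suc r)"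
      using ideal_prod_mono[OF J_I[OF L] subset_refl] IB by blast
    ultimately have "ideal_pow R I (Suc r) = J L \<cdot> ideal_pow R I r" by (rule equalityI)
    then show ?thesis unfolding reduction_def using J_ideal[OF L] J_I[OF L] by blast
  qed
  then show ?thesis using u by blast
qed

text \<open>Either \<open>w\<close> itself lies in \<open>J L \<cdot> I + D\<close> for general \<open>L\<close>, or every polynomial function \<open>q\<close> with
  \<open>q L \<otimes> w \<in> J L \<cdot> I + D\<close> has values in \<open>m\<close>, hence coefficients in \<open>m\<close>, and Nakayama's lemma
  applies to generators of \<open>m\<close>.\<close>

lemma open_socle:
  assumes L0: "L0 \<in> idx \<rightarrow> carrier R" and w: "w \<in> carrier R" and D: "ideal D R"
    and f: "f \<in> poly_funs R idx" "f L0 \<notin> m"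
    and span: "\<And>c. c \<in> I \<cdot> I \<Longrightarrow> \<exists>s\<in>poly_funs R idx.
      \<forall>L \<in> idx \<rightarrow> carrier R. f L \<otimes> c \<ominus> s L \<otimes> w \<in> J L \<cdot> I <+>\<^bsub>R\<^esub> D"
    and socle: "\<And>t. t \<in> m \<Longrightarrow> t \<otimes> w \<in> J L0 \<cdot> I <+>\<^bsub>R\<^esub> D"
  shows "\<exists>q\<in>poly_funs R idx. (\<exists>L1 \<in> idx \<rightarrow> carrier R. q L1 \<notin> m) \<and>
    (\<forall>L \<in> idx \<rightarrow> carrier R. q L \<notin> m \<longrightarrow> (\<forall>t\<in>m. t \<otimes> w \<in> J L \<cdot> I <+>\<^bsub>R\<^esub> D))"
proof -
  define N where "N L = J L \<cdot> I <+>\<^bsub>R\<^esub> D" for L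
  have iJI: "ideal (J L \<cdot> I) R" if "L \<in> idx \<rightarrow> carrier R" for L
    by (intro ideal_prod_is_ideal J_ideal that I_ideal)
  have iN: "ideal (N L) R" if "L \<in> idx \<rightarrow> carrier R" for L
    unfolding N_def by (intro add_ideals iJI that D)
  have iII: "ideal (I \<cdot> I) R" by (intro ideal_prod_is_ideal I_ideal)
  show ?thesis unfolding N_def[symmetric]
  \<comment> \<open>In the first case \<open>w\<close> lies in \<open>N L\<close> wherever
    \<open>q L\<close> is a unit, so it is killed trivially; the witness \<open>L1\<close> may
    differ from \<open>L0\<close>. The second case says that every \<open>q\<close> with
    \<open>q L w\<close> in \<open>N L\<close> for all \<open>L\<close> has its values in
    \<open>m\<close>.\<close>
  proof (cases "\<exists>q\<in>poly_funs R idx. (\<forall>L \<in> idx \<rightarrow> carrier R. q L \<otimes> w \<in> N L) \<and>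
      (\<exists>L1 \<in> idx \<rightarrow> carrier R. q L1 \<notin> m)")
    case True
    then obtain q L1 where q: "q \<in> poly_funs R idx" "\<And>L. L \<in> idx \<rightarrow> carrier R \<Longrightarrow> q L \<otimes> w \<in> N L"
      "L1 \<in> idx \<rightarrow> carrier R" "q L1 \<notin> m" by blast
    have "t \<otimes> w \<in> N L" if "L \<in> idx \<rightarrow> carrier R" "q L \<notin> m" "t \<in> m" for L t
    proof -
      have "w \<in> N L"
        using ideal_unit_cancel[OF iN[OF that(1)] poly_funs_closed[OF q(1) that(1)] that(2) w q(2)[OF that(1)]] .
      then show ?thesis using ideal_closed(5)[OF iN[OF that(1)]] ideal_closed(7)[OF m_ideal that(3)] by auto
    qed
    then show "\<exists>q\<in>poly_funs R idx. (\<exists>L1 \<in> idx \<rightarrow> carrier R. q L1 \<notin> m) \<and>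
      (\<forall>L \<in> idx \<rightarrow> carrier R. q L \<notin> m \<longrightarrow> (\<forall>t\<in>m. t \<otimes> w \<in> N L))" using q by blast
  next
    case False
    then have mval: "q L \<in> m" if "q \<in> poly_funs R idx" "\<And>L. L \<in> idx \<rightarrow> carrier R \<Longrightarrow> q L \<otimes> w \<in> N L"
      "L \<in> idx \<rightarrow> carrier R" for q L using that by blast
    have fc: "f L \<in> carrier R" if "L \<in> idx \<rightarrow> carrier R" for L by (rule poly_funs_closed[OF f(1) that])
    obtain T where T: "finite T" "T \<subseteq> carrier R" "m = Idl T" using fg_ideal[OF m_ideal] .
    have Tid: "(\<lambda>t. t) \<in> T \<rightarrow> carrier R" "Idl ((\<lambda>t. t) ` T) = m" using T by auto
    \<comment> \<open>The annihilator of \<open>w\<close> modulo \<open>N L\<close>. The aim is that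
      it contains \<open>m\<close>, so Nakayama's lemma is applied to generators of
      \<open>m\<close>, with zero in the place of \<open>w\<close>.\<close>
    define M where "M L = {r \<in> carrier R. r \<otimes> w \<in> N L}" for L
    have iM: "ideal (M L) R" if L: "L \<in> idx \<rightarrow> carrier R" for L
      using ideal_closed[OF iN[OF L]] w
      by (intro cring_idealI) (auto simp: M_def l_distr m_assoc)
    \<comment> \<open>By \<open>span\<close>, multiplication by \<open>f\<close> turns an error term
      with values in \<open>I^2\<close> into a multiple \<open>p L\<close> of \<open>w\<close>
      modulo \<open>N L\<close>, and \<open>p\<close> still vanishes at \<open>L0\<close>.\<close>
    have diff: "\<exists>p\<in>poly_funs R idx. p L0 = \<zero> \<and> (\<forall>L \<in> idx \<rightarrow> carrier R. f L \<otimes> k L \<ominus> p L \<otimes> w \<in> N L)"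
      if "k \<in> diff_sums R idx L0 (I \<cdot> I)" for k
      using that
    proof induction
      case zero
      have "f L \<otimes> \<zero> \<ominus> \<zero> \<otimes> w \<in> N L" if "L \<in> idx \<rightarrow> carrier R" for L
        using ideal_closed(1)[OF iN[OF that]] fc[OF that] w by (simp add: a_minus_def)
      then show ?case by (intro bexI[of _ "\<lambda>_. \<zero>"] poly_funs.const) auto
    next
      case (base s c)
      obtain h where h: "h \<in> poly_funs R idx" "\<And>L. L \<in> idx \<rightarrow> carrier R \<Longrightarrow> h L = L0 s \<ominus> L s"
        using poly_funs_minus[of "\<lambda>_. L0 s" idx "\<lambda>L. L s"] base L0 by (blast intro: poly_funs.intros)
      obtain v where v: "v \<in> poly_funs R idx" "\<And>L. L \<in> idx \<rightarrow> carrier R \<Longrightarrow> f L \<otimes> c \<ominus> v L \<otimes> w \<in> N L"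
        using span[OF base(2)] unfolding N_def by blast
      have cc: "c \<in> carrier R" using base(2) ideal_closed(7)[OF iII] by auto
      have hL0: "h L0 = \<zero>" using h(2)[OF L0] funcset_mem[OF L0 base(1)] by (simp add: a_minus_def r_neg)
      have "f L \<otimes> ((L0 s \<ominus> L s) \<otimes> c) \<ominus> (h L \<otimes> v L) \<otimes> w \<in> N L" if L: "L \<in> idx \<rightarrow> carrier R" for L
      proof -
        have hc: "h L \<in> carrier R" "v L \<in> carrier R" using poly_funs_closed[OF h(1) L] poly_funs_closed[OF v(1) L] by auto
        have "f L \<otimes> (h L \<otimes> c) \<ominus> (h L \<otimes> v L) \<otimes> w = h L \<otimes> (f L \<otimes> c \<ominus> v L \<otimes> w)"
          using hc fc[OF L] cc w by algebra
        then show ?thesis using ideal_closed(5)[OF iN[OF L] v(2)[OF L] hc(1)] h(2)[OF L] by simp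
      qed
      then show ?case using hL0 poly_funs_closed[OF v(1) L0]
        by (intro bexI[of _ "\<lambda>L. h L \<otimes> v L"] poly_funs.mult h(1) v(1)) auto
    next
      case (add k k')
      obtain p p' where p: "p \<in> poly_funs R idx" "p L0 = \<zero>"
          "\<And>L. L \<in> idx \<rightarrow> carrier R \<Longrightarrow> f L \<otimes> k L \<ominus> p L \<otimes> w \<in> N L"
        and p': "p' \<in> poly_funs R idx" "p' L0 = \<zero>"
          "\<And>L. L \<in> idx \<rightarrow> carrier R \<Longrightarrow> f L \<otimes> k' L \<ominus> p' L \<otimes> w \<in> N L"
        using add.IH by blast
      have "f L \<otimes> (k L \<oplus> k' L) \<ominus> (p L \<oplus> p' L) \<otimes> w \<in> N L" if L: "L \<in> idx \<rightarrow> carrier R" for L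
      proof -
        have c: "k L \<in> carrier R" "k' L \<in> carrier R"
          using diff_sums_closed[OF _ ideal_closed(8)[OF iII] L0 L] add.hyps by auto
        have "f L \<otimes> (k L \<oplus> k' L) \<ominus> (p L \<oplus> p' L) \<otimes> w = (f L \<otimes> k L \<ominus> p L \<otimes> w) \<oplus> (f L \<otimes> k' L \<ominus> p' L \<otimes> w)"
          using c fc[OF L] w poly_funs_closed[OF p(1) L] poly_funs_closed[OF p'(1) L] by algebra
        then show ?thesis using ideal_closed(2)[OF iN[OF L] p(3)[OF L] p'(3)[OF L]] by simp
      qed
      then show ?case using p(2) p'(2)
        by (intro bexI[of _ "\<lambda>L. p L \<oplus> p' L"] poly_funs.add p(1) p'(1)) auto
    qed
    have "\<exists>u\<in>poly_funs R idx. u L0 \<notin> m \<and> (\<forall>t\<in>T. \<exists>s\<in>poly_funs R idx.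
      \<forall>L \<in> idx \<rightarrow> carrier R. u L \<otimes> (\<lambda>t. t) t \<ominus> s L \<otimes> \<zero> \<in> M L)"
    proof (rule poly_nakayama[OF L0 zero_closed iM T(1) Tid(1)])
      fix t assume t: "t \<in> T"
      then have tm: "t \<in> m" "t \<in> carrier R" using T genideal_self[OF T(2)] by auto
      obtain y z where yz: "y \<in> J L0 \<cdot> I" "z \<in> D" "t \<otimes> w = y \<oplus> z"
        using socle[OF tm(1)] by (auto simp: set_add_iff)
      obtain k where k: "k \<in> diff_sums R idx L0 (I \<cdot> I)"
        "\<And>L. L \<in> idx \<rightarrow> carrier R \<Longrightarrow> y \<ominus> k L \<in> J L \<cdot> I" using diff_expand[OF L0 I_ideal yz(1)] by auto
      obtain p where p: "p \<in> poly_funs R idx" "p L0 = \<zero>"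
        "\<And>L. L \<in> idx \<rightarrow> carrier R \<Longrightarrow> f L \<otimes> k L \<ominus> p L \<otimes> w \<in> N L" using diff[OF k(1)] by blast
      have ft: "(\<lambda>L. f L \<otimes> t) \<in> poly_funs R idx" using f(1) tm by (intro poly_funs.mult poly_funs.const)
      \<comment> \<open>\<open>q L w\<close> lies in \<open>N L\<close> for every \<open>L\<close>,
        so the case assumption puts all values of \<open>q\<close> into \<open>m\<close>. Then
        \<open>p L = f L t - q L\<close> has its values in \<open>m\<close> as well.\<close>
      obtain q where q: "q \<in> poly_funs R idx" "\<And>L. L \<in> idx \<rightarrow> carrier R \<Longrightarrow> q L = f L \<otimes> t \<ominus> p L"
        using poly_funs_minus[OF ft p(1)] by blast
      have qN: "q L \<otimes> w \<in> N L" if L: "L \<in> idx \<rightarrow> carrier R" for L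
      proof -
        have c: "k L \<in> carrier R" "y \<in> carrier R" "z \<in> carrier R" "p L \<in> carrier R"
          using diff_sums_closed[OF k(1) ideal_closed(8)[OF iII] L0 L] yz ideal_closed(7)[OF iJI[OF L0]]
            ideal_closed(7)[OF D] poly_funs_closed[OF p(1) L] by auto
        have "q L \<otimes> w = f L \<otimes> (t \<otimes> w) \<ominus> p L \<otimes> w"
          unfolding q(2)[OF L] using c fc[OF L] tm w by algebra
        also have "\<dots> = f L \<otimes> ((y \<ominus> k L) \<oplus> z) \<oplus> (f L \<otimes> k L \<ominus> p L \<otimes> w)"
          unfolding yz(3) using c fc[OF L] w by algebra
        finally have eq: "q L \<otimes> w = f L \<otimes> ((y \<ominus> k L) \<oplus> z) \<oplus> (f L \<otimes> k L \<ominus> p L \<otimes> w)" .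
        have "(y \<ominus> k L) \<oplus> z \<in> N L" unfolding N_def set_add_iff using k(2)[OF L] yz(2) by blast
        then have "f L \<otimes> ((y \<ominus> k L) \<oplus> z) \<in> N L" using ideal_closed(5)[OF iN[OF L]] fc[OF L] by auto
        then show ?thesis unfolding eq using ideal_closed(2)[OF iN[OF L]] p(3)[OF L] by auto
      qed
      have pm: "p L \<in> m" if L: "L \<in> idx \<rightarrow> carrier R" for L
      proof -
        have "p L = f L \<otimes> t \<ominus> q L"
          unfolding q(2)[OF L] using fc[OF L] tm(2) poly_funs_closed[OF p(1) L] by algebra
        then show ?thesis
          using ideal_closed(4,5)[OF m_ideal] tm(1) fc[OF L] mval[OF q(1) qN L] by simp
      qed
      \<comment> \<open>Values in \<open>m\<close> give coefficients in \<open>m\<close>. Together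
        with \<open>p L0 = \<zero>\<close> this presents \<open>p\<close> as a combination of
        generators of \<open>m\<close> with coefficients vanishing at \<open>L0\<close>, which
        Nakayama's lemma can discard.\<close>
      obtain Ex C where C: "finite Ex" "Ex \<subseteq> idx \<rightarrow>\<^sub>E UNIV" "C \<in> Ex \<rightarrow> carrier R"
        "\<And>L. L \<in> idx \<rightarrow> carrier R \<Longrightarrow> p L = (\<Oplus>\<alpha>\<in>Ex. C \<alpha> \<otimes> monomial R idx \<alpha> L)"
        using poly_funs_coeffs[OF p(1) finite_idx] by blast
      have "C \<alpha> \<in> m" if "\<alpha> \<in> Ex" for \<alpha>
      proof (rule monomial_coeffs_in_m[OF finite_idx C(1,3), of "\<lambda>\<alpha>. \<alpha>"])
        show "a = b" if "a \<in> Ex" "b \<in> Ex" "\<And>i. i \<in> idx \<Longrightarrow> a i = b i" for a b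
          using that C(2) by (intro PiE_ext[of a idx "\<lambda>_. UNIV" b]) auto
        show "(\<Oplus>a\<in>Ex. C a \<otimes> monomial R idx a L) \<in> m" if "L \<in> idx \<rightarrow> carrier R" for L
          using pm[OF that] C(4)[OF that] by simp
      qed (rule that)
      then have "(\<lambda>L. (\<Oplus>\<alpha>\<in>Ex. C \<alpha> \<otimes> monomial R idx \<alpha> L) \<ominus> (\<Oplus>\<alpha>\<in>Ex. C \<alpha> \<otimes> monomial R idx \<alpha> L0))
        \<in> vanishing_combs R m idx L0 T (\<lambda>t. t)" (is "?k \<in> _")
        using Tid(2) by (intro vanishing_combs_of_m_coeffs finite_idx C(1) T(1) Tid(1) L0) auto
      moreover have kp: "?k L = p L" if L: "L \<in> idx \<rightarrow> carrier R" for L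
        unfolding C(4)[OF L, symmetric] C(4)[OF L0, symmetric] p(2)
        using poly_funs_closed[OF p(1) L] by (simp add: a_minus_def)
      have "f L \<otimes> t \<ominus> (\<zero> \<otimes> \<zero> \<oplus> ?k L) \<in> M L" if L: "L \<in> idx \<rightarrow> carrier R" for L
      proof -
        have "f L \<otimes> t \<ominus> (\<zero> \<otimes> \<zero> \<oplus> ?k L) = q L"
          unfolding kp[OF L] q(2)[OF L] using fc[OF L] tm(2) poly_funs_closed[OF p(1) L] by simp
        then show ?thesis unfolding M_def using qN[OF L] poly_funs_closed[OF q(1) L] by simp
      qed
      ultimately show "\<exists>u\<in>poly_funs R idx. u L0 \<notin> m \<and> (\<exists>s\<in>poly_funs R idx.
        \<exists>k\<in>vanishing_combs R m idx L0 T (\<lambda>t. t). \<forall>L \<in> idx \<rightarrow> carrier R.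
          u L \<otimes> t \<ominus> (s L \<otimes> \<zero> \<oplus> k L) \<in> M L)"
        using f by (intro bexI[of _ f] conjI bexI[of _ "\<lambda>_. \<zero>"] bexI[of _ ?k] poly_funs.const) auto
    qed
    then obtain u where u: "u \<in> poly_funs R idx" "u L0 \<notin> m" "\<And>t. t \<in> T \<Longrightarrow> \<exists>s\<in>poly_funs R idx.
      \<forall>L \<in> idx \<rightarrow> carrier R. u L \<otimes> t \<ominus> s L \<otimes> \<zero> \<in> M L" by auto
    have "t \<otimes> w \<in> N L" if L: "L \<in> idx \<rightarrow> carrier R" and uL: "u L \<notin> m" and "t \<in> m" for L t
    proof -
      note uc = poly_funs_closed[OF u(1) L]
      have "T \<subseteq> M L"
      proof
        fix t assume t: "t \<in> T"
        then have tc: "t \<in> carrier R" using T by auto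
        obtain s where s: "s \<in> poly_funs R idx" "u L \<otimes> t \<ominus> s L \<otimes> \<zero> \<in> M L" using u(3)[OF t] L by blast
        then have "u L \<otimes> t \<in> M L" using uc tc poly_funs_closed[OF s(1) L] by (simp add: a_minus_def)
        then show "t \<in> M L" by (rule ideal_unit_cancel[OF iM[OF L] uc uL tc])
      qed
      then have "m \<subseteq> M L" unfolding T(3) by (rule Idl_least[OF iM[OF L]])
      then show ?thesis using \<open>t \<in> m\<close> by (auto simp: M_def)
    qed
    then show "\<exists>q\<in>poly_funs R idx. (\<exists>L1 \<in> idx \<rightarrow> carrier R. q L1 \<notin> m) \<and>
      (\<forall>L \<in> idx \<rightarrow> carrier R. q L \<notin> m \<longrightarrow> (\<forall>t\<in>m. t \<otimes> w \<in> N L))" using u L0 by blast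
  qed
qed

end

section \<open>Lengths of quotients\<close>

context cring
begin

lemma coset_eq_iff:
  assumes "ideal B R" "a \<in> carrier R" "b \<in> carrier R"
  shows "B +> a = B +> b \<longleftrightarrow> a \<ominus> b \<in> B"
  using quotient_eq_iff_same_a_r_cos[OF assms] by blast

lemma coset_eq_ideal_iff:
  assumes "ideal B R" "a \<in> carrier R"
  shows "B +> a = B \<longleftrightarrow> a \<in> B"
  using ideal.rcos_const_imp_mem[OF assms(1)] a_rcos_zero[OF assms(1)] assms by auto

lemma quot_module_smult:
  assumes B: "ideal B R" and r: "r \<in> carrier R" and a: "a \<in> carrier R"
  shows "r \<odot>\<^bsub>quot_module R A B\<^esub> (B +> a) = B +> (r \<otimes> a)"
proof -
  have "B +> (r \<otimes> x) = B +> (r \<otimes> a)" if x: "x \<in> B +> a" for x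
  proof -
    obtain b where b: "b \<in> B" "x = b \<oplus> a" using x by (auto simp: a_r_coset_def')
    then have bc: "b \<in> carrier R" using ideal_closed(7)[OF B] by auto
    have "r \<otimes> x \<ominus> r \<otimes> a = r \<otimes> b" unfolding b(2) using bc r a by algebra
    then have "r \<otimes> x \<ominus> r \<otimes> a \<in> B" using ideal_closed(5)[OF B b(1) r] by simp
    then show ?thesis using coset_eq_iff[OF B] b bc r a by simp
  qed
  moreover have "a \<in> B +> a"
    using a ideal_closed(1)[OF B] by (auto simp: a_r_coset_def' intro!: bexI[of _ \<zero>])
  ultimately have "(\<Union>x\<in>B +> a. B +> (r \<otimes> x)) = B +> (r \<otimes> a)" by blast
  then show ?thesis by (simp add: quot_module_def)
qed

lemma quot_module_add:
  assumes "ideal B R" "a \<in> carrier R" "b \<in> carrier R"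
  shows "(B +> a) \<oplus>\<^bsub>quot_module R A B\<^esub> (B +> b) = B +> (a \<oplus> b)"
  using ideal.a_rcos_sum[OF assms] by (simp add: quot_module_def)

lemma image_submodule_quot:
  assumes A: "ideal A R" and B: "ideal B R" and C: "ideal C R" "B \<subseteq> C" "C \<subseteq> A"
  shows "submodule ((\<lambda>a. B +> a) ` C) R (quot_module R A B)"
proof -
  let ?M = "quot_module R A B"
  have car: "carrier ?M = (\<lambda>a. B +> a) ` A" and zero: "\<zero>\<^bsub>?M\<^esub> = B" by (simp_all add: quot_module_def)
  note Ac = ideal_closed[OF A] and Bc = ideal_closed[OF B] and Cc = ideal_closed[OF C(1)]
  have zeroB: "B = B +> \<zero>" using coset_eq_ideal_iff[OF B zero_closed] Bc(1) by simp
  have "subgroup ((\<lambda>a. B +> a) ` C) (add_monoid ?M)"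
  proof
    show "(\<lambda>a. B +> a) ` C \<subseteq> carrier (add_monoid ?M)" using C by (auto simp: car)
    show "x \<otimes>\<^bsub>add_monoid ?M\<^esub> y \<in> (\<lambda>a. B +> a) ` C" if "x \<in> (\<lambda>a. B +> a) ` C" "y \<in> (\<lambda>a. B +> a) ` C" for x y
      using that quot_module_add[OF B] Cc(2,7) by auto
    show "\<one>\<^bsub>add_monoid ?M\<^esub> \<in> (\<lambda>a. B +> a) ` C" using zeroB Cc(1) by (auto simp: zero)
    fix x assume "x \<in> (\<lambda>a. B +> a) ` C"
    then obtain a where a: "a \<in> C" "x = B +> a" by auto
    have ac: "a \<in> carrier R" "a \<in> A" using a C Cc by auto
    have "inv\<^bsub>add_monoid ?M\<^esub> x = B +> (\<ominus> a)"
      unfolding m_inv_def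
    proof (rule the_equality)
      have "B +> (a \<oplus> \<ominus> a) = B" "B +> (\<ominus> a \<oplus> a) = B"
        using ac zeroB by (simp_all add: r_neg l_neg)
      then show "B +> (\<ominus> a) \<in> carrier (add_monoid ?M) \<and> x \<otimes>\<^bsub>add_monoid ?M\<^esub> (B +> (\<ominus> a)) = \<one>\<^bsub>add_monoid ?M\<^esub>
        \<and> (B +> (\<ominus> a)) \<otimes>\<^bsub>add_monoid ?M\<^esub> x = \<one>\<^bsub>add_monoid ?M\<^esub>"
        unfolding a(2) using ac Ac(3) quot_module_add[OF B, of _ _ A] by (auto simp: car zero)
    next
      fix y assume y: "y \<in> carrier (add_monoid ?M) \<and> x \<otimes>\<^bsub>add_monoid ?M\<^esub> y = \<one>\<^bsub>add_monoid ?M\<^esub>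
        \<and> y \<otimes>\<^bsub>add_monoid ?M\<^esub> x = \<one>\<^bsub>add_monoid ?M\<^esub>"
      then obtain b where b: "b \<in> A" "y = B +> b" by (auto simp: car)
      have bc: "b \<in> carrier R" using b Ac by auto
      have "B +> (b \<oplus> a) = B" using y quot_module_add[OF B bc ac(1), of A] by (simp add: a b zero)
      then have "b \<oplus> a \<in> B" using coset_eq_ideal_iff[OF B] bc ac by simp
      moreover have "b \<ominus> (\<ominus> a) = b \<oplus> a" using bc ac by (simp add: a_minus_def)
      ultimately show "y = B +> (\<ominus> a)" unfolding b(2) using coset_eq_iff[OF B bc] ac by simp
    qed
    then show "inv\<^bsub>add_monoid ?M\<^esub> x \<in> (\<lambda>a. B +> a) ` C" using a Cc(3) by auto
  qed
  moreover have "a \<odot>\<^bsub>?M\<^esub> x \<in> (\<lambda>a. B +> a) ` C" if "a \<in> carrier R" "x \<in> (\<lambda>a. B +> a) ` C" for a x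
    using that quot_module_smult[OF B] Cc(5,7) by auto
  ultimately show ?thesis by (simp add: submodule_def submodule_axioms_def)
qed

lemma image_quot_strict:
  assumes B: "ideal B R" and C: "ideal C R" "ideal C' R" "B \<subseteq> C" "C \<subset> C'"
  shows "(\<lambda>a. B +> a) ` C \<subset> (\<lambda>a. B +> a) ` C'"
proof -
  obtain z where z: "z \<in> C'" "z \<notin> C" using C by auto
  have zc: "z \<in> carrier R" using z ideal_closed(7)[OF C(2)] by auto
  have "B +> z \<notin> (\<lambda>a. B +> a) ` C"
  proof
    assume "B +> z \<in> (\<lambda>a. B +> a) ` C"
    then obtain a where a: "a \<in> C" "B +> z = B +> a" by auto
    have ac: "a \<in> carrier R" using a ideal_closed(7)[OF C(1)] by auto
    have "z \<ominus> a \<in> C" using coset_eq_iff[OF B zc ac] a C by auto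
    then have "(z \<ominus> a) \<oplus> a \<in> C" using ideal_closed(2)[OF C(1)] a by auto
    moreover have "(z \<ominus> a) \<oplus> a = z" using zc ac by algebra
    ultimately show False using z by simp
  qed
  then show ?thesis using z C by auto
qed

lemma quot_length_le_one_no_chain:
  assumes len: "module_length R (quot_module R A B) \<le> 1"
    and A: "ideal A R" and B: "ideal B R" and C: "ideal C R" and sub: "B \<subset> C" "C \<subset> A"
  shows False
proof -
  define N where "N i = (\<lambda>a. B +> a) ` (if i = 0 then B else if i = 1 then C else A)" for i :: nat
  have "submodule (N i) R (quot_module R A B)" for i
    unfolding N_def using sub A B C by (auto intro!: image_submodule_quot)
  moreover have "N i \<subset> N (Suc i)" if "i < 2" for i
    using that sub image_quot_strict[OF B B C subset_refl] image_quot_strict[OF B C A]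
    by (auto simp: N_def less_Suc_eq numeral_2_eq_2)
  ultimately have "enat 2 \<le> module_length R (quot_module R A B)"
    unfolding module_length_def by (intro Sup_upper) blast
  then have "enat 2 \<le> 1" using len by (rule order_trans)
  then show False by (simp add: one_enat_def)
qed

text \<open>Each scalar kills \<open>w\<close> modulo \<open>B\<close> or is invertible, so a
  nonzero submodule contains the class of \<open>w\<close> and is the whole quotient. Invertibility
  stands in for a maximal ideal because the ring in the application is \<open>R Quot Q\<close>,
  where scalars are lifted to \<open>R\<close>.\<close>

lemma quot_length_le_one:
  assumes A: "ideal A R" and B: "ideal B R" and w: "w \<in> A"
    and span: "\<And>a. a \<in> A \<Longrightarrow> \<exists>s\<in>carrier R. a \<ominus> s \<otimes> w \<in> B"
    and soc: "\<And>s. s \<in> carrier R \<Longrightarrow> s \<otimes> w \<in> B \<or> (\<exists>t\<in>carrier R. t \<otimes> s = \<one>)"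
  shows "module_length R (quot_module R A B) \<le> 1"
  unfolding module_length_def
proof (rule Sup_least)
  let ?M = "quot_module R A B"
  have car: "carrier ?M = (\<lambda>a. B +> a) ` A" and zero: "\<zero>\<^bsub>?M\<^esub> = B" by (simp_all add: quot_module_def)
  have wc: "w \<in> carrier R" using w ideal_closed(7)[OF A] by auto
  have Acar: "\<exists>s\<in>carrier R. B +> a = B +> (s \<otimes> w)" if a: "a \<in> A" for a
  proof -
    obtain s where s: "s \<in> carrier R" "a \<ominus> s \<otimes> w \<in> B" using span[OF a] by auto
    then have "B +> a = B +> (s \<otimes> w)" using coset_eq_iff[OF B ideal_closed(7)[OF A a], of "s \<otimes> w"] wc by simp
    then show ?thesis using s(1) by blast
  qed
  fix z assume "z \<in> {enat n | n. \<exists>N. (\<forall>i\<le>n. submodule (N i) R ?M) \<and> (\<forall>i<n. N i \<subset> N (Suc i))}"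
  then obtain n N where z: "z = enat n" and N: "\<And>i. i \<le> n \<Longrightarrow> submodule (N i) R ?M"
    "\<And>i. i < n \<Longrightarrow> N i \<subset> N (Suc i)" by auto
  have sub: "N i \<subseteq> carrier ?M" if "i \<le> n" for i
    using subgroup.subset[OF submodule.axioms(1)[OF N(1)[OF that]]] by simp
  have "n \<le> 1"
  proof (rule ccontr)
    assume "\<not> n \<le> 1"
    then have n: "0 \<le> n" "1 \<le> n" "2 \<le> n" by auto
    have c01: "N 0 \<subset> N 1" and c12: "N 1 \<subset> N 2"
      using N(2)[of 0] N(2)[of 1] n by (auto simp: numeral_2_eq_2)
    obtain T where T: "T \<in> N 1" "T \<notin> N 0" using c01 by auto
    obtain a where a: "a \<in> A" "T = B +> a" using T sub[OF n(2)] by (auto simp: car)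
    obtain s where s: "s \<in> carrier R" "T = B +> (s \<otimes> w)" using Acar[OF a(1)] a(2) by auto
    have "B \<in> N 0" using subgroup.one_closed[OF submodule.axioms(1)[OF N(1)[OF n(1)]]] by (simp add: zero)
    then have "s \<otimes> w \<notin> B" using T(2) coset_eq_ideal_iff[OF B, of "s \<otimes> w"] s wc by auto
    then obtain t where t: "t \<in> carrier R" "t \<otimes> s = \<one>" using soc[OF s(1)] by auto
    have "t \<odot>\<^bsub>?M\<^esub> T \<in> N 1" using submodule.smult_closed[OF N(1)[OF n(2)] t(1) T(1)] .
    then have "B +> (t \<otimes> (s \<otimes> w)) \<in> N 1" using quot_module_smult[OF B t(1), of "s \<otimes> w" A] s wc by simp
    moreover have "t \<otimes> (s \<otimes> w) = w" using t s wc by (simp flip: m_assoc)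
    ultimately have wN: "B +> w \<in> N 1" by simp
    have "carrier ?M \<subseteq> N 1"
    proof
      fix U assume "U \<in> carrier ?M"
      then obtain a where a: "a \<in> A" "U = B +> a" by (auto simp: car)
      obtain r where r: "r \<in> carrier R" "U = B +> (r \<otimes> w)" using Acar[OF a(1)] a(2) by auto
      have "r \<odot>\<^bsub>?M\<^esub> (B +> w) \<in> N 1" using submodule.smult_closed[OF N(1)[OF n(2)] r(1) wN] .
      then show "U \<in> N 1" unfolding r(2) using quot_module_smult[OF B r(1) wc, of A] by simp
    qed
    then show False using c12 sub[OF n(3)] by auto
  qed
  then show "z \<le> 1" using z by (simp add: one_enat_def)
qed

lemma ideal_saturation_ideal:
  assumes A: "ideal A R" and I: "ideal I R"
  shows "ideal (ideal_saturation R A I) R" "A \<subseteq> ideal_saturation R A I"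
proof -
  note Ac = ideal_closed[OF A]
  have Ic: "y \<in> carrier R" if "y \<in> ideal_pow R I n" for y n
    using ideal_closed(7)[OF ideal_pow_ideal[OF I] that] .
  show "A \<subseteq> ideal_saturation R A I"
  proof
    fix a assume a: "a \<in> A"
    have "a \<otimes> y \<in> A" if "y \<in> ideal_pow R I 0" for y using Ac(6)[OF a Ic[OF that]] .
    then show "a \<in> ideal_saturation R A I" using Ac(7)[OF a] unfolding ideal_saturation_def by blast
  qed
  show "ideal (ideal_saturation R A I) R"
  proof (rule cring_idealI)
    show "ideal_saturation R A I \<subseteq> carrier R" by (auto simp: ideal_saturation_def)
    show "\<zero> \<in> ideal_saturation R A I" using \<open>A \<subseteq> ideal_saturation R A I\<close> Ac(1) by auto
  next
    fix a b assume "a \<in> ideal_saturation R A I" "b \<in> ideal_saturation R A I"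
    then obtain k l where ab: "a \<in> carrier R" "b \<in> carrier R"
      "\<And>y. y \<in> ideal_pow R I k \<Longrightarrow> a \<otimes> y \<in> A" "\<And>y. y \<in> ideal_pow R I l \<Longrightarrow> b \<otimes> y \<in> A"
      by (auto simp: ideal_saturation_def)
    have "(a \<oplus> b) \<otimes> y \<in> A" if y: "y \<in> ideal_pow R I (max k l)" for y
    proof -
      have "y \<in> ideal_pow R I k" "y \<in> ideal_pow R I l"
        using y ideal_pow_decreasing[OF I, of _ "max k l"] by (meson max.cobounded1 max.cobounded2 subsetD)+
      then show ?thesis using ab Ac(2) Ic[OF y] by (simp add: l_distr)
    qed
    then show "a \<oplus> b \<in> ideal_saturation R A I" using ab by (auto simp: ideal_saturation_def)
  next
    fix a r assume "a \<in> ideal_saturation R A I" and r: "r \<in> carrier R"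
    then obtain k where a: "a \<in> carrier R" "\<And>y. y \<in> ideal_pow R I k \<Longrightarrow> a \<otimes> y \<in> A"
      by (auto simp: ideal_saturation_def)
    have "(r \<otimes> a) \<otimes> y \<in> A" if y: "y \<in> ideal_pow R I k" for y
      using ideal_closed(5)[OF A a(2)[OF y] r] a(1) r Ic[OF y] by (simp add: m_assoc)
    then show "r \<otimes> a \<in> ideal_saturation R A I" using a r by (auto simp: ideal_saturation_def)
  qed
qed

end

text \<open>Any \<open>w\<close> of \<open>A\<close> outside \<open>B\<close> works.
  \<open>B + (w)\<close> must be all of \<open>A\<close>. For \<open>t\<close> in \<open>m\<close>
  the ideal \<open>B + (t w)\<close> does not contain \<open>w\<close>, as
  \<open>\<one> \<ominus> r \<otimes> t\<close> is a unit, so it must be \<open>B\<close>. If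
  \<open>A = B\<close>, the witness is zero.\<close>

lemma (in noetherian_local_cring) quot_length_le_one_witness:
  assumes len: "module_length R (quot_module R A B) \<le> 1"
    and A: "ideal A R" and B: "ideal B R" and BA: "B \<subseteq> A"
  shows "\<exists>w\<in>A. (\<forall>a\<in>A. \<exists>s\<in>carrier R. a \<ominus> s \<otimes> w \<in> B) \<and> (\<forall>t\<in>m. t \<otimes> w \<in> B)"
proof (cases "A = B")
  case True
  have "a \<ominus> \<zero> \<otimes> \<zero> \<in> B" if "a \<in> A" for a
    using that True ideal_closed(7)[OF A] by (simp add: a_minus_def)
  then show ?thesis using True ideal_closed(1)[OF B] ideal_closed(7)[OF m_ideal]
    by (intro bexI[of _ \<zero>]) auto
next
  case False
  then obtain w where w: "w \<in> A" "w \<notin> B" using BA by auto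
  have wc: "w \<in> carrier R" using w ideal_closed(7)[OF A] by auto
  note iW = cgenideal_ideal[OF wc]
  have sumI: "ideal (B <+>\<^bsub>R\<^esub> V) R" if "ideal V R" for V by (intro add_ideals B that)
  have "\<exists>s\<in>carrier R. a \<ominus> s \<otimes> w \<in> B" if a: "a \<in> A" for a
  proof -
    have "B <+>\<^bsub>R\<^esub> PIdl w \<subseteq> A"
      using BA cgenideal_minimal[OF A w(1)] by (intro set_add_least[OF A]) auto
    moreover have "B \<subset> B <+>\<^bsub>R\<^esub> PIdl w"
      using set_add_incl[OF B iW] cgenideal_self[OF wc] w(2) by auto
    ultimately have "B <+>\<^bsub>R\<^esub> PIdl w = A"
      using quot_length_le_one_no_chain[OF len A B sumI[OF iW]] by auto
    then obtain b s where b: "b \<in> B" "s \<in> carrier R" "a = b \<oplus> s \<otimes> w"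
      using a by (auto simp: set_add_iff cgenideal_def)
    have "a \<ominus> s \<otimes> w = b" unfolding b(3) using b(2) wc ideal_closed(7)[OF B b(1)] by algebra
    then have "a \<ominus> s \<otimes> w \<in> B" using b(1) by simp
    then show ?thesis using b(2) by blast
  qed
  moreover have "t \<otimes> w \<in> B" if t: "t \<in> m" for t
  proof (rule ccontr)
    assume tw: "t \<otimes> w \<notin> B"
    have tc: "t \<in> carrier R" using t ideal_closed(7)[OF m_ideal] by auto
    have twc: "t \<otimes> w \<in> carrier R" using tc wc by simp
    note iT = cgenideal_ideal[OF twc]
    have "t \<otimes> w \<in> A" using ideal_closed(5)[OF A w(1) tc] .
    then have "B <+>\<^bsub>R\<^esub> PIdl (t \<otimes> w) \<subseteq> A"
      using BA cgenideal_minimal[OF A, of "t \<otimes> w"] by (intro set_add_least[OF A]) auto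
    moreover have "w \<notin> B <+>\<^bsub>R\<^esub> PIdl (t \<otimes> w)"
    proof
      assume "w \<in> B <+>\<^bsub>R\<^esub> PIdl (t \<otimes> w)"
      then obtain b r where b: "b \<in> B" "r \<in> carrier R" "w = b \<oplus> r \<otimes> (t \<otimes> w)"
        by (auto simp: set_add_iff cgenideal_def)
      have bc: "b \<in> carrier R" using b ideal_closed(7)[OF B] by auto
      have "(\<one> \<ominus> r \<otimes> t) \<otimes> w = w \<ominus> r \<otimes> (t \<otimes> w)" using b(2) tc wc by algebra
      also have "\<dots> = (b \<oplus> r \<otimes> (t \<otimes> w)) \<ominus> r \<otimes> (t \<otimes> w)" using b(3) by simp
      also have "\<dots> = b" using bc b(2) tc wc by algebra
      finally have "(\<one> \<ominus> r \<otimes> t) \<otimes> w \<in> B" using b by simp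
      moreover have "\<one> \<ominus> r \<otimes> t \<notin> m"
      proof
        assume "\<one> \<ominus> r \<otimes> t \<in> m"
        then have "(\<one> \<ominus> r \<otimes> t) \<oplus> r \<otimes> t \<in> m"
          using ideal_closed(2,5)[OF m_ideal] t b(2) by auto
        moreover have "(\<one> \<ominus> r \<otimes> t) \<oplus> r \<otimes> t = \<one>" using b(2) tc by algebra
        ultimately show False using one_notin_m by simp
      qed
      ultimately show False using ideal_unit_cancel[OF B, of "\<one> \<ominus> r \<otimes> t" w] b(2) tc wc w(2) by auto
    qed
    moreover have "B \<subset> B <+>\<^bsub>R\<^esub> PIdl (t \<otimes> w)"
      using set_add_incl[OF B iT] cgenideal_self[OF twc] tw by auto
    ultimately show False
      using quot_length_le_one_no_chain[OF len A B sumI[OF iT]] w(1) by auto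
  qed
  ultimately show ?thesis using w(1) by blast
qed

text \<open>Only the inclusion of \<open>x i\<close>, \<open>i < d - 1\<close>, in \<open>Q\<close> is needed: it makes the module in question
  a quotient of \<open>I\<^sup>2 / (J I + I\<^sup>3)\<close>.\<close>

lemma (in noetherian_local_cring) quotient_ring_length_le_one:
  fixes d :: nat
  assumes I: "ideal I R" and x: "\<And>i. i < d \<Longrightarrow> x i \<in> carrier R"
    and Q: "ideal Q R" "\<And>i. i < d - 1 \<Longrightarrow> x i \<in> Q"
    and w: "w \<in> ideal_pow R I 2"
    and span: "\<And>c. c \<in> ideal_pow R I 2 \<Longrightarrow> \<exists>s\<in>carrier R.
      c \<ominus> s \<otimes> w \<in> (Idl (x ` {..<d})) \<cdot> I <+>\<^bsub>R\<^esub> ideal_pow R I 3"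
    and soc: "\<And>t. t \<in> m \<Longrightarrow> t \<otimes> w \<in> (Idl (x ` {..<d})) \<cdot> I <+>\<^bsub>R\<^esub> ideal_pow R I 3"
  defines "R' \<equiv> R Quot Q"
  defines "I' \<equiv> Idl\<^bsub>R'\<^esub> ((\<lambda>a. Q +>\<^bsub>R\<^esub> a) ` I)"
  defines "y \<equiv> (if d = 0 then \<zero>\<^bsub>R'\<^esub> else Q +>\<^bsub>R\<^esub> x (d - 1))"
  shows "module_length R' (quot_module R' (ideal_pow R' I' 2)
    (((PIdl\<^bsub>R'\<^esub> y) \<cdot>\<^bsub>R'\<^esub> I') <+>\<^bsub>R'\<^esub> ideal_pow R' I' 3)) \<le> 1"
proof -
  define h where "h a = Q +> a" for a
  have R': "cring R'" unfolding R'_def using ideal.quotient_is_cring[OF Q(1) is_cring] .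
  have ringR': "ring R'" using R' by (rule cring.axioms)
  note hom = ideal.rcos_ring_hom[OF Q(1), folded R'_def]
  have hc: "h a \<in> carrier R'" if "a \<in> carrier R" for a
    unfolding h_def using ring_hom_closed[OF hom that] .
  have ha: "h (a \<oplus> b) = h a \<oplus>\<^bsub>R'\<^esub> h b" and hm: "h (a \<otimes> b) = h a \<otimes>\<^bsub>R'\<^esub> h b"
    if "a \<in> carrier R" "b \<in> carrier R" for a b
    unfolding h_def using ring_hom_add[OF hom that] ring_hom_mult[OF hom that] by auto
  have h1: "h \<one> = \<one>\<^bsub>R'\<^esub>" unfolding h_def using ring_hom_one[OF hom] .
  have h0: "h a = \<zero>\<^bsub>R'\<^esub>" if "a \<in> Q" for a
    unfolding h_def R'_def using a_rcos_zero[OF Q(1) that] by (simp add: FactRing_def)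
  have hsurj: "\<exists>a\<in>carrier R. b = h a" if "b \<in> carrier R'" for b
    using that by (auto simp: R'_def h_def FactRing_simps)
  note Rc = ring.ideal_closed[OF ringR']
  have h0': "h \<zero> = \<zero>\<^bsub>R'\<^esub>" using h0 ideal_closed(1)[OF Q(1)] by auto
  have img: "ideal (h ` C) R'" if C: "ideal C R" for C
  proof (rule cring.cring_idealI[OF R'])
    show "h ` C \<subseteq> carrier R'" using hc ideal_closed(7)[OF C] by auto
    show "\<zero>\<^bsub>R'\<^esub> \<in> h ` C" using h0' ideal_closed(1)[OF C] by (metis image_eqI)
    fix a b assume "a \<in> h ` C" "b \<in> h ` C"
    then show "a \<oplus>\<^bsub>R'\<^esub> b \<in> h ` C"
      using ideal_closed(2,7)[OF C] by (auto simp flip: ha)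
  next
    fix a r assume "a \<in> h ` C" "r \<in> carrier R'"
    then show "r \<otimes>\<^bsub>R'\<^esub> a \<in> h ` C"
      using hsurj[of r] ideal_closed(5,7)[OF C] by (auto simp flip: hm)
  qed
  have iI': "ideal I' R'" unfolding I'_def
    using hc ideal_closed(7)[OF I] by (intro ring.genideal_ideal[OF ringR']) (auto simp: h_def)
  have I'img: "I' = h ` I"
  proof
    show "I' \<subseteq> h ` I" unfolding I'_def using ring.Idl_least[OF ringR' img[OF I]] by (simp add: h_def)
    show "h ` I \<subseteq> I'" unfolding I'_def h_def
      by (rule ring.genideal_self[OF ringR']) (use hc ideal_closed(7)[OF I] in \<open>auto simp: h_def\<close>)
  qed
  have iP': "ideal (ideal_pow R' I' k) R'" for k by (rule cring.ideal_pow_ideal[OF R' iI'])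
  have pre: "ideal {a \<in> carrier R. h a \<in> C} R" if C: "ideal C R'" for C
    using Rc(1,2,5)[OF C] h0' hc by (intro cring_idealI) (auto simp: ha hm)
  have pow_img: "ideal_pow R' I' k = h ` ideal_pow R I k" for k
  proof (induction k)
    case 0
    then show ?case unfolding ideal_pow_0 using hc hsurj by auto
  next
    case (Suc k)
    note ik = ideal_pow_ideal[OF I, of k]
    have "ideal_pow R' I' k \<cdot>\<^bsub>R'\<^esub> I' \<subseteq> h ` (ideal_pow R I k \<cdot> I)"
    proof (rule ring.ideal_prod_least[OF ringR' img])
      show "ideal (ideal_pow R I k \<cdot> I) R" by (intro ideal_prod_is_ideal ik I)
      fix a b assume "a \<in> ideal_pow R' I' k" "b \<in> I'"
      then have "a \<in> h ` ideal_pow R I k" "b \<in> h ` I" using Suc I'img by auto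
      then obtain a' b' where "a' \<in> ideal_pow R I k" "b' \<in> I" "a = h a'" "b = h b'" by auto
      then show "a \<otimes>\<^bsub>R'\<^esub> b \<in> h ` (ideal_pow R I k \<cdot> I)"
        using ideal_closed(7)[OF ik] ideal_closed(7)[OF I] by (auto simp flip: hm intro: ideal_prod.prod)
    qed
    moreover have "ideal_pow R I k \<cdot> I \<subseteq> {a \<in> carrier R. h a \<in> ideal_pow R' I' (Suc k)}"
    proof (rule ideal_prod_least[OF pre[OF iP']])
      fix a b assume ab: "a \<in> ideal_pow R I k" "b \<in> I"
      then have "h a \<in> ideal_pow R' I' k" "h b \<in> I'" using Suc I'img by auto
      then have "h a \<otimes>\<^bsub>R'\<^esub> h b \<in> ideal_pow R' I' (Suc k)"
        unfolding ideal_pow_Suc by (rule ideal_prod.prod)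
      then show "a \<otimes> b \<in> {a \<in> carrier R. h a \<in> ideal_pow R' I' (Suc k)}"
        using ab ideal_closed(7)[OF ik] ideal_closed(7)[OF I] by (simp add: hm)
    qed
    ultimately show ?case unfolding ideal_pow_Suc by auto
  qed
  define B' where "B' = ((PIdl\<^bsub>R'\<^esub> y) \<cdot>\<^bsub>R'\<^esub> I') <+>\<^bsub>R'\<^esub> ideal_pow R' I' 3"
  have yc: "y \<in> carrier R'"
  proof (cases "d = 0")
    case True
    then show ?thesis using hc[OF zero_closed] h0' by (simp add: y_def)
  next
    case False
    then have "y = h (x (d - 1))" by (simp add: y_def h_def)
    moreover have "d - 1 < d" using False by simp
    ultimately show ?thesis using hc[OF x] by simp
  qed
  have iPy: "ideal (PIdl\<^bsub>R'\<^esub> y) R'" by (rule cring.cgenideal_ideal[OF R' yc])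
  have iPyI: "ideal ((PIdl\<^bsub>R'\<^esub> y) \<cdot>\<^bsub>R'\<^esub> I') R'" by (rule ring.ideal_prod_is_ideal[OF ringR' iPy iI'])
  have iB': "ideal B' R'" unfolding B'_def by (rule ring.add_ideals[OF ringR' iPyI iP'])
  note B'i = ring.set_add_incl[OF ringR' iPyI iP'[of 3], folded B'_def]
  have xc: "x ` {..<d} \<subseteq> carrier R" using x by auto
  have "(Idl (x ` {..<d})) \<cdot> I \<subseteq> {a \<in> carrier R. h a \<in> B'}"
  proof (rule ideal_prod_least[OF pre[OF iB']])
    fix a b assume a: "a \<in> Idl (x ` {..<d})" and b: "b \<in> I"
    have bc: "b \<in> carrier R" using b ideal_closed(7)[OF I] by auto
    \<comment> \<open>For fixed \<open>b\<close> this set is an ideal, so testing the generators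
      \<open>x i\<close> is enough.\<close>
    let ?K = "{a \<in> carrier R. h (a \<otimes> b) \<in> B'}"
    have "ideal ?K R"
      using Rc(1,2,5)[OF iB'] h0' hc bc
      by (intro cring_idealI) (auto simp: ha hm l_distr m_assoc)
    moreover have "x i \<in> ?K" if i: "i < d" for i
    \<comment> \<open>Elements before the last one lie in \<open>Q\<close> and become zero in
      \<open>R'\<close>; the last one maps to \<open>y\<close>. For \<open>d = 0\<close> there is no
      index to consider.\<close>
    proof (cases "i < d - 1")
      case True
      then have "x i \<otimes> b \<in> Q" using Q(2) ideal_closed(6)[OF Q(1)] bc by auto
      then have "h (x i \<otimes> b) = \<zero>\<^bsub>R'\<^esub>" by (rule h0)
      then show ?thesis using x[OF i] Rc(1)[OF iB'] by simp
    next
      case False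
      then have "i = d - 1" using i by auto
      then have "y = h (x i)" using i by (auto simp: y_def h_def)
      then have "h (x i) \<otimes>\<^bsub>R'\<^esub> h b \<in> (PIdl\<^bsub>R'\<^esub> y) \<cdot>\<^bsub>R'\<^esub> I'"
        using b ring.cgenideal_self[OF ringR' yc] by (intro ideal_prod.prod) (auto simp: I'img)
      then show ?thesis using B'i(1) x[OF i] bc by (auto simp: hm)
    qed
    ultimately have "Idl (x ` {..<d}) \<subseteq> ?K" by (intro Idl_least) auto
    then show "a \<otimes> b \<in> {a \<in> carrier R. h a \<in> B'}"
      using a bc ideal_closed(7)[OF genideal_ideal[OF xc] a] by auto
  qed
  moreover have "ideal_pow R I 3 \<subseteq> {a \<in> carrier R. h a \<in> B'}"
    using B'i(2) pow_img[of 3] ideal_closed(7)[OF ideal_pow_ideal[OF I]] by auto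
  ultimately have NB: "(Idl (x ` {..<d})) \<cdot> I <+>\<^bsub>R\<^esub> ideal_pow R I 3 \<subseteq> {a \<in> carrier R. h a \<in> B'}"
    by (intro set_add_least pre iB')
  have wc: "w \<in> carrier R" using w ideal_closed(7)[OF ideal_pow_ideal[OF I]] by auto
  have "module_length R' (quot_module R' (ideal_pow R' I' 2) B') \<le> 1"
  proof (rule cring.quot_length_le_one[OF R' iP' iB', of "h w"])
    show "h w \<in> ideal_pow R' I' 2" using w pow_img[of 2] by auto
    fix a' assume "a' \<in> ideal_pow R' I' 2"
    then obtain a where a: "a \<in> ideal_pow R I 2" "a' = h a" using pow_img[of 2] by auto
    then have ac: "a \<in> carrier R" using ideal_closed(7)[OF ideal_pow_ideal[OF I]] by auto
    obtain s where s: "s \<in> carrier R" "a \<ominus> s \<otimes> w \<in> (Idl (x ` {..<d})) \<cdot> I <+>\<^bsub>R\<^esub> ideal_pow R I 3"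
      using span[OF a(1)] by auto
    have eq: "a = (a \<ominus> s \<otimes> w) \<oplus> s \<otimes> w" using ac s(1) wc by algebra
    have dc: "a \<ominus> s \<otimes> w \<in> carrier R" using ac s(1) wc by simp
    have c': "h (a \<ominus> s \<otimes> w) \<in> carrier R'" "h s \<in> carrier R'" "h w \<in> carrier R'" using hc dc s wc by auto
    have "h a = h (a \<ominus> s \<otimes> w) \<oplus>\<^bsub>R'\<^esub> h s \<otimes>\<^bsub>R'\<^esub> h w"
      using ha[of "a \<ominus> s \<otimes> w" "s \<otimes> w"] hm s(1) wc dc eq by simp
    then have "a' \<ominus>\<^bsub>R'\<^esub> h s \<otimes>\<^bsub>R'\<^esub> h w = h (a \<ominus> s \<otimes> w)"
      unfolding a(2) using c' ringR'
      by (simp add: a_minus_def ring.ring_simprules)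
    then show "\<exists>s\<in>carrier R'. a' \<ominus>\<^bsub>R'\<^esub> s \<otimes>\<^bsub>R'\<^esub> h w \<in> B'"
      using NB s(2) hc[OF s(1)] by (intro bexI[of _ "h s"]) auto
  next
    fix s' assume "s' \<in> carrier R'"
    then obtain s where s: "s \<in> carrier R" "s' = h s" using hsurj by auto
    show "s' \<otimes>\<^bsub>R'\<^esub> h w \<in> B' \<or> (\<exists>t\<in>carrier R'. t \<otimes>\<^bsub>R'\<^esub> s' = \<one>\<^bsub>R'\<^esub>)"
    proof (cases "s \<in> m")
      case True
      then have "h (s \<otimes> w) \<in> B'" using soc NB by auto
      then show ?thesis using s wc by (simp add: hm)
    next
      case False
      then obtain t where t: "t \<in> carrier R" "t \<otimes> s = \<one>" using unit_of_notin_m[OF s(1)] by auto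
      then have "h t \<otimes>\<^bsub>R'\<^esub> h s = \<one>\<^bsub>R'\<^esub>" using hm[OF t(1) s(1)] h1 by simp
      then show ?thesis using hc t s by auto
    qed
  qed
  then show ?thesis unfolding B'_def .
qed

text \<open>The passage from the special reduction to a general one. \<open>p\<close> is a product
  of three polynomial functions, responsible for the reduction property, the generation by
  \<open>w\<close>, and \<open>m w = 0\<close>. Minimality follows from the first because
  \<open>J L\<close> has \<open>d\<close> generators.\<close>

lemma (in reduction_family) generic_minimal_reduction:
  assumes Im: "I \<subseteq> m" and mI: "ideal_pow R m c \<subseteq> I" and dim: "krull_dim R = enat d"
    and ys: "length ys = d" "set ys \<subseteq> m" "ideal_pow R m N0 \<subseteq> Idl (set ys)"
    and str: "stretched R I"
  shows "\<exists>p\<in>poly_funs R idx. (\<exists>L1 \<in> idx \<rightarrow> carrier R. p L1 \<notin> m) \<and>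
    (\<forall>L \<in> idx \<rightarrow> carrier R. p L \<notin> m \<longrightarrow> minimal_reduction R (J L) I \<and>
      (\<exists>w\<in>ideal_pow R I 2. (\<forall>c\<in>ideal_pow R I 2. \<exists>s\<in>carrier R. c \<ominus> s \<otimes> w \<in> J L \<cdot> I <+>\<^bsub>R\<^esub> ideal_pow R I 3) \<and>
        (\<forall>t\<in>m. t \<otimes> w \<in> J L \<cdot> I <+>\<^bsub>R\<^esub> ideal_pow R I 3)))"
proof -
  obtain J0 where J0: "minimal_reduction R J0 I" and cap: "J0 \<inter> ideal_pow R I 2 = J0 \<cdot> I"
    and len: "hilbert_fun_mod R I J0 2 \<le> 1" using str by (auto simp: stretched_def)
  have red0: "reduction R J0 I" and iJ0: "ideal J0 R" and J0I: "J0 \<subseteq> I"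
    using J0 by (auto simp: minimal_reduction_def reduction_def)
  note iP = ideal_pow_ideal[OF I_ideal]
  have II: "ideal_pow R I 2 = I \<cdot> I"
    using ideal_pow_Suc[of R I 1] ideal_pow_one[OF I_ideal] by (simp add: numeral_2_eq_2)
  have P32: "ideal_pow R I 3 \<subseteq> ideal_pow R I 2" by (rule ideal_pow_decreasing[OF I_ideal]) simp
  have "\<exists>x \<in> {..<length ys} \<rightarrow> carrier R. J0 = Idl (x ` {..<length ys})"
    by (rule minimal_reduction_generators[OF I_ideal Im mI J0 ys(2,3)])
  then obtain x where x: "x \<in> {..<d} \<rightarrow> carrier R" "J0 = Idl (x ` {..<d})" using ys(1) by auto
  have "\<exists>c \<in> {..<length as} \<rightarrow> carrier R. x i = (\<Oplus>j\<in>{..<length as}. c j \<otimes> as ! j)" if "i < d" for i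
  proof -
    have "x ` {..<d} \<subseteq> carrier R" using x by auto
    then have "x i \<in> I" using genideal_self[of "x ` {..<d}"] x J0I that by auto
    moreover have "(!) as ` {..<length as} = set as" by (auto simp: set_conv_nth)
    then have "I = Idl ((!) as ` {..<length as})" by (simp add: I_def)
    moreover have "(!) as \<in> {..<length as} \<rightarrow> carrier R" using as_carrier nth_mem by auto
    ultimately show ?thesis using Idl_image[of "{..<length as}" "(!) as"] by auto
  qed
  then obtain C where C: "\<And>i. i < d \<Longrightarrow> C i \<in> {..<length as} \<rightarrow> carrier R"
    "\<And>i. i < d \<Longrightarrow> x i = (\<Oplus>j\<in>{..<length as}. C i j \<otimes> as ! j)" by metis
  \<comment> \<open>The coefficients of the \<open>d\<close> generators of \<open>J0\<close> with
    respect to the list \<open>as\<close> make \<open>J0\<close> a member of the family.\<close>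
  define L0 where "L0 = (\<lambda>(i, j). C i j)"
  have L0: "L0 \<in> idx \<rightarrow> carrier R" using C(1) by (auto simp: L0_def idx_def Pi_iff)
  have "lin_comb R as L0 i = x i" if "i < d" for i using C(2)[OF that] by (simp add: lin_comb_def L0_def)
  then have JL0: "J L0 = J0" unfolding J_def x(2) by (metis (no_types, lifting) image_cong lessThan_iff)
  obtain u1 where u1: "u1 \<in> poly_funs R idx" "u1 L0 \<notin> m"
    "\<And>L. L \<in> idx \<rightarrow> carrier R \<Longrightarrow> u1 L \<notin> m \<Longrightarrow> reduction R (J L) I"
    using open_reduction[OF L0] red0 unfolding JL0 by blast
  define A B where "A = ideal_pow R I 2 <+>\<^bsub>R\<^esub> J0" and "B = ideal_pow R I 3 <+>\<^bsub>R\<^esub> J0"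
  have iA: "ideal A R" and iB: "ideal B R" unfolding A_def B_def by (intro add_ideals iP iJ0)+
  note Ai = set_add_incl[OF iP[of 2] iJ0, folded A_def] and Bi = set_add_incl[OF iP[of 3] iJ0, folded B_def]
  have "B \<subseteq> A" using Ai P32 unfolding B_def by (intro set_add_least[OF iA]) auto
  moreover have "module_length R (quot_module R A B) \<le> 1"
    using len by (simp add: hilbert_fun_mod_def A_def B_def numeral_3_eq_3 numeral_2_eq_2 del: nat_pow_Suc)
  ultimately obtain w0 where w0: "w0 \<in> A" "\<And>a. a \<in> A \<Longrightarrow> \<exists>s\<in>carrier R. a \<ominus> s \<otimes> w0 \<in> B"
    "\<And>t. t \<in> m \<Longrightarrow> t \<otimes> w0 \<in> B" using quot_length_le_one_witness[OF _ iA iB] by blast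
  \<comment> \<open>The generator is moved from \<open>I^2 + J0\<close> into \<open>I^2\<close>; the
    discarded part \<open>j\<close> lies in \<open>B\<close>.\<close>
  obtain w j where w: "w \<in> ideal_pow R I 2" and j: "j \<in> J0" and w0eq: "w0 = w \<oplus> j"
    using w0(1) by (auto simp: A_def set_add_iff)
  have wc: "w \<in> carrier R" "j \<in> carrier R" using w j ideal_closed(7)[OF iP] ideal_closed(7)[OF iJ0] by auto
  \<comment> \<open>Here \<open>J0 \<inter> I^2 = J0 I\<close> enters. If an element of
    \<open>B\<close> lies in \<open>I^2\<close>, then so does its \<open>J0\<close>-component,
    because the other component lies in \<open>I^3\<close>; the \<open>J0\<close>-component is
    therefore in \<open>J0 I\<close>.\<close>
  have BN: "v \<in> J0 \<cdot> I <+>\<^bsub>R\<^esub> ideal_pow R I 3" if v: "v \<in> B" "v \<in> ideal_pow R I 2" for v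
  proof -
    obtain a b where ab: "a \<in> ideal_pow R I 3" "b \<in> J0" "v = a \<oplus> b" using v(1) by (auto simp: B_def set_add_iff)
    have c: "a \<in> carrier R" "b \<in> carrier R" using ab ideal_closed(7)[OF iP] ideal_closed(7)[OF iJ0] by auto
    have "b = v \<ominus> a" unfolding ab(3) using c by algebra
    then have "b \<in> ideal_pow R I 2" using ideal_closed(4)[OF iP v(2)] ab(1) P32 by auto
    then have "b \<in> J0 \<cdot> I" using ab(2) cap by auto
    moreover have "v = b \<oplus> a" unfolding ab(3) using c by (rule a_comm)
    ultimately show ?thesis unfolding set_add_iff using ab(1) by blast
  qed
  have span0: "\<exists>s\<in>carrier R. c \<ominus> s \<otimes> w \<in> J L0 \<cdot> I <+>\<^bsub>R\<^esub> ideal_pow R I 3" if c: "c \<in> I \<cdot> I" for c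
  proof -
    have c2: "c \<in> ideal_pow R I 2" using c II by simp
    then have cc: "c \<in> carrier R" using ideal_closed(7)[OF iP] by auto
    obtain s where s: "s \<in> carrier R" "c \<ominus> s \<otimes> w0 \<in> B" using w0(2) c2 Ai by blast
    have "c \<ominus> s \<otimes> w = (c \<ominus> s \<otimes> w0) \<oplus> s \<otimes> j" unfolding w0eq using cc s(1) wc by algebra
    moreover have "s \<otimes> j \<in> B" using ideal_closed(5)[OF iB _ s(1)] j Bi by auto
    ultimately have "c \<ominus> s \<otimes> w \<in> B" using ideal_closed(2)[OF iB s(2)] by simp
    moreover have "c \<ominus> s \<otimes> w \<in> ideal_pow R I 2"
      using ideal_closed(4)[OF iP c2 ideal_closed(5)[OF iP w s(1)]] .
    ultimately show ?thesis using BN s(1) unfolding JL0 by auto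
  qed
  have soc0: "t \<otimes> w \<in> J L0 \<cdot> I <+>\<^bsub>R\<^esub> ideal_pow R I 3" if t: "t \<in> m" for t
  proof -
    have tc: "t \<in> carrier R" using t ideal_closed(7)[OF m_ideal] by auto
    have "t \<otimes> w = t \<otimes> w0 \<ominus> t \<otimes> j" unfolding w0eq using tc wc by algebra
    moreover have "t \<otimes> j \<in> B" using ideal_closed(5)[OF iB _ tc] j Bi by auto
    ultimately have "t \<otimes> w \<in> B" using ideal_closed(4)[OF iB w0(3)[OF t]] by simp
    then show ?thesis using BN ideal_closed(5)[OF iP w tc] unfolding JL0 by auto
  qed
  obtain f where f: "f \<in> poly_funs R idx" "f L0 \<notin> m"
    "\<And>c. c \<in> I \<cdot> I \<Longrightarrow> \<exists>s\<in>poly_funs R idx.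
      \<forall>L \<in> idx \<rightarrow> carrier R. f L \<otimes> c \<ominus> s L \<otimes> w \<in> J L \<cdot> I <+>\<^bsub>R\<^esub> ideal_pow R I 3"
    using open_span[OF L0 wc(1) I_ideal iP span0] by blast
  obtain q L1 where q: "q \<in> poly_funs R idx" and L1: "L1 \<in> idx \<rightarrow> carrier R" "q L1 \<notin> m"
    and qs: "\<And>L t. L \<in> idx \<rightarrow> carrier R \<Longrightarrow> q L \<notin> m \<Longrightarrow> t \<in> m \<Longrightarrow> t \<otimes> w \<in> J L \<cdot> I <+>\<^bsub>R\<^esub> ideal_pow R I 3"
    using open_socle[OF L0 wc(1) iP f(1,2) f(3) soc0] by blast
  define p where "p L = (u1 L \<otimes> f L) \<otimes> q L" for L
  have uf: "(\<lambda>L. u1 L \<otimes> f L) \<in> poly_funs R idx" by (rule poly_funs.mult[OF u1(1) f(1)])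
  have p: "p \<in> poly_funs R idx" unfolding p_def[abs_def] by (rule poly_funs.mult[OF uf q])
  \<comment> \<open>\<open>u1\<close> and \<open>f\<close> are units at \<open>L0\<close>, but
    \<open>q\<close> is known to be one at \<open>L1\<close>; \<open>poly_funs_common_point\<close>
    supplies a common parameter.\<close>
  have "u1 L0 \<otimes> f L0 \<notin> m"
    using u1(2) f(2) primeideal.I_prime[OF m_prime] poly_funs_closed[OF u1(1) L0] poly_funs_closed[OF f(1) L0] by blast
  then have "\<exists>L \<in> idx \<rightarrow> carrier R. p L \<notin> m"
    unfolding p_def using poly_funs_common_point[OF uf q L0 _ L1] by blast
  moreover have "minimal_reduction R (J L) I \<and>
      (\<exists>w\<in>ideal_pow R I 2. (\<forall>c\<in>ideal_pow R I 2. \<exists>s\<in>carrier R. c \<ominus> s \<otimes> w \<in> J L \<cdot> I <+>\<^bsub>R\<^esub> ideal_pow R I 3) \<and>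
        (\<forall>t\<in>m. t \<otimes> w \<in> J L \<cdot> I <+>\<^bsub>R\<^esub> ideal_pow R I 3))"
    if L: "L \<in> idx \<rightarrow> carrier R" and pL: "p L \<notin> m" for L
  proof -
    have uc: "u1 L \<in> carrier R" "f L \<in> carrier R" "q L \<in> carrier R"
      using poly_funs_closed[OF u1(1) L] poly_funs_closed[OF f(1) L] poly_funs_closed[OF q L] by auto
    have n: "u1 L \<notin> m" "f L \<notin> m" "q L \<notin> m"
      using pL uc ideal_closed(5,6)[OF m_ideal] by (auto simp: p_def)
    have lc: "lin_comb R as L \<in> {..<d} \<rightarrow> carrier R" using lin_comb_closed[OF L] by auto
    have minr: "minimal_reduction R (J L) I"
      by (rule minimal_reductionI[OF I_ideal Im mI u1(3)[OF L n(1)] lc _ dim]) (simp add: J_def)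
    have iN: "ideal (J L \<cdot> I <+>\<^bsub>R\<^esub> ideal_pow R I 3) R"
      by (intro add_ideals ideal_prod_is_ideal J_ideal L I_ideal iP)
    have "\<exists>s\<in>carrier R. z \<ominus> s \<otimes> w \<in> J L \<cdot> I <+>\<^bsub>R\<^esub> ideal_pow R I 3"
      if z: "z \<in> ideal_pow R I 2" for z
    proof -
      have zc: "z \<in> carrier R" using z ideal_closed(7)[OF iP] by auto
      obtain s where s: "s \<in> poly_funs R idx" "f L \<otimes> z \<ominus> s L \<otimes> w \<in> J L \<cdot> I <+>\<^bsub>R\<^esub> ideal_pow R I 3"
        using f(3)[of z] z II L by blast
      have sc: "s L \<in> carrier R" by (rule poly_funs_closed[OF s(1) L])
      obtain v where v: "v \<in> carrier R" "v \<otimes> f L = \<one>" using unit_of_notin_m[OF uc(2) n(2)] by auto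
      have "v \<otimes> (f L \<otimes> z \<ominus> s L \<otimes> w) = (v \<otimes> f L) \<otimes> z \<ominus> (v \<otimes> s L) \<otimes> w"
        using v(1) uc(2) zc sc wc(1) by algebra
      also have "\<dots> = z \<ominus> (v \<otimes> s L) \<otimes> w" unfolding v(2) using zc by simp
      finally have "z \<ominus> (v \<otimes> s L) \<otimes> w \<in> J L \<cdot> I <+>\<^bsub>R\<^esub> ideal_pow R I 3"
        using ideal_closed(5)[OF iN s(2) v(1)] by simp
      then show ?thesis using v(1) sc by blast
    qed
    then show ?thesis using minr w qs[OF L n(3)] by blast
  qed
  ultimately show ?thesis using p by blast
qed

theorem corollary2p8:
  fixes R :: "('a, 'b) ring_scheme" and m I :: "'a set"
  assumes "cohen_macaulay_local R m"
    and "equicharacteristic R m"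
    and "infinite (carrier (R Quot m))"
    and "primary_to R m I"
    and "stretched R I"
  shows "j_stretched R m I"
proof -
  obtain d ys N0 where d: "krull_dim R = enat d" and ys: "length ys = d" "set ys \<subseteq> m"
    "ideal_pow R m N0 \<subseteq> Idl\<^bsub>R\<^esub> (set ys)" using cohen_macaulay_system_of_parameters[OF assms(1)] by blast
  interpret infinite_residue_local_cring R m
    using assms(1,3) by (auto simp: cohen_macaulay_local_def noetherian_local_def noetherian_local_cring_def
        noetherian_local_cring_axioms_def noetherian_cring_def infinite_residue_local_cring_def
        infinite_residue_local_cring_axioms_def)
  have iI: "ideal I R" and Ine: "I \<noteq> carrier R" and rad: "ideal_radical R I = m"
    using assms(4) by (auto simp: primary_to_def primary_ideal_def)
  have Im: "I \<subseteq> m" by (rule proper_ideal_le_m[OF iI Ine])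
  have "\<exists>k::nat. t [^]\<^bsub>R\<^esub> k \<in> I" if "t \<in> m" for t using that rad by (auto simp: ideal_radical_def)
  \<comment> \<open>Every element of \<open>m\<close> has a power in \<open>I\<close>, and
    \<open>m\<close> is finitely generated, so a power of \<open>m\<close> lies in
    \<open>I\<close>.\<close>
  then obtain c where mI: "ideal_pow R m c \<subseteq> I" using power_in_ideal[OF m_ideal iI] by blast
  have "for_general_minimal_reduction R m I d (\<lambda>x.
          let Q = ideal_saturation R (Idl\<^bsub>R\<^esub> (x ` {..<d - 1})) I;
              R' = R Quot Q;
              I' = Idl\<^bsub>R'\<^esub> ((\<lambda>a. Q +>\<^bsub>R\<^esub> a) ` I);
              y = (if d = 0 then \<zero>\<^bsub>R'\<^esub> else Q +>\<^bsub>R\<^esub> x (d - 1))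
          in module_length R'
               (quot_module R' (ideal_pow R' I' 2)
                 (((PIdl\<^bsub>R'\<^esub> y) \<cdot>\<^bsub>R'\<^esub> I') <+>\<^bsub>R'\<^esub> ideal_pow R' I' 3)) \<le> 1)"
    unfolding for_general_minimal_reduction_def Let_def
  proof (intro allI impI, goal_cases)
    case (1 as)
    note as = this
    define S where "S = {..<d} \<times> {..<length as}"
    have fam: "reduction_family R m as"
      using as by (simp add: reduction_family_def reduction_family_axioms_def infinite_residue_local_cring_axioms)
    have famI: "reduction_family.I R as = I" using as by (simp add: reduction_family.I_def[OF fam])
    have idx: "reduction_family.idx as d = S" by (simp add: reduction_family.idx_def[OF fam] S_def)
    have famJ: "reduction_family.J R as d L = Idl\<^bsub>R\<^esub> (lin_comb R as L ` {..<d})" for L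
      by (simp add: reduction_family.J_def[OF fam])
    obtain p L1 where p: "p \<in> poly_funs R S" and L1: "L1 \<in> S \<rightarrow> carrier R" "p L1 \<notin> m"
      and good: "\<And>L. L \<in> S \<rightarrow> carrier R \<Longrightarrow> p L \<notin> m \<Longrightarrow>
        minimal_reduction R (Idl\<^bsub>R\<^esub> (lin_comb R as L ` {..<d})) I \<and>
        (\<exists>w\<in>ideal_pow R I 2. (\<forall>c\<in>ideal_pow R I 2. \<exists>s\<in>carrier R. c \<ominus>\<^bsub>R\<^esub> s \<otimes>\<^bsub>R\<^esub> w
            \<in> (Idl\<^bsub>R\<^esub> (lin_comb R as L ` {..<d})) \<cdot>\<^bsub>R\<^esub> I <+>\<^bsub>R\<^esub> ideal_pow R I 3) \<and>
          (\<forall>t\<in>m. t \<otimes>\<^bsub>R\<^esub> w \<in> (Idl\<^bsub>R\<^esub> (lin_comb R as L ` {..<d})) \<cdot>\<^bsub>R\<^esub> I <+>\<^bsub>R\<^esub> ideal_pow R I 3))"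
      using reduction_family.generic_minimal_reduction[OF fam, where d = d and c = c and ys = ys and ?N0.0 = N0,
          unfolded famI idx famJ, OF Im mI d ys assms(5)] by blast
    obtain U where U: "zariski_open (R Quot m) S U" "zariski_dense (R Quot m) S U"
      "\<And>L. L \<in> S \<rightarrow> carrier R \<Longrightarrow> (\<lambda>s\<in>S. m +>\<^bsub>R\<^esub> L s) \<in> U \<Longrightarrow> p L \<notin> m"
      using generic_open[OF p L1] by blast
    \<comment> \<open>The abbreviations of the definition are turned into variables with defining
      equations, which are discharged by \<open>refl\<close> at the end.\<close>
    have main: "minimal_reduction R (Idl\<^bsub>R\<^esub> (x ` {..<d})) I \<and>
        module_length (R Quot Q) (quot_module (R Quot Q) (ideal_pow (R Quot Q) I' 2)
          (((PIdl\<^bsub>R Quot Q\<^esub> y) \<cdot>\<^bsub>R Quot Q\<^esub> I') <+>\<^bsub>R Quot Q\<^esub> ideal_pow (R Quot Q) I' 3)) \<le> 1"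
      if L: "L \<in> S \<rightarrow> carrier R" "(\<lambda>s\<in>S. m +>\<^bsub>R\<^esub> L s) \<in> U"
        and x: "x = (\<lambda>i. \<Oplus>\<^bsub>R\<^esub>j\<in>{..<length as}. L (i, j) \<otimes>\<^bsub>R\<^esub> as ! j)"
        and Q: "Q = ideal_saturation R (Idl\<^bsub>R\<^esub> (x ` {..<d - 1})) I"
        and I': "I' = Idl\<^bsub>R Quot Q\<^esub> ((\<lambda>a. Q +>\<^bsub>R\<^esub> a) ` I)"
        and y: "y = (if d = 0 then \<zero>\<^bsub>R Quot Q\<^esub> else Q +>\<^bsub>R\<^esub> x (d - 1))" for L x Q I' y
    proof -
      have xl: "x = lin_comb R as L" unfolding x lin_comb_def by simp
      note g = good[OF L(1) U(3)[OF L], folded xl]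
      have xc: "x i \<in> carrier R" if "i < d" for i
        using reduction_family.lin_comb_closed[OF fam, of L d] L(1) that unfolding xl idx by auto
      then have xc': "x ` {..<d - 1} \<subseteq> carrier R" by auto
      note sat = ideal_saturation_ideal[OF genideal_ideal[OF xc'] iI, folded Q]
      have xQ: "x i \<in> Q" if "i < d - 1" for i using genideal_self[OF xc'] sat(2) that by auto
      obtain w where w: "w \<in> ideal_pow R I 2"
        "\<And>c. c \<in> ideal_pow R I 2 \<Longrightarrow> \<exists>s\<in>carrier R. c \<ominus>\<^bsub>R\<^esub> s \<otimes>\<^bsub>R\<^esub> w
            \<in> (Idl\<^bsub>R\<^esub> (x ` {..<d})) \<cdot>\<^bsub>R\<^esub> I <+>\<^bsub>R\<^esub> ideal_pow R I 3"
        "\<And>t. t \<in> m \<Longrightarrow> t \<otimes>\<^bsub>R\<^esub> w \<in> (Idl\<^bsub>R\<^esub> (x ` {..<d})) \<cdot>\<^bsub>R\<^esub> I <+>\<^bsub>R\<^esub> ideal_pow R I 3"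
        using g by blast
      show ?thesis
        using g quotient_ring_length_le_one[OF iI xc sat(1) xQ w] unfolding I' y by blast
    qed
    show ?case
      unfolding S_def[symmetric]
      using main[OF _ _ refl refl refl refl] by (intro exI[of _ U] conjI U ballI impI) blast+
  qed
  then show ?thesis unfolding j_stretched_def using d by blast
qed

end
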